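(* Let $X$ be a topological space, let $\mathcal H=(\mathcal H_j)_{j\ge0}$ be a sheaf of AQ central series on $X$ with linearisation $\mathcal A=\bigoplus_j\mathcal A_j$, and suppose its first primary cohomology vanishes, ${\bf H}^1_\partial(X,\mathcal A)=(0)$. Then for any $j$ and any $\theta\in H^1(X,\mathcal A_j)$ the following are equivalent: (i) $\theta$ integrates to an $\mathcal H_j$-torsor, i.e. there is $h\in\check H^1(X,\mathcal H_j)$ with $\omega_{j*}(h)=\theta$; (ii) $\partial\theta=0$, where $\partial:H^1(X,\mathcal A_j)\to H^2(X,\mathcal A_{j+1})$ is the map in the primary complex of $\mathcal H$.
   Context: A sheaf of AQ normal series on $X$ is a finite descending collection of sheaves of groups $\mathcal G=\mathcal H_0\supseteq \mathcal H_1\supseteq\cdots\supseteq\mathcal H_N=\{e\}$ on $X$ (put $\mathcal H_j=\{e\}$ for $j\ge N$) such that each $\mathcal H_j$ is a sheaf of normal subgroups of $\mathcal G$ and each quotient $\mathcal A_j=\mathcal H_j/\mathcal H_{j+1}$ is a sheaf of abelian groups ($\mathcal A_j=0$ for $j<0$). It is central (an AQ central series) if for each $j>0$ there exists some $k<j$ such that $\mathcal A_j$ lies in the centre of $\mathcal H_k/\mathcal H_{j+1}$. The linearisation is the $\mathbb Z$-graded abelian sheaf $\mathcal A=\bigoplus_j\mathcal A_j$. $\check H^1(X,\mathcal H_j)$ is the non-abelian Čech cohomology pointed set; its elements are ($\mathcal H_j$-)torsors. The map $\omega_{j*}:\check H^1(X,\mathcal H_j)\to H^1(X,\mathcal A_j)$,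 the $j$-th linearisation map, is induced by the quotient $\mathcal H_j\to\mathcal A_j$. Primary complex: $\partial:H^0(X,\mathcal A_{j-1})\to H^1(X,\mathcal A_{j})$ is the composite $H^0(X,\mathcal A_{j-1})\to H^0(X,\mathcal H_k/\mathcal H_{j})\to H^1(X,\mathcal A_{j})$, the last map being the connecting map of the central sequence $\{e\}\to\mathcal A_{j}\to\mathcal H_k/\mathcal H_{j+1}\to\mathcal H_k/\mathcal H_{j}\to\{e\}$, $k<j$; and $\partial:H^1(X,\mathcal A_{j})\to H^2(X,\mathcal A_{j+1})$ is the composite $H^1(X,\mathcal A_{j})\to\check H^1(X,\mathcal H_k/\mathcal H_{j+1})\to H^2(X,\mathcal A_{j+1})$, the last map being the degree-2 connecting map of the central sequence $\{e\}\to\mathcal A_{j+1}\to\mathcal H_k/\mathcal H_{j+2}\to\mathcal H_k/\mathcal H_{j+1}\to\{e\}$, $k<j+1$. The composition of the two maps is trivial. The first primary cohomology ${\bf H}^1_\partial(X,\mathcal A)$ is the cohomology of this complex at the $H^1$ term; ${\bf H}^1_\partial(X,\mathcal A)=(0)$ means that for every $j$, $\ker\{\partial:H^1(X,\mathcal A_j)\to H^2(X,\mathcal A_{j+1})\}=\operatorname{im}\{\partial:H^0(X,\mathcal A_{j-1})\to H^1(X,\mathcal A_j)\}$. *)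

theory Defs
  imports "HOL-Analysis.Abstract_Topology" "HOL-Algebra.Coset"
begin

section \<open>Sheaves of groups on a topological space\<close>

record ('x, 'g) presheaf =
  sec :: "'x set \<Rightarrow> 'g monoid"
  res :: "'x set \<Rightarrow> 'x set \<Rightarrow> 'g \<Rightarrow> 'g"

text \<open>\<open>res F U V\<close> is the restriction from \<open>F(U)\<close> to \<open>F(V)\<close>, for \<open>V \<subseteq> U\<close>.
  Values of \<open>sec\<close> and \<open>res\<close> at non-open sets are irrelevant.\<close>

locale presheaf_of_groups =
  fixes X :: "'x topology" and F :: "('x, 'g) presheaf"
  assumes group_sec: "openin X U \<Longrightarrow> group (sec F U)"
    and res_hom: "\<lbrakk>openin X U; openin X V; V \<subseteq> U\<rbrakk> \<Longrightarrow> res F U V \<in> hom (sec F U) (sec F V)"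
    and res_id: "\<lbrakk>openin X U; s \<in> carrier (sec F U)\<rbrakk> \<Longrightarrow> res F U U s = s"
    and res_comp: "\<lbrakk>openin X U; openin X V; openin X W; W \<subseteq> V; V \<subseteq> U; s \<in> carrier (sec F U)\<rbrakk>
      \<Longrightarrow> res F V W (res F U V s) = res F U W s"

locale sheaf_of_groups = presheaf_of_groups +
  assumes locality:
    "\<lbrakk>\<And>U. U \<in> \<U> \<Longrightarrow> openin X U; s \<in> carrier (sec F (\<Union>\<U>)); t \<in> carrier (sec F (\<Union>\<U>));
      \<And>U. U \<in> \<U> \<Longrightarrow> res F (\<Union>\<U>) U s = res F (\<Union>\<U>) U t\<rbrakk> \<Longrightarrow> s = t"
    and gluing:
    "\<lbrakk>\<And>U. U \<in> \<U> \<Longrightarrow> openin X U; \<And>U. U \<in> \<U> \<Longrightarrow> f U \<in> carrier (sec F U);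
      \<And>U V. \<lbrakk>U \<in> \<U>; V \<in> \<U>\<rbrakk> \<Longrightarrow> res F U (U \<inter> V) (f U) = res F V (U \<inter> V) (f V)\<rbrakk>
     \<Longrightarrow> \<exists>s \<in> carrier (sec F (\<Union>\<U>)). \<forall>U \<in> \<U>. res F (\<Union>\<U>) U s = f U"

definition sheaf_of_abelian_groups :: "'x topology \<Rightarrow> ('x, 'g) presheaf \<Rightarrow> bool" where
  "sheaf_of_abelian_groups X F \<longleftrightarrow>
     sheaf_of_groups X F \<and> (\<forall>U. openin X U \<longrightarrow> comm_group (sec F U))"

definition H0 :: "'x topology \<Rightarrow> ('x, 'g) presheaf \<Rightarrow> 'g set" where
  "H0 X F = carrier (sec F (topspace X))"

definition sub_presheaf :: "('x, 'g) presheaf \<Rightarrow> ('x set \<Rightarrow> 'g set) \<Rightarrow> ('x, 'g) presheaf" where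
  "sub_presheaf G S = G\<lparr>sec := \<lambda>U. (sec G U)\<lparr>carrier := S U\<rparr>\<rparr>"

definition sheaf_of_normal_subgroups ::
    "'x topology \<Rightarrow> ('x, 'g) presheaf \<Rightarrow> ('x set \<Rightarrow> 'g set) \<Rightarrow> bool" where
  "sheaf_of_normal_subgroups X G S \<longleftrightarrow>
     (\<forall>U. openin X U \<longrightarrow> S U \<lhd> sec G U) \<and> sheaf_of_groups X (sub_presheaf G S)"


section \<open>Stalks and sheafification\<close>

definition germ ::
    "'x topology \<Rightarrow> ('x, 'g) presheaf \<Rightarrow> 'x \<Rightarrow> 'x set \<Rightarrow> 'g \<Rightarrow> ('x set \<times> 'g) set" where
  "germ X F x U s = {(V, t). openin X V \<and> x \<in> V \<and> t \<in> carrier (sec F V) \<and>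
     (\<exists>W. openin X W \<and> x \<in> W \<and> W \<subseteq> U \<inter> V \<and> res F U W s = res F V W t)}"

text \<open>Here and below, a function on equivalence classes is given as the union of its values
  on representatives, all of which coincide; likewise for values depending on auxiliary choices.\<close>

definition stalk_mult :: "'x topology \<Rightarrow> ('x, 'g) presheaf \<Rightarrow> 'x \<Rightarrow>
    ('x set \<times> 'g) set \<Rightarrow> ('x set \<times> 'g) set \<Rightarrow> ('x set \<times> 'g) set" where
  "stalk_mult X F x \<alpha> \<beta> =
     (\<Union>(U, s) \<in> \<alpha>. \<Union>(V, t) \<in> \<beta>.
        germ X F x (U \<inter> V) (res F U (U \<inter> V) s \<otimes>\<^bsub>sec F (U \<inter> V)\<^esub> res F V (U \<inter> V) t))"

text \<open>Sections of the sheafification over \<open>U\<close> are the families of germs over the points of \<open>U\<close>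
  that are locally induced by sections of the presheaf.\<close>

definition sheafify ::
    "'x topology \<Rightarrow> ('x, 'g) presheaf \<Rightarrow> ('x, 'x \<Rightarrow> ('x set \<times> 'g) set) presheaf" where
  "sheafify X F = \<lparr>
     sec = (\<lambda>U. \<lparr>
       carrier = {\<sigma> \<in> extensional U. \<forall>x \<in> U. \<exists>V t. openin X V \<and> x \<in> V \<and> V \<subseteq> U \<and>
                    t \<in> carrier (sec F V) \<and> (\<forall>y \<in> V. \<sigma> y = germ X F y V t)},
       monoid.mult = (\<lambda>\<sigma> \<tau>. \<lambda>x\<in>U. stalk_mult X F x (\<sigma> x) (\<tau> x)),
       one = (\<lambda>x\<in>U. germ X F x U \<one>\<^bsub>sec F U\<^esub>)\<rparr>),
     res = (\<lambda>U V \<sigma>. restrict \<sigma> V)\<rparr>"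

text \<open>A morphism \<open>F \<rightarrow> F'\<close> is given by its components \<open>f U\<close>. The following is the
  morphism of sheafifications induced by a morphism \<open>f\<close> of presheaves with target \<open>F'\<close>.\<close>

definition sheafify_map :: "'x topology \<Rightarrow> ('x, 'h) presheaf \<Rightarrow> ('x set \<Rightarrow> 'g \<Rightarrow> 'h) \<Rightarrow>
    'x set \<Rightarrow> ('x \<Rightarrow> ('x set \<times> 'g) set) \<Rightarrow> ('x \<Rightarrow> ('x set \<times> 'h) set)" where
  "sheafify_map X F' f U \<sigma> = (\<lambda>x\<in>U. \<Union>(V, s) \<in> \<sigma> x. germ X F' x V (f V s))"


section \<open>Quotient sheaves\<close>

text \<open>For families \<open>N U \<subseteq> M U \<subseteq> G(U)\<close>: the presheaf \<open>U \<mapsto> M(U)/N(U)\<close> and its sheafification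
  \<open>M/N\<close>. The factor \<open>N V\<close> in the restriction map turns the image of a coset into a coset.\<close>

definition quot_presheaf ::
    "('x, 'g) presheaf \<Rightarrow> ('x set \<Rightarrow> 'g set) \<Rightarrow> ('x set \<Rightarrow> 'g set) \<Rightarrow> ('x, 'g set) presheaf" where
  "quot_presheaf G M N = \<lparr>
     sec = (\<lambda>U. (sec G U)\<lparr>carrier := M U\<rparr> Mod N U),
     res = (\<lambda>U V C. N V <#>\<^bsub>sec G V\<^esub> (res G U V ` C))\<rparr>"

type_synonym ('x, 'g) quot_sec = "'x \<Rightarrow> ('x set \<times> 'g set) set"

definition quot_sheaf :: "'x topology \<Rightarrow> ('x, 'g) presheaf \<Rightarrow> ('x set \<Rightarrow> 'g set) \<Rightarrow>
    ('x set \<Rightarrow> 'g set) \<Rightarrow> ('x, ('x, 'g) quot_sec) presheaf" where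
  "quot_sheaf X G M N = sheafify X (quot_presheaf G M N)"

text \<open>The projection \<open>M \<rightarrow> M/N\<close>.\<close>

definition quot_proj :: "'x topology \<Rightarrow> ('x, 'g) presheaf \<Rightarrow> ('x set \<Rightarrow> 'g set) \<Rightarrow>
    ('x set \<Rightarrow> 'g set) \<Rightarrow> 'x set \<Rightarrow> 'g \<Rightarrow> ('x, 'g) quot_sec" where
  "quot_proj X G M N U s =
     (\<lambda>x\<in>U. germ X (quot_presheaf G M N) x U (N U #>\<^bsub>sec G U\<^esub> s))"

text \<open>The morphism \<open>M/N \<rightarrow> M'/N'\<close> induced by inclusions \<open>M \<subseteq> M'\<close> and \<open>N \<subseteq> N'\<close>
  (it depends on \<open>M\<close> and \<open>N\<close> only through its domain).\<close>

definition quot_map :: "'x topology \<Rightarrow> ('x, 'g) presheaf \<Rightarrow> ('x set \<Rightarrow> 'g set) \<Rightarrow>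
    ('x set \<Rightarrow> 'g set) \<Rightarrow> 'x set \<Rightarrow> ('x, 'g) quot_sec \<Rightarrow> ('x, 'g) quot_sec" where
  "quot_map X G M' N' =
     sheafify_map X (quot_presheaf G M' N') (\<lambda>U C. N' U <#>\<^bsub>sec G U\<^esub> C)"


section \<open>Non-abelian Cech cohomology in degree one\<close>

definition open_cover :: "'x topology \<Rightarrow> 'x set set \<Rightarrow> bool" where
  "open_cover X \<U> \<longleftrightarrow> (\<forall>U \<in> \<U>. openin X U) \<and> \<Union>\<U> = topspace X"

type_synonym ('x, 'g) cochain1 = "'x set set \<times> ('x set \<Rightarrow> 'x set \<Rightarrow> 'g)"

definition Z1 :: "'x topology \<Rightarrow> ('x, 'g) presheaf \<Rightarrow> ('x, 'g) cochain1 set" where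
  "Z1 X F = {(\<U>, g). open_cover X \<U> \<and>
     (\<forall>U \<in> \<U>. \<forall>V \<in> \<U>. g U V \<in> carrier (sec F (U \<inter> V))) \<and>
     (\<forall>U \<in> \<U>. \<forall>V \<in> \<U>. \<forall>W \<in> \<U>.
        res F (U \<inter> V) (U \<inter> V \<inter> W) (g U V) \<otimes>\<^bsub>sec F (U \<inter> V \<inter> W)\<^esub>
        res F (V \<inter> W) (U \<inter> V \<inter> W) (g V W) = res F (U \<inter> W) (U \<inter> V \<inter> W) (g U W))}"

text \<open>Two cocycles define the same element of the colimit over all covers if their pullbacks
  \<open>g\<close>, \<open>h\<close> to a common refinement satisfy \<open>h W W' = (\<lambda> W)\<^sup>-\<^sup>1 g W W' (\<lambda> W')\<close> on \<open>W \<inter> W'\<close>.\<close>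

definition cohom1 ::
    "'x topology \<Rightarrow> ('x, 'g) presheaf \<Rightarrow> (('x, 'g) cochain1 \<times> ('x, 'g) cochain1) set" where
  "cohom1 X F = {((\<U>, g), (\<V>, h)). (\<U>, g) \<in> Z1 X F \<and> (\<V>, h) \<in> Z1 X F \<and>
     (\<exists>\<W> r s l. open_cover X \<W> \<and>
        (\<forall>W \<in> \<W>. r W \<in> \<U> \<and> W \<subseteq> r W \<and> s W \<in> \<V> \<and> W \<subseteq> s W \<and> l W \<in> carrier (sec F W)) \<and>
        (\<forall>W \<in> \<W>. \<forall>W' \<in> \<W>.
           res F W (W \<inter> W') (l W) \<otimes>\<^bsub>sec F (W \<inter> W')\<^esub>
             res F (s W \<inter> s W') (W \<inter> W') (h (s W) (s W')) =
           res F (r W \<inter> r W') (W \<inter> W') (g (r W) (r W')) \<otimes>\<^bsub>sec F (W \<inter> W')\<^esub>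
             res F W' (W \<inter> W') (l W')))}"

definition H1 :: "'x topology \<Rightarrow> ('x, 'g) presheaf \<Rightarrow> ('x, 'g) cochain1 set set" where
  "H1 X F = Z1 X F // cohom1 X F"

definition H1_zero :: "'x topology \<Rightarrow> ('x, 'g) presheaf \<Rightarrow> ('x, 'g) cochain1 set" where
  "H1_zero X F = cohom1 X F `` {({topspace X}, \<lambda>U V. \<one>\<^bsub>sec F (U \<inter> V)\<^esub>)}"

definition H1_map :: "'x topology \<Rightarrow> ('x, 'h) presheaf \<Rightarrow> ('x set \<Rightarrow> 'g \<Rightarrow> 'h) \<Rightarrow>
    ('x, 'g) cochain1 set \<Rightarrow> ('x, 'h) cochain1 set" where
  "H1_map X F' f \<gamma> = (\<Union>(\<U>, g) \<in> \<gamma>. cohom1 X F' `` {(\<U>, \<lambda>U V. f (U \<inter> V) (g U V))})"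

text \<open>The connecting map \<open>H\<^sup>0(X,C) \<rightarrow> H\<^sup>1(X,A)\<close> of a short exact sequence
  \<open>A \<rightarrow> B \<rightarrow> C\<close> with maps \<open>i\<close> and \<open>p\<close>.\<close>

definition connecting0 :: "'x topology \<Rightarrow>
    ('x, 'a) presheaf \<Rightarrow> ('x, 'b) presheaf \<Rightarrow> ('x, 'c) presheaf \<Rightarrow>
    ('x set \<Rightarrow> 'a \<Rightarrow> 'b) \<Rightarrow> ('x set \<Rightarrow> 'b \<Rightarrow> 'c) \<Rightarrow> 'c \<Rightarrow> ('x, 'a) cochain1 set" where
  "connecting0 X A B C i p c =
     \<Union>{cohom1 X A `` {(\<U>, a)} | \<U> a b. (\<U>, a) \<in> Z1 X A \<and>
         (\<forall>U \<in> \<U>. b U \<in> carrier (sec B U) \<and> p U (b U) = res C (topspace X) U c) \<and>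
         (\<forall>U \<in> \<U>. \<forall>V \<in> \<U>. i (U \<inter> V) (a U V) =
            inv\<^bsub>sec B (U \<inter> V)\<^esub> (res B U (U \<inter> V) (b U)) \<otimes>\<^bsub>sec B (U \<inter> V)\<^esub>
              res B V (U \<inter> V) (b V))}"


section \<open>Abelian cohomology in degree two\<close>

text \<open>On an arbitrary space, Cech cohomology of ordinary covers need not compute \<open>H\<^sup>2(X,A)\<close>, and
  a cocycle in \<open>C\<close> need not lift to \<open>B\<close> on the intersections \<open>U \<inter> V\<close> of any cover. Both are
  repaired by using hypercovers (Verdier), where each \<open>U \<inter> V\<close> is covered in turn; in degree two
  hypercovers that are coskeletal above level one suffice. Such a hypercover is given by a cover
  \<open>\<U>\<close> together with a set of edges \<open>(U, V, P)\<close>, meaning that \<open>P\<close> is a member of the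
  cover of \<open>U \<inter> V\<close>.\<close>

type_synonym 'x edge = "'x set \<times> 'x set \<times> 'x set"

abbreviation src :: "'x edge \<Rightarrow> 'x set" where "src e \<equiv> fst e"
abbreviation tgt :: "'x edge \<Rightarrow> 'x set" where "tgt e \<equiv> fst (snd e)"
abbreviation supp :: "'x edge \<Rightarrow> 'x set" where "supp e \<equiv> snd (snd e)"

type_synonym 'x hypercover = "'x set set \<times> 'x edge set"

definition is_hypercover :: "'x topology \<Rightarrow> 'x hypercover \<Rightarrow> bool" where
  "is_hypercover X K \<longleftrightarrow> open_cover X (fst K) \<and>
     (\<forall>e \<in> snd K. src e \<in> fst K \<and> tgt e \<in> fst K \<and> openin X (supp e)) \<and>
     (\<forall>U \<in> fst K. \<forall>V \<in> fst K. \<Union>{P. (U, V, P) \<in> snd K} = U \<inter> V)"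

text \<open>The arguments are the edges \<open>01\<close>, \<open>12\<close>, \<open>02\<close> of a 2-simplex, in this order.\<close>

definition triangle :: "'x hypercover \<Rightarrow> 'x edge \<Rightarrow> 'x edge \<Rightarrow> 'x edge \<Rightarrow> bool" where
  "triangle K e f g \<longleftrightarrow> e \<in> snd K \<and> f \<in> snd K \<and> g \<in> snd K \<and>
     src e = src g \<and> tgt e = src f \<and> tgt f = tgt g"

abbreviation supp3 :: "'x edge \<Rightarrow> 'x edge \<Rightarrow> 'x edge \<Rightarrow> 'x set" where
  "supp3 e f g \<equiv> supp e \<inter> supp f \<inter> supp g"

type_synonym ('x, 'g) cochain2 = "'x hypercover \<times> ('x edge \<Rightarrow> 'x edge \<Rightarrow> 'x edge \<Rightarrow> 'g)"

definition Z2 :: "'x topology \<Rightarrow> ('x, 'g) presheaf \<Rightarrow> ('x, 'g) cochain2 set" where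
  "Z2 X A = {(K, a). is_hypercover X K \<and>
     (\<forall>e f g. triangle K e f g \<longrightarrow> a e f g \<in> carrier (sec A (supp3 e f g))) \<and>
     (\<forall>e01 e02 e03 e12 e13 e23.
        triangle K e01 e12 e02 \<and> triangle K e01 e13 e03 \<and>
        triangle K e02 e23 e03 \<and> triangle K e12 e23 e13 \<longrightarrow>
        (let S = supp e01 \<inter> supp e02 \<inter> supp e03 \<inter> supp e12 \<inter> supp e13 \<inter> supp e23 in
         res A (supp3 e12 e23 e13) S (a e12 e23 e13) \<otimes>\<^bsub>sec A S\<^esub>
         res A (supp3 e01 e13 e03) S (a e01 e13 e03) =
         res A (supp3 e02 e23 e03) S (a e02 e23 e03) \<otimes>\<^bsub>sec A S\<^esub>
         res A (supp3 e01 e12 e02) S (a e01 e12 e02)))}"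

definition hyper_refinement ::
    "'x hypercover \<Rightarrow> 'x hypercover \<Rightarrow> ('x set \<Rightarrow> 'x set) \<Rightarrow> ('x edge \<Rightarrow> 'x edge) \<Rightarrow> bool" where
  "hyper_refinement M K r0 r \<longleftrightarrow>
     (\<forall>U \<in> fst M. r0 U \<in> fst K \<and> U \<subseteq> r0 U) \<and>
     (\<forall>e \<in> snd M. r e \<in> snd K \<and> src (r e) = r0 (src e) \<and> tgt (r e) = r0 (tgt e) \<and>
        supp e \<subseteq> supp (r e))"

text \<open>On a common refinement, the difference of the two cocycles is the coboundary of \<open>l\<close>.\<close>

definition cohom2 ::
    "'x topology \<Rightarrow> ('x, 'g) presheaf \<Rightarrow> (('x, 'g) cochain2 \<times> ('x, 'g) cochain2) set" where
  "cohom2 X A = {((K, a), (L, b)). (K, a) \<in> Z2 X A \<and> (L, b) \<in> Z2 X A \<and>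
     (\<exists>M r0 r s0 s l. is_hypercover X M \<and> hyper_refinement M K r0 r \<and> hyper_refinement M L s0 s \<and>
        (\<forall>e \<in> snd M. l e \<in> carrier (sec A (supp e))) \<and>
        (\<forall>e f g. triangle M e f g \<longrightarrow>
          (let S = supp3 e f g in
           res A (supp3 (r e) (r f) (r g)) S (a (r e) (r f) (r g)) =
           res A (supp3 (s e) (s f) (s g)) S (b (s e) (s f) (s g)) \<otimes>\<^bsub>sec A S\<^esub>
             (res A (supp e) S (l e) \<otimes>\<^bsub>sec A S\<^esub> res A (supp f) S (l f) \<otimes>\<^bsub>sec A S\<^esub>
              inv\<^bsub>sec A S\<^esub> (res A (supp g) S (l g))))))}"

definition H2 :: "'x topology \<Rightarrow> ('x, 'g) presheaf \<Rightarrow> ('x, 'g) cochain2 set set" where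
  "H2 X A = Z2 X A // cohom2 X A"

definition H2_zero :: "'x topology \<Rightarrow> ('x, 'g) presheaf \<Rightarrow> ('x, 'g) cochain2 set" where
  "H2_zero X A = cohom2 X A ``
     {(({topspace X}, {(topspace X, topspace X, topspace X)}),
       \<lambda>e f g. \<one>\<^bsub>sec A (supp3 e f g)\<^esub>)}"

text \<open>The connecting map from \<open>H\<^sup>1(X,C)\<close> to \<open>H\<^sup>2(X,A)\<close> of a central sequence
  \<open>A \<rightarrow> B \<rightarrow> C\<close>: a cocycle \<open>c\<close> of \<open>C\<close> is lifted locally on the intersections
  to \<open>b\<close>, and the failure of \<open>b\<close> to be a cocycle is measured by \<open>a\<close>.\<close>

definition connecting1 :: "'x topology \<Rightarrow>
    ('x, 'a) presheaf \<Rightarrow> ('x, 'b) presheaf \<Rightarrow> ('x, 'c) presheaf \<Rightarrow>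
    ('x set \<Rightarrow> 'a \<Rightarrow> 'b) \<Rightarrow> ('x set \<Rightarrow> 'b \<Rightarrow> 'c) \<Rightarrow>
    ('x, 'c) cochain1 set \<Rightarrow> ('x, 'a) cochain2 set" where
  "connecting1 X A B C i p \<gamma> =
     \<Union>{cohom2 X A `` {((\<U>, \<E>), a)} | \<U> c \<E> a b. (\<U>, c) \<in> \<gamma> \<and> ((\<U>, \<E>), a) \<in> Z2 X A \<and>
         (\<forall>e \<in> \<E>. b e \<in> carrier (sec B (supp e)) \<and>
            p (supp e) (b e) = res C (src e \<inter> tgt e) (supp e) (c (src e) (tgt e))) \<and>
         (\<forall>e f g. triangle (\<U>, \<E>) e f g \<longrightarrow>
            (let S = supp3 e f g in
             i S (a e f g) =
               res B (supp e) S (b e) \<otimes>\<^bsub>sec B S\<^esub> res B (supp f) S (b f) \<otimes>\<^bsub>sec B S\<^esub>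
               inv\<^bsub>sec B S\<^esub> (res B (supp g) S (b g))))}"


section \<open>AQ series and the primary complex\<close>

text \<open>A series is given by the sheaf of groups \<open>G\<close> and the subsheaves \<open>H j\<close>, which are
  trivial for large \<open>j\<close>. \<open>series_quot X G H m n\<close> is \<open>H m/H n\<close>.\<close>

type_synonym ('x, 'g) series = "nat \<Rightarrow> 'x set \<Rightarrow> 'g set"

abbreviation series_quot :: "'x topology \<Rightarrow> ('x, 'g) presheaf \<Rightarrow> ('x, 'g) series \<Rightarrow> nat \<Rightarrow> nat \<Rightarrow>
    ('x, ('x, 'g) quot_sec) presheaf" where
  "series_quot X G H m n \<equiv> quot_sheaf X G (H m) (H n)"

text \<open>The map from any \<open>H m'/H n'\<close> with \<open>m' \<ge> m\<close>, \<open>n' \<ge> n\<close> to \<open>H m/H n\<close>.\<close>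

abbreviation series_map :: "'x topology \<Rightarrow> ('x, 'g) presheaf \<Rightarrow> ('x, 'g) series \<Rightarrow> nat \<Rightarrow> nat \<Rightarrow>
    'x set \<Rightarrow> ('x, 'g) quot_sec \<Rightarrow> ('x, 'g) quot_sec" where
  "series_map X G H m n \<equiv> quot_map X G (H m) (H n)"

text \<open>The graded piece \<open>\<A>\<^sub>j = \<H>\<^sub>j/\<H>\<^sub>j\<^sub>+\<^sub>1\<close> of the linearisation.\<close>

definition lin :: "'x topology \<Rightarrow> ('x, 'g) presheaf \<Rightarrow> ('x, 'g) series \<Rightarrow> nat \<Rightarrow>
    ('x, ('x, 'g) quot_sec) presheaf" where
  "lin X G H j = series_quot X G H j (Suc j)"

definition AQ_normal_series ::
    "'x topology \<Rightarrow> ('x, 'g) presheaf \<Rightarrow> ('x, 'g) series \<Rightarrow> bool" where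
  "AQ_normal_series X G H \<longleftrightarrow> sheaf_of_groups X G \<and>
     (\<forall>U. openin X U \<longrightarrow> H 0 U = carrier (sec G U)) \<and>
     (\<forall>j U. openin X U \<longrightarrow> H (Suc j) U \<subseteq> H j U) \<and>
     (\<exists>N. \<forall>j \<ge> N. \<forall>U. openin X U \<longrightarrow> H j U = {\<one>\<^bsub>sec G U\<^esub>}) \<and>
     (\<forall>j. sheaf_of_normal_subgroups X G (H j)) \<and>
     (\<forall>j. sheaf_of_abelian_groups X (lin X G H j))"

text \<open>\<open>\<A>\<^sub>j\<close> lies in the centre of \<open>\<H>\<^sub>k/\<H>\<^sub>j\<^sub>+\<^sub>1\<close>.\<close>

definition central_at ::
    "'x topology \<Rightarrow> ('x, 'g) presheaf \<Rightarrow> ('x, 'g) series \<Rightarrow> nat \<Rightarrow> nat \<Rightarrow> bool" where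
  "central_at X G H k j \<longleftrightarrow>
     (\<forall>U. openin X U \<longrightarrow>
        (\<forall>\<sigma> \<in> carrier (sec (lin X G H j) U). \<forall>\<tau> \<in> carrier (sec (series_quot X G H k (Suc j)) U).
           series_map X G H k (Suc j) U \<sigma> \<otimes>\<^bsub>sec (series_quot X G H k (Suc j)) U\<^esub> \<tau> =
           \<tau> \<otimes>\<^bsub>sec (series_quot X G H k (Suc j)) U\<^esub> series_map X G H k (Suc j) U \<sigma>))"

definition AQ_central_series ::
    "'x topology \<Rightarrow> ('x, 'g) presheaf \<Rightarrow> ('x, 'g) series \<Rightarrow> bool" where
  "AQ_central_series X G H \<longleftrightarrow>
     AQ_normal_series X G H \<and> (\<forall>j > 0. \<exists>k < j. central_at X G H k j)"

text \<open>The maps of the primary complex below do not depend on which admissible \<open>k\<close> is chosen.\<close>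

definition central_index ::
    "'x topology \<Rightarrow> ('x, 'g) presheaf \<Rightarrow> ('x, 'g) series \<Rightarrow> nat \<Rightarrow> nat" where
  "central_index X G H j = (SOME k. k < j \<and> central_at X G H k j)"

text \<open>\<open>\<partial> : H\<^sup>0(X, \<A>\<^sub>j) \<rightarrow> H\<^sup>1(X, \<A>\<^sub>j\<^sub>+\<^sub>1)\<close>\<close>

definition primary0 :: "'x topology \<Rightarrow> ('x, 'g) presheaf \<Rightarrow> ('x, 'g) series \<Rightarrow> nat \<Rightarrow>
    ('x, 'g) quot_sec \<Rightarrow> ('x, ('x, 'g) quot_sec) cochain1 set" where
  "primary0 X G H j \<sigma> =
     (let k = central_index X G H (Suc j) in
      connecting0 X
        (lin X G H (Suc j)) (series_quot X G H k (j + 2)) (series_quot X G H k (Suc j))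
        (series_map X G H k (j + 2)) (series_map X G H k (Suc j))
        (series_map X G H k (Suc j) (topspace X) \<sigma>))"

text \<open>\<open>\<partial> : H\<^sup>1(X, \<A>\<^sub>j) \<rightarrow> H\<^sup>2(X, \<A>\<^sub>j\<^sub>+\<^sub>1)\<close>\<close>

definition primary1 :: "'x topology \<Rightarrow> ('x, 'g) presheaf \<Rightarrow> ('x, 'g) series \<Rightarrow> nat \<Rightarrow>
    ('x, ('x, 'g) quot_sec) cochain1 set \<Rightarrow> ('x, ('x, 'g) quot_sec) cochain2 set" where
  "primary1 X G H j \<theta> =
     (let k = central_index X G H (Suc j) in
      connecting1 X
        (lin X G H (Suc j)) (series_quot X G H k (j + 2)) (series_quot X G H k (Suc j))
        (series_map X G H k (j + 2)) (series_map X G H k (Suc j))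
        (H1_map X (series_quot X G H k (Suc j)) (series_map X G H k (Suc j)) \<theta>))"

text \<open>For \<open>j = 0\<close> the incoming map has source \<open>H\<^sup>0(X, \<A>\<^sub>-\<^sub>1) = 0\<close>; negative \<open>j\<close> contribute
  nothing since \<open>\<A>\<^sub>j = 0\<close> there.\<close>

definition primary_H1_vanishes ::
    "'x topology \<Rightarrow> ('x, 'g) presheaf \<Rightarrow> ('x, 'g) series \<Rightarrow> bool" where
  "primary_H1_vanishes X G H \<longleftrightarrow>
     (\<forall>j. {\<theta> \<in> H1 X (lin X G H j). primary1 X G H j \<theta> = H2_zero X (lin X G H (Suc j))} =
        (case j of 0 \<Rightarrow> {H1_zero X (lin X G H 0)}
                 | Suc i \<Rightarrow> primary0 X G H i ` H0 X (lin X G H i)))"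

text \<open>The \<open>j\<close>-th linearisation map.\<close>

definition omega :: "'x topology \<Rightarrow> ('x, 'g) presheaf \<Rightarrow> ('x, 'g) series \<Rightarrow> nat \<Rightarrow>
    ('x, 'g) cochain1 set \<Rightarrow> ('x, ('x, 'g) quot_sec) cochain1 set" where
  "omega X G H j = H1_map X (lin X G H j) (quot_proj X G (H j) (H (Suc j)))"

end

theory Submission
  imports Defs
begin

text \<open>
  Both implications follow by writing down one explicit cocycle.

  Classes of torsors are closed. If \<open>\<theta>\<close> is the image of an \<open>\<H>\<^sub>j\<close>-torsor \<open>h\<close>, then its image
  in the cohomology of
  \<open>\<H>\<^sub>k/\<H>\<^sub>j\<^sub>+\<^sub>1\<close> is that of \<open>h\<close>, hence lifts to the cocycle of \<open>\<H>\<^sub>k/\<H>\<^sub>j\<^sub>+\<^sub>2\<close> given by \<open>h\<close>, and the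
  degree-two connecting map of a central extension vanishes on classes that lift. The
  latter is \<open>connecting1_of_lift\<close>, which rests on \<open>lifted_cocycle_splits\<close>: two local lifts of
  the same cocycle, one of which is itself a cocycle, differ by a cochain of the centre,
  whose coboundary is the obstruction cocycle of the other.

  Closed classes integrate. If \<open>\<partial>\<theta> = 0\<close>, the vanishing of the primary cohomology gives \<open>\<theta> = \<partial>\<sigma>\<close> for a
  global section \<open>\<sigma>\<close> of \<open>\<A>\<^sub>j\<^sub>-\<^sub>1\<close> (for \<open>j = 0\<close> it gives \<open>\<theta> = 0\<close>, the image of the trivial torsor).
  Choose sections \<open>s\<^sub>U\<close> of \<open>\<H>\<^sub>j\<^sub>-\<^sub>1\<close> on the members of a cover that represent \<open>\<sigma>\<close>. The cocycle
  \<open>s\<^sub>U\<^sup>-\<^sup>1 s\<^sub>V\<close> becomes trivial modulo \<open>\<H>\<^sub>j\<close>, so it is an \<open>\<H>\<^sub>j\<close>-torsor, and its reduction modulo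
  \<open>\<H>\<^sub>j\<^sub>+\<^sub>1\<close> is one of the cocycles that represent \<open>\<partial>\<sigma>\<close>. This is \<open>primary0_integrates\<close>.

  The first argument uses that \<open>K/N \<rightarrow> M/N \<rightarrow> M/K\<close> is a short exact sequence of sheaves, where the
  quotient sheaves are sheafifications. To keep germs out of the cohomological arguments, three facts
  about the projection \<open>M \<rightarrow> M/N\<close> are isolated: it is a homomorphism (\<open>quot_proj_hom\<close>), it is locally surjective (\<open>quot_proj_locally_surj\<close>), and its kernel is \<open>N\<close>
  (\<open>quot_proj_eq_one_iff\<close>).
\<close>

section \<open>Presheaves of groups and their morphisms\<close>

declare openin_Int [simp]

context presheaf_of_groups
begin

lemma res_closed [simp]:
  "\<lbrakk>openin X U; openin X V; V \<subseteq> U; s \<in> carrier (sec F U)\<rbrakk> \<Longrightarrow> res F U V s \<in> carrier (sec F V)"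
  using res_hom[of U V] by (auto simp: hom_def)

lemma one_sec [simp]: "openin X U \<Longrightarrow> \<one>\<^bsub>sec F U\<^esub> \<in> carrier (sec F U)"
  by (simp add: group.is_monoid group_sec)

lemma mult_sec [simp]:
  "\<lbrakk>openin X U; s \<in> carrier (sec F U); t \<in> carrier (sec F U)\<rbrakk> \<Longrightarrow> s \<otimes>\<^bsub>sec F U\<^esub> t \<in> carrier (sec F U)"
  by (simp add: group.is_monoid group_sec monoid.m_closed)

lemma inv_sec [simp]:
  "\<lbrakk>openin X U; s \<in> carrier (sec F U)\<rbrakk> \<Longrightarrow> inv\<^bsub>sec F U\<^esub> s \<in> carrier (sec F U)"
  by (simp add: group_sec group.inv_closed)

lemma res_group_hom:
  "\<lbrakk>openin X U; openin X V; V \<subseteq> U\<rbrakk> \<Longrightarrow> group_hom (sec F U) (sec F V) (res F U V)"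
  by (simp add: group_hom_def group_hom_axioms_def group_sec res_hom)

lemma res_mult:
  "\<lbrakk>openin X U; openin X V; V \<subseteq> U; s \<in> carrier (sec F U); t \<in> carrier (sec F U)\<rbrakk>
    \<Longrightarrow> res F U V (s \<otimes>\<^bsub>sec F U\<^esub> t) = res F U V s \<otimes>\<^bsub>sec F V\<^esub> res F U V t"
  using res_hom[of U V] by (auto simp: hom_def)

lemma res_one [simp]:
  "\<lbrakk>openin X U; openin X V; V \<subseteq> U\<rbrakk> \<Longrightarrow> res F U V \<one>\<^bsub>sec F U\<^esub> = \<one>\<^bsub>sec F V\<^esub>"
  by (rule group_hom.hom_one[OF res_group_hom])

lemma res_inv:
  "\<lbrakk>openin X U; openin X V; V \<subseteq> U; s \<in> carrier (sec F U)\<rbrakk>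
    \<Longrightarrow> res F U V (inv\<^bsub>sec F U\<^esub> s) = inv\<^bsub>sec F V\<^esub> (res F U V s)"
  by (rule group_hom.hom_inv[OF res_group_hom])

lemma l_one_sec [simp]:
  "\<lbrakk>openin X U; s \<in> carrier (sec F U)\<rbrakk> \<Longrightarrow> \<one>\<^bsub>sec F U\<^esub> \<otimes>\<^bsub>sec F U\<^esub> s = s"
  by (simp add: group_sec group.is_monoid monoid.l_one)

lemma r_one_sec [simp]:
  "\<lbrakk>openin X U; s \<in> carrier (sec F U)\<rbrakk> \<Longrightarrow> s \<otimes>\<^bsub>sec F U\<^esub> \<one>\<^bsub>sec F U\<^esub> = s"
  by (simp add: group_sec group.is_monoid monoid.r_one)

end

definition presheaf_hom ::
    "'x topology \<Rightarrow> ('x, 'g) presheaf \<Rightarrow> ('x, 'h) presheaf \<Rightarrow> ('x set \<Rightarrow> 'g \<Rightarrow> 'h) \<Rightarrow> bool" where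
  "presheaf_hom X F F' f \<longleftrightarrow>
     (\<forall>U. openin X U \<longrightarrow> f U \<in> hom (sec F U) (sec F' U)) \<and>
     (\<forall>U V s. openin X U \<and> openin X V \<and> V \<subseteq> U \<and> s \<in> carrier (sec F U) \<longrightarrow>
        f V (res F U V s) = res F' U V (f U s))"

lemma presheaf_homD:
  assumes "presheaf_hom X F F' f"
  shows "\<And>U s. \<lbrakk>openin X U; s \<in> carrier (sec F U)\<rbrakk> \<Longrightarrow> f U s \<in> carrier (sec F' U)"
    and "\<And>U s t. \<lbrakk>openin X U; s \<in> carrier (sec F U); t \<in> carrier (sec F U)\<rbrakk> \<Longrightarrow>
       f U (s \<otimes>\<^bsub>sec F U\<^esub> t) = f U s \<otimes>\<^bsub>sec F' U\<^esub> f U t"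
    and "\<And>U V s. \<lbrakk>openin X U; openin X V; V \<subseteq> U; s \<in> carrier (sec F U)\<rbrakk> \<Longrightarrow>
       f V (res F U V s) = res F' U V (f U s)"
  using assms by (auto simp: presheaf_hom_def hom_def)

lemma presheaf_hom_group_hom:
  assumes "presheaf_hom X F F' f" "presheaf_of_groups X F" "presheaf_of_groups X F'" "openin X U"
  shows "group_hom (sec F U) (sec F' U) (f U)"
  using assms by (simp add: group_hom_def group_hom_axioms_def presheaf_of_groups.group_sec
      presheaf_hom_def)

lemma presheaf_hom_one:
  assumes "presheaf_hom X F F' f" "presheaf_of_groups X F" "presheaf_of_groups X F'" "openin X U"
  shows "f U \<one>\<^bsub>sec F U\<^esub> = \<one>\<^bsub>sec F' U\<^esub>"
  by (rule group_hom.hom_one[OF presheaf_hom_group_hom[OF assms]])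

lemma presheaf_hom_inv:
  assumes "presheaf_hom X F F' f" "presheaf_of_groups X F" "presheaf_of_groups X F'" "openin X U"
    and "s \<in> carrier (sec F U)"
  shows "f U (inv\<^bsub>sec F U\<^esub> s) = inv\<^bsub>sec F' U\<^esub> (f U s)"
  using group_hom.hom_inv[OF presheaf_hom_group_hom[OF assms(1-4)] assms(5)] .

lemma presheaf_hom_comp:
  assumes "presheaf_hom X F F' f" "presheaf_hom X F' F'' f'"
  shows "presheaf_hom X F F'' (\<lambda>U s. f' U (f U s))"
  using assms unfolding presheaf_hom_def hom_def by (auto simp: Pi_iff)

section \<open>Non-abelian cohomology in degree one\<close>

lemma open_coverD: "open_cover X \<U> \<Longrightarrow> U \<in> \<U> \<Longrightarrow> openin X U"
  by (simp add: open_cover_def)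

lemma open_cover_topspace [simp]: "open_cover X {topspace X}"
  by (simp add: open_cover_def)

lemma open_cover_common_refinement:
  assumes U: "open_cover X \<U>" and V: "open_cover X \<V>"
  obtains \<N> p q where "open_cover X \<N>"
    "\<And>N. N \<in> \<N> \<Longrightarrow> p N \<in> \<U>" "\<And>N. N \<in> \<N> \<Longrightarrow> N \<subseteq> p N"
    "\<And>N. N \<in> \<N> \<Longrightarrow> q N \<in> \<V>" "\<And>N. N \<in> \<N> \<Longrightarrow> N \<subseteq> q N"
proof -
  define \<N> where "\<N> = {A \<inter> B | A B. A \<in> \<U> \<and> B \<in> \<V>}"
  have "\<Union>\<N> = \<Union>\<U> \<inter> \<Union>\<V>" unfolding \<N>_def by blast
  then have cov: "open_cover X \<N>"
    using U V unfolding open_cover_def \<N>_def by auto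
  have "\<forall>N\<in>\<N>. \<exists>A B. A \<in> \<U> \<and> N \<subseteq> A \<and> B \<in> \<V> \<and> N \<subseteq> B"
    unfolding \<N>_def by blast
  then obtain p q where pq: "\<forall>N\<in>\<N>. p N \<in> \<U> \<and> N \<subseteq> p N \<and> q N \<in> \<V> \<and> N \<subseteq> q N" by metis
  show ?thesis by (rule that[OF cov, of p q]) (use pq in simp_all)
qed

lemma Z1D:
  assumes "(\<U>, g) \<in> Z1 X F"
  shows "open_cover X \<U>"
    and "\<And>U. U \<in> \<U> \<Longrightarrow> openin X U"
    and "\<And>U V. U \<in> \<U> \<Longrightarrow> V \<in> \<U> \<Longrightarrow> g U V \<in> carrier (sec F (U \<inter> V))"
  using assms by (auto simp: Z1_def open_cover_def)

lemma Z1I: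
  assumes "open_cover X \<U>"
    and "\<And>U V. U \<in> \<U> \<Longrightarrow> V \<in> \<U> \<Longrightarrow> g U V \<in> carrier (sec F (U \<inter> V))"
    and "\<And>U V W. \<lbrakk>U \<in> \<U>; V \<in> \<U>; W \<in> \<U>\<rbrakk> \<Longrightarrow>
      res F (U \<inter> V) (U \<inter> V \<inter> W) (g U V) \<otimes>\<^bsub>sec F (U \<inter> V \<inter> W)\<^esub>
      res F (V \<inter> W) (U \<inter> V \<inter> W) (g V W) = res F (U \<inter> W) (U \<inter> V \<inter> W) (g U W)"
  shows "(\<U>, g) \<in> Z1 X F"
  using assms unfolding Z1_def by auto

context group
begin

lemma coboundary_inv:
  assumes "l \<otimes> h = g \<otimes> l'" "{l, l', g, h} \<subseteq> carrier G"
  shows "inv l \<otimes> g = h \<otimes> inv l'"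
proof -
  have c: "l \<in> carrier G" "l' \<in> carrier G" "g \<in> carrier G" "h \<in> carrier G"
    using assms(2) by auto
  have "inv l \<otimes> g = inv l \<otimes> (g \<otimes> l') \<otimes> inv l'" using c by (simp add: m_assoc)
  also have "\<dots> = inv l \<otimes> (l \<otimes> h) \<otimes> inv l'" by (simp add: assms(1))
  also have "\<dots> = h \<otimes> inv l'" using c by (simp add: m_assoc[symmetric])
  finally show ?thesis .
qed

text \<open>The value on a pair of open sets of the composite in the transitivity of cohomology:
  \<open>h1, \<dots>, h4\<close> are values of the middle cocycle.\<close>

lemma coboundary_comp:
  assumes "{l, l', m, m', g, h1, h2, h3, h4, k} \<subseteq> carrier G"
    and "l \<otimes> h1 = g \<otimes> l'" "m \<otimes> k = h2 \<otimes> m'" "h3 \<otimes> h2 = h1 \<otimes> h4"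
  shows "(l \<otimes> h3 \<otimes> m) \<otimes> k = g \<otimes> (l' \<otimes> h4 \<otimes> m')"
proof -
  have c: "l \<in> carrier G" "l' \<in> carrier G" "m \<in> carrier G" "m' \<in> carrier G" "g \<in> carrier G"
    "h1 \<in> carrier G" "h2 \<in> carrier G" "h3 \<in> carrier G" "h4 \<in> carrier G" "k \<in> carrier G"
    using assms(1) by auto
  have "(l \<otimes> h3 \<otimes> m) \<otimes> k = l \<otimes> h3 \<otimes> (m \<otimes> k)" using c by (simp add: m_assoc)
  also have "\<dots> = l \<otimes> (h3 \<otimes> h2) \<otimes> m'" unfolding assms(3) using c by (simp add: m_assoc)
  also have "\<dots> = (l \<otimes> h1) \<otimes> h4 \<otimes> m'" unfolding assms(4) using c by (simp add: m_assoc)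
  also have "\<dots> = g \<otimes> (l' \<otimes> h4 \<otimes> m')" unfolding assms(2) using c by (simp add: m_assoc)
  finally show ?thesis .
qed

end

context presheaf_of_groups
begin

lemma Z1_restrict:
  assumes "(\<U>, g) \<in> Z1 X F" "U \<in> \<U>" "V \<in> \<U>" "W \<in> \<U>" "openin X O'" "O' \<subseteq> U \<inter> V \<inter> W"
  shows "res F (U \<inter> V) O' (g U V) \<otimes>\<^bsub>sec F O'\<^esub> res F (V \<inter> W) O' (g V W) = res F (U \<inter> W) O' (g U W)"
proof -
  note Z = Z1D[OF assms(1)]
  let ?T = "U \<inter> V \<inter> W"
  have sub: "O' \<subseteq> U" "O' \<subseteq> V" "O' \<subseteq> W" using assms by auto
  have "res F ?T O' (res F (U \<inter> V) ?T (g U V) \<otimes>\<^bsub>sec F ?T\<^esub> res F (V \<inter> W) ?T (g V W))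
     = res F ?T O' (res F (U \<inter> W) ?T (g U W))"
    using assms by (auto simp: Z1_def)
  then show ?thesis
    using assms Z sub by (subst (asm) res_mult) (auto simp: res_comp le_infI1)
qed

lemma cohom1D:
  assumes "((\<U>, g), (\<V>, h)) \<in> cohom1 X F"
  obtains \<W> r s l where "(\<U>, g) \<in> Z1 X F" "(\<V>, h) \<in> Z1 X F" "open_cover X \<W>"
    "\<And>W. W \<in> \<W> \<Longrightarrow> openin X W"
    "\<And>W. W \<in> \<W> \<Longrightarrow> r W \<in> \<U>" "\<And>W. W \<in> \<W> \<Longrightarrow> W \<subseteq> r W"
    "\<And>W. W \<in> \<W> \<Longrightarrow> s W \<in> \<V>" "\<And>W. W \<in> \<W> \<Longrightarrow> W \<subseteq> s W"
    "\<And>W. W \<in> \<W> \<Longrightarrow> l W \<in> carrier (sec F W)"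
    "\<And>W W' O'. \<lbrakk>W \<in> \<W>; W' \<in> \<W>; openin X O'; O' \<subseteq> W; O' \<subseteq> W'\<rbrakk> \<Longrightarrow>
       res F W O' (l W) \<otimes>\<^bsub>sec F O'\<^esub> res F (s W \<inter> s W') O' (h (s W) (s W')) =
       res F (r W \<inter> r W') O' (g (r W) (r W')) \<otimes>\<^bsub>sec F O'\<^esub> res F W' O' (l W')"
proof -
  from assms obtain \<W> r s l where Z: "(\<U>, g) \<in> Z1 X F" "(\<V>, h) \<in> Z1 X F" and W: "open_cover X \<W>"
    and *: "\<forall>W \<in> \<W>. r W \<in> \<U> \<and> W \<subseteq> r W \<and> s W \<in> \<V> \<and> W \<subseteq> s W \<and> l W \<in> carrier (sec F W)"
    and **: "\<forall>W \<in> \<W>. \<forall>W' \<in> \<W>.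
           res F W (W \<inter> W') (l W) \<otimes>\<^bsub>sec F (W \<inter> W')\<^esub>
             res F (s W \<inter> s W') (W \<inter> W') (h (s W) (s W')) =
           res F (r W \<inter> r W') (W \<inter> W') (g (r W) (r W')) \<otimes>\<^bsub>sec F (W \<inter> W')\<^esub>
             res F W' (W \<inter> W') (l W')"
    unfolding cohom1_def by auto
  note Z1 = Z1D[OF Z(1)] Z1D[OF Z(2)]
  have "res F W O' (l W) \<otimes>\<^bsub>sec F O'\<^esub> res F (s W \<inter> s W') O' (h (s W) (s W')) =
       res F (r W \<inter> r W') O' (g (r W) (r W')) \<otimes>\<^bsub>sec F O'\<^esub> res F W' O' (l W')"
    if A: "W \<in> \<W>" "W' \<in> \<W>" "openin X O'" "O' \<subseteq> W" "O' \<subseteq> W'" for W W' O'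
  proof -
    have o: "openin X W" "openin X W'" using W A by (auto simp: open_cover_def)
    have sb: "W \<inter> W' \<subseteq> s W \<inter> s W'" "W \<inter> W' \<subseteq> r W \<inter> r W'" using * A by blast+
    have "res F (W \<inter> W') O' (res F W (W \<inter> W') (l W) \<otimes>\<^bsub>sec F (W \<inter> W')\<^esub>
             res F (s W \<inter> s W') (W \<inter> W') (h (s W) (s W'))) =
       res F (W \<inter> W') O' (res F (r W \<inter> r W') (W \<inter> W') (g (r W) (r W')) \<otimes>\<^bsub>sec F (W \<inter> W')\<^esub>
             res F W' (W \<inter> W') (l W'))"
      using ** A by auto
    then show ?thesis
      using * A o sb Z1 by (simp add: res_mult res_comp)
  qed
  then show ?thesis
    using that[OF Z W, of r s l] * W by (auto simp: open_cover_def)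
qed

lemma cohom1I:
  assumes "(\<U>, g) \<in> Z1 X F" "(\<V>, h) \<in> Z1 X F" "open_cover X \<W>"
    "\<And>W. W \<in> \<W> \<Longrightarrow> r W \<in> \<U> \<and> W \<subseteq> r W \<and> s W \<in> \<V> \<and> W \<subseteq> s W \<and> l W \<in> carrier (sec F W)"
    "\<And>W W'. \<lbrakk>W \<in> \<W>; W' \<in> \<W>\<rbrakk> \<Longrightarrow>
       res F W (W \<inter> W') (l W) \<otimes>\<^bsub>sec F (W \<inter> W')\<^esub> res F (s W \<inter> s W') (W \<inter> W') (h (s W) (s W')) =
       res F (r W \<inter> r W') (W \<inter> W') (g (r W) (r W')) \<otimes>\<^bsub>sec F (W \<inter> W')\<^esub> res F W' (W \<inter> W') (l W')"
  shows "((\<U>, g), (\<V>, h)) \<in> cohom1 X F"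
  using assms unfolding cohom1_def by blast

lemma cohom1_sym:
  assumes "((\<U>, g), (\<V>, h)) \<in> cohom1 X F"
  shows "((\<V>, h), (\<U>, g)) \<in> cohom1 X F"
proof -
  from assms obtain \<W> r s l where *: "(\<U>, g) \<in> Z1 X F" "(\<V>, h) \<in> Z1 X F" "open_cover X \<W>"
    "\<And>W. W \<in> \<W> \<Longrightarrow> openin X W"
    "\<And>W. W \<in> \<W> \<Longrightarrow> r W \<in> \<U>" "\<And>W. W \<in> \<W> \<Longrightarrow> W \<subseteq> r W"
    "\<And>W. W \<in> \<W> \<Longrightarrow> s W \<in> \<V>" "\<And>W. W \<in> \<W> \<Longrightarrow> W \<subseteq> s W"
    "\<And>W. W \<in> \<W> \<Longrightarrow> l W \<in> carrier (sec F W)"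
    "\<And>W W' O'. \<lbrakk>W \<in> \<W>; W' \<in> \<W>; openin X O'; O' \<subseteq> W; O' \<subseteq> W'\<rbrakk> \<Longrightarrow>
       res F W O' (l W) \<otimes>\<^bsub>sec F O'\<^esub> res F (s W \<inter> s W') O' (h (s W) (s W')) =
       res F (r W \<inter> r W') O' (g (r W) (r W')) \<otimes>\<^bsub>sec F O'\<^esub> res F W' O' (l W')"
    by (rule cohom1D) blast
  show ?thesis
  proof (rule cohom1I[where \<W> = \<W> and r = s and s = r and l = "\<lambda>W. inv\<^bsub>sec F W\<^esub> (l W)"])
    fix W W' assume W: "W \<in> \<W>" "W' \<in> \<W>"
    let ?O = "W \<inter> W'"
    have o: "openin X ?O" using * W by simp
    have sb: "?O \<subseteq> s W \<inter> s W'" "?O \<subseteq> r W \<inter> r W'" using * W by blast+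
    have c: "g (r W) (r W') \<in> carrier (sec F (r W \<inter> r W'))" "openin X (r W)" "openin X (r W')"
      "h (s W) (s W') \<in> carrier (sec F (s W \<inter> s W'))" "openin X (s W)" "openin X (s W')"
      using * W Z1D[OF *(1)] Z1D[OF *(2)] by auto
    show "res F W ?O (inv\<^bsub>sec F W\<^esub> (l W)) \<otimes>\<^bsub>sec F ?O\<^esub> res F (r W \<inter> r W') ?O (g (r W) (r W')) =
       res F (s W \<inter> s W') ?O (h (s W) (s W')) \<otimes>\<^bsub>sec F ?O\<^esub> res F W' ?O (inv\<^bsub>sec F W'\<^esub> (l W'))"
      using *(4,9)[OF W(1)] *(4,9)[OF W(2)] c sb
      by (simp add: res_inv)
        (rule group.coboundary_inv[OF group_sec[OF o] *(10)[OF W o]]; simp)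
  qed (use * in auto)
qed

text \<open>Both comparisons pull the middle cocycle \<open>h\<close> back to the common refinement, but along different
  refinement maps \<open>s\<close> and \<open>r'\<close>. The two pullbacks differ by the coboundary of the cochain with
  values \<open>h (s W) (r' W)\<close>, which is therefore inserted between the two given cochains.\<close>

lemma cohom1_trans:
  assumes "((\<U>, g), (\<V>, h)) \<in> cohom1 X F" "((\<V>, h), (\<T>, k)) \<in> cohom1 X F"
  shows "((\<U>, g), (\<T>, k)) \<in> cohom1 X F"
proof -
  from assms(1) obtain \<W> r s l where A: "(\<U>, g) \<in> Z1 X F" "(\<V>, h) \<in> Z1 X F" "open_cover X \<W>"
    "\<And>W. W \<in> \<W> \<Longrightarrow> openin X W"
    "\<And>W. W \<in> \<W> \<Longrightarrow> r W \<in> \<U>" "\<And>W. W \<in> \<W> \<Longrightarrow> W \<subseteq> r W"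
    "\<And>W. W \<in> \<W> \<Longrightarrow> s W \<in> \<V>" "\<And>W. W \<in> \<W> \<Longrightarrow> W \<subseteq> s W"
    "\<And>W. W \<in> \<W> \<Longrightarrow> l W \<in> carrier (sec F W)"
    "\<And>W W' O'. \<lbrakk>W \<in> \<W>; W' \<in> \<W>; openin X O'; O' \<subseteq> W; O' \<subseteq> W'\<rbrakk> \<Longrightarrow>
       res F W O' (l W) \<otimes>\<^bsub>sec F O'\<^esub> res F (s W \<inter> s W') O' (h (s W) (s W')) =
       res F (r W \<inter> r W') O' (g (r W) (r W')) \<otimes>\<^bsub>sec F O'\<^esub> res F W' O' (l W')"
    by (rule cohom1D) blast
  from assms(2) obtain \<W>' r' s' l' where B: "(\<V>, h) \<in> Z1 X F" "(\<T>, k) \<in> Z1 X F" "open_cover X \<W>'"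
    "\<And>W. W \<in> \<W>' \<Longrightarrow> openin X W"
    "\<And>W. W \<in> \<W>' \<Longrightarrow> r' W \<in> \<V>" "\<And>W. W \<in> \<W>' \<Longrightarrow> W \<subseteq> r' W"
    "\<And>W. W \<in> \<W>' \<Longrightarrow> s' W \<in> \<T>" "\<And>W. W \<in> \<W>' \<Longrightarrow> W \<subseteq> s' W"
    "\<And>W. W \<in> \<W>' \<Longrightarrow> l' W \<in> carrier (sec F W)"
    "\<And>W W' O'. \<lbrakk>W \<in> \<W>'; W' \<in> \<W>'; openin X O'; O' \<subseteq> W; O' \<subseteq> W'\<rbrakk> \<Longrightarrow>
       res F W O' (l' W) \<otimes>\<^bsub>sec F O'\<^esub> res F (s' W \<inter> s' W') O' (k (s' W) (s' W')) =
       res F (r' W \<inter> r' W') O' (h (r' W) (r' W')) \<otimes>\<^bsub>sec F O'\<^esub> res F W' O' (l' W')"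
    by (rule cohom1D) blast
  obtain \<N> p q where cov: "open_cover X \<N>" and pq: "\<And>N. N \<in> \<N> \<Longrightarrow> p N \<in> \<W>"
    "\<And>N. N \<in> \<N> \<Longrightarrow> N \<subseteq> p N" "\<And>N. N \<in> \<N> \<Longrightarrow> q N \<in> \<W>'" "\<And>N. N \<in> \<N> \<Longrightarrow> N \<subseteq> q N"
    by (rule open_cover_common_refinement[OF A(3) B(3)]) (rule that)
  note pq = pq(1,3,2,4) open_coverD[OF cov]
  have sub: "N \<subseteq> r (p N)" "N \<subseteq> s (p N)" "N \<subseteq> r' (q N)" "N \<subseteq> s' (q N)" if "N \<in> \<N>" for N
    using that pq A(6,8) B(6,8) by (meson subset_trans)+
  have mem: "r (p N) \<in> \<U>" "s (p N) \<in> \<V>" "r' (q N) \<in> \<V>" "s' (q N) \<in> \<T>" if "N \<in> \<N>" for N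
    using that pq A(5,7) B(5,7) by auto
  have op: "openin X (r (p N))" "openin X (s (p N))" "openin X (r' (q N))" "openin X (s' (q N))"
    "openin X (p N)" "openin X (q N)"
    if "N \<in> \<N>" for N
    using mem[OF that] Z1D(2)[OF A(1)] Z1D(2)[OF A(2)] Z1D(2)[OF B(2)] A(4) B(4) pq that by auto
  define L where "L N = res F (p N) N (l (p N)) \<otimes>\<^bsub>sec F N\<^esub>
      res F (s (p N) \<inter> r' (q N)) N (h (s (p N)) (r' (q N))) \<otimes>\<^bsub>sec F N\<^esub>
      res F (q N) N (l' (q N))" for N
  have h: "h (s (p N)) (r' (q N')) \<in> carrier (sec F (s (p N) \<inter> r' (q N')))" if "N \<in> \<N>" "N' \<in> \<N>" for N N'
    using Z1D(3)[OF A(2)] mem that by simp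
  have resL: "res F N O' (L N) = res F (p N) O' (l (p N)) \<otimes>\<^bsub>sec F O'\<^esub>
      res F (s (p N) \<inter> r' (q N)) O' (h (s (p N)) (r' (q N))) \<otimes>\<^bsub>sec F O'\<^esub>
      res F (q N) O' (l' (q N))" if "N \<in> \<N>" "openin X O'" "O' \<subseteq> N" for N O'
    unfolding L_def using that pq[OF that(1)] sub[OF that(1)] op[OF that(1)] h[OF that(1,1)]
      A(9)[OF pq(1)[OF that(1)]] B(9)[OF pq(2)[OF that(1)]]
    by (simp add: res_mult res_comp)
  show ?thesis
  proof (rule cohom1I[where \<W> = \<N> and r = "\<lambda>N. r (p N)" and s = "\<lambda>N. s' (q N)" and l = L])
    fix N assume N: "N \<in> \<N>"
    show "r (p N) \<in> \<U> \<and> N \<subseteq> r (p N) \<and> s' (q N) \<in> \<T> \<and> N \<subseteq> s' (q N) \<and> L N \<in> carrier (sec F N)"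
      unfolding L_def using N pq[OF N] sub[OF N] mem[OF N] op[OF N] h[OF N N] A(9) B(9) by simp
  next
    fix N N' assume N: "N \<in> \<N>" "N' \<in> \<N>"
    define O' where "O' = N \<inter> N'"
    have o: "openin X O'" unfolding O'_def using N pq by auto
    have O: "O' \<subseteq> N" "O' \<subseteq> N'" by (auto simp: O'_def)
    have sb: "O' \<subseteq> p N" "O' \<subseteq> p N'" "O' \<subseteq> q N" "O' \<subseteq> q N'"
      "O' \<subseteq> r (p N)" "O' \<subseteq> s (p N)" "O' \<subseteq> r' (q N)" "O' \<subseteq> s' (q N)"
      "O' \<subseteq> r (p N')" "O' \<subseteq> s (p N')" "O' \<subseteq> r' (q N')" "O' \<subseteq> s' (q N')"
      using pq(3,4)[OF N(1)] pq(3,4)[OF N(2)] sub[OF N(1)] sub[OF N(2)] O by (meson order.trans)+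
    note facts = o sb pq(1,2)[OF N(1)] pq(1,2)[OF N(2)] mem[OF N(1)] mem[OF N(2)] op[OF N(1)] op[OF N(2)]
    have e: "res F (s (p N) \<inter> r' (q N)) O' (h (s (p N)) (r' (q N))) \<otimes>\<^bsub>sec F O'\<^esub>
          res F (r' (q N) \<inter> r' (q N')) O' (h (r' (q N)) (r' (q N'))) =
        res F (s (p N) \<inter> s (p N')) O' (h (s (p N)) (s (p N'))) \<otimes>\<^bsub>sec F O'\<^esub>
          res F (s (p N') \<inter> r' (q N')) O' (h (s (p N')) (r' (q N')))"
      using facts by (simp add: Z1_restrict[OF A(2)])
    have c: "l (p N) \<in> carrier (sec F (p N))" "l (p N') \<in> carrier (sec F (p N'))"
      "l' (q N) \<in> carrier (sec F (q N))" "l' (q N') \<in> carrier (sec F (q N'))"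
      "g (r (p N)) (r (p N')) \<in> carrier (sec F (r (p N) \<inter> r (p N')))"
      "h (s (p N)) (s (p N')) \<in> carrier (sec F (s (p N) \<inter> s (p N')))"
      "h (r' (q N)) (r' (q N')) \<in> carrier (sec F (r' (q N) \<inter> r' (q N')))"
      "k (s' (q N)) (s' (q N')) \<in> carrier (sec F (s' (q N) \<inter> s' (q N')))"
      by (simp_all add: facts A(9) B(9) Z1D(3)[OF A(1)] Z1D(3)[OF A(2)] Z1D(3)[OF B(2)])
    show "res F N (N \<inter> N') (L N) \<otimes>\<^bsub>sec F (N \<inter> N')\<^esub>
           res F (s' (q N) \<inter> s' (q N')) (N \<inter> N') (k (s' (q N)) (s' (q N'))) =
         res F (r (p N) \<inter> r (p N')) (N \<inter> N') (g (r (p N)) (r (p N'))) \<otimes>\<^bsub>sec F (N \<inter> N')\<^esub>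
         res F N' (N \<inter> N') (L N')"
      unfolding O'_def[symmetric] resL[OF N(1) o O(1)] resL[OF N(2) o O(2)]
      by (rule group.coboundary_comp[OF group_sec[OF o] _ A(10)[OF pq(1)[OF N(1)] pq(1)[OF N(2)] o sb(1,2)]
            B(10)[OF pq(2)[OF N(1)] pq(2)[OF N(2)] o sb(3,4)] e])
        (use facts c h[OF N(1,1)] h[OF N(2,2)] in simp)
  qed (use A B cov in auto)
qed

text \<open>Only the values of a cochain on pairs of members of its cover matter.\<close>

lemma cohom1_cong:
  assumes "(\<U>, g) \<in> Z1 X F" "(\<U>, h) \<in> Z1 X F"
    and "\<And>U V. U \<in> \<U> \<Longrightarrow> V \<in> \<U> \<Longrightarrow> g U V = h U V"
  shows "((\<U>, g), (\<U>, h)) \<in> cohom1 X F"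
  by (rule cohom1I[where \<W> = \<U> and r = id and s = id and l = "\<lambda>U. \<one>\<^bsub>sec F U\<^esub>"])
    (use assms Z1D[OF assms(1)] in auto)

lemma cohom1_refine:
  assumes c: "(\<U>, c) \<in> Z1 X F" and W: "open_cover X \<W>" and q: "\<And>W. W \<in> \<W> \<Longrightarrow> q W \<in> \<U> \<and> W \<subseteq> q W"
  shows "((\<W>, \<lambda>U V. res F (q U \<inter> q V) (U \<inter> V) (c (q U) (q V))), (\<U>, c)) \<in> cohom1 X F"
proof (rule cohom1I[where \<W> = \<W> and r = id and s = q and l = "\<lambda>U. \<one>\<^bsub>sec F U\<^esub>"])
  note o = open_coverD[OF W]
  have q': "q W \<in> \<U>" "W \<subseteq> q W" "openin X (q W)" if "W \<in> \<W>" for W using q[OF that] Z1D(2)[OF c] by auto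
  have sub: "U \<inter> V \<subseteq> q U \<inter> q V" if "U \<in> \<W>" "V \<in> \<W>" for U V using q'(2)[OF that(1)] q'(2)[OF that(2)] by blast
  have cl: "res F (q U \<inter> q V) (U \<inter> V) (c (q U) (q V)) \<in> carrier (sec F (U \<inter> V))"
    if "U \<in> \<W>" "V \<in> \<W>" for U V
    using that o q' sub Z1D(3)[OF c] by simp
  show "(\<W>, \<lambda>U V. res F (q U \<inter> q V) (U \<inter> V) (c (q U) (q V))) \<in> Z1 X F"
  proof (rule Z1I[OF W cl])
    fix U V W assume UVW: "U \<in> \<W>" "V \<in> \<W>" "W \<in> \<W>"
    define S where "S = U \<inter> V \<inter> W"
    have S: "openin X S" "S \<subseteq> U \<inter> V" "S \<subseteq> V \<inter> W" "S \<subseteq> U \<inter> W" "S \<subseteq> q U \<inter> q V \<inter> q W"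
      using UVW o sub[OF UVW(1,2)] sub[OF UVW(2,3)] by (auto simp: S_def)
    have rc: "res F (A \<inter> B) S (res F (q A \<inter> q B) (A \<inter> B) (c (q A) (q B))) = res F (q A \<inter> q B) S (c (q A) (q B))"
      if "A \<in> \<W>" "B \<in> \<W>" "S \<subseteq> A \<inter> B" for A B
      by (rule res_comp) (use that o q' sub Z1D(3)[OF c] S in simp_all)
    show "res F (U \<inter> V) (U \<inter> V \<inter> W) (res F (q U \<inter> q V) (U \<inter> V) (c (q U) (q V))) \<otimes>\<^bsub>sec F (U \<inter> V \<inter> W)\<^esub>
       res F (V \<inter> W) (U \<inter> V \<inter> W) (res F (q V \<inter> q W) (V \<inter> W) (c (q V) (q W))) =
       res F (U \<inter> W) (U \<inter> V \<inter> W) (res F (q U \<inter> q W) (U \<inter> W) (c (q U) (q W)))"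
      unfolding S_def[symmetric] rc[OF UVW(1,2) S(2)] rc[OF UVW(2,3) S(3)] rc[OF UVW(1,3) S(4)]
      by (rule Z1_restrict[OF c]) (use UVW q' S in auto)
  qed
  fix U V assume UV: "U \<in> \<W>" "V \<in> \<W>"
  show "res F U (U \<inter> V) \<one>\<^bsub>sec F U\<^esub> \<otimes>\<^bsub>sec F (U \<inter> V)\<^esub> res F (q U \<inter> q V) (U \<inter> V) (c (q U) (q V)) =
    res F (id U \<inter> id V) (U \<inter> V) (res F (q (id U) \<inter> q (id V)) (id U \<inter> id V) (c (q (id U)) (q (id V)))) \<otimes>\<^bsub>sec F (U \<inter> V)\<^esub>
      res F V (U \<inter> V) \<one>\<^bsub>sec F V\<^esub>"
    using UV o cl by (simp add: res_id)
qed (use q open_coverD[OF W] c W in auto)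

lemma equiv_cohom1: "equiv (Z1 X F) (cohom1 X F)"
proof (rule equivI)
  show "cohom1 X F \<subseteq> Z1 X F \<times> Z1 X F" by (auto simp: cohom1_def)
  show "refl_on (Z1 X F) (cohom1 X F)"
    by (rule refl_onI) (auto intro: cohom1_cong)
  show "sym (cohom1 X F)" by (rule symI) (metis cohom1_sym surj_pair)
  show "trans (cohom1 X F)" by (rule transI) (metis cohom1_trans surj_pair)
qed

end

lemma (in presheaf_of_groups) Z1_coboundary:
  assumes U: "open_cover X \<U>" and s: "\<And>U. U \<in> \<U> \<Longrightarrow> s U \<in> carrier (sec F U)"
  shows "(\<U>, \<lambda>U V. inv\<^bsub>sec F (U \<inter> V)\<^esub> (res F U (U \<inter> V) (s U)) \<otimes>\<^bsub>sec F (U \<inter> V)\<^esub> res F V (U \<inter> V) (s V)) \<in> Z1 X F"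
    (is "(\<U>, ?g) \<in> _")
proof (rule Z1I[OF U])
  note o = open_coverD[OF U]
  show "?g U V \<in> carrier (sec F (U \<inter> V))" if "U \<in> \<U>" "V \<in> \<U>" for U V
    using that o s by simp
  fix U V W assume UVW: "U \<in> \<U>" "V \<in> \<U>" "W \<in> \<U>"
  define S where "S = U \<inter> V \<inter> W"
  have S: "openin X S" "S \<subseteq> U" "S \<subseteq> V" "S \<subseteq> W" using UVW o by (auto simp: S_def)
  have r: "res F (P \<inter> Q) S (?g P Q) = inv\<^bsub>sec F S\<^esub> (res F P S (s P)) \<otimes>\<^bsub>sec F S\<^esub> res F Q S (s Q)"
    if "P \<in> \<U>" "Q \<in> \<U>" "S \<subseteq> P" "S \<subseteq> Q" for P Q
    using that o s S by (simp add: res_mult res_inv res_comp)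
  have c: "res F P S (s P) \<in> carrier (sec F S)" if "P \<in> \<U>" "S \<subseteq> P" for P
    using that o s S by simp
  interpret S: group "sec F S" by (rule group_sec[OF S(1)])
  have "inv\<^bsub>sec F S\<^esub> (res F U S (s U)) \<otimes>\<^bsub>sec F S\<^esub> res F V S (s V) \<otimes>\<^bsub>sec F S\<^esub>
      (inv\<^bsub>sec F S\<^esub> (res F V S (s V)) \<otimes>\<^bsub>sec F S\<^esub> res F W S (s W)) =
      inv\<^bsub>sec F S\<^esub> (res F U S (s U)) \<otimes>\<^bsub>sec F S\<^esub> res F W S (s W)"
  proof -
    have "res F V S (s V) \<otimes>\<^bsub>sec F S\<^esub> (inv\<^bsub>sec F S\<^esub> (res F V S (s V)) \<otimes>\<^bsub>sec F S\<^esub> res F W S (s W)) = res F W S (s W)"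
      using c[OF UVW(2) S(3)] c[OF UVW(3) S(4)] by (simp add: S.m_assoc[symmetric])
    then show ?thesis using c UVW S by (simp add: S.m_assoc)
  qed
  then show "res F (U \<inter> V) (U \<inter> V \<inter> W) (?g U V) \<otimes>\<^bsub>sec F (U \<inter> V \<inter> W)\<^esub>
      res F (V \<inter> W) (U \<inter> V \<inter> W) (?g V W) = res F (U \<inter> W) (U \<inter> V \<inter> W) (?g U W)"
    unfolding S_def[symmetric] r[OF UVW(1,2) S(2,3)] r[OF UVW(2,3) S(3,4)] r[OF UVW(1,3) S(2,4)] .
qed

lemma Z1_map:
  assumes f: "presheaf_hom X F F' f" and F: "presheaf_of_groups X F"
    and g: "(\<U>, g) \<in> Z1 X F"
  shows "(\<U>, \<lambda>U V. f (U \<inter> V) (g U V)) \<in> Z1 X F'"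
proof (rule Z1I)
  interpret F: presheaf_of_groups X F by fact
  note f = presheaf_homD[OF f] and g' = Z1D[OF g]
  fix U V W assume UVW: "U \<in> \<U>" "V \<in> \<U>" "W \<in> \<U>"
  let ?O = "U \<inter> V \<inter> W"
  have sb: "?O \<subseteq> U \<inter> W" by blast
  have "f ?O (res F (U \<inter> V) ?O (g U V) \<otimes>\<^bsub>sec F ?O\<^esub> res F (V \<inter> W) ?O (g V W)) =
    f ?O (res F (U \<inter> W) ?O (g U W))"
    by (subst F.Z1_restrict[OF g UVW]) (use g' UVW in auto)
  then show "res F' (U \<inter> V) ?O (f (U \<inter> V) (g U V)) \<otimes>\<^bsub>sec F' ?O\<^esub>
      res F' (V \<inter> W) ?O (f (V \<inter> W) (g V W)) = res F' (U \<inter> W) ?O (f (U \<inter> W) (g U W))"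
    using f g' UVW sb by (simp add: le_infI1)
qed (use Z1D[OF g] presheaf_homD[OF f] in auto)

lemma cohom1_map:
  assumes f: "presheaf_hom X F F' f" and F: "presheaf_of_groups X F" and F': "presheaf_of_groups X F'"
    and gh: "((\<U>, g), (\<V>, h)) \<in> cohom1 X F"
  shows "((\<U>, \<lambda>U V. f (U \<inter> V) (g U V)), (\<V>, \<lambda>U V. f (U \<inter> V) (h U V))) \<in> cohom1 X F'"
proof -
  interpret F: presheaf_of_groups X F by fact
  interpret F': presheaf_of_groups X F' by fact
  from gh obtain \<W> r s l where *: "(\<U>, g) \<in> Z1 X F" "(\<V>, h) \<in> Z1 X F" "open_cover X \<W>"
    "\<And>W. W \<in> \<W> \<Longrightarrow> openin X W"
    "\<And>W. W \<in> \<W> \<Longrightarrow> r W \<in> \<U>" "\<And>W. W \<in> \<W> \<Longrightarrow> W \<subseteq> r W"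
    "\<And>W. W \<in> \<W> \<Longrightarrow> s W \<in> \<V>" "\<And>W. W \<in> \<W> \<Longrightarrow> W \<subseteq> s W"
    "\<And>W. W \<in> \<W> \<Longrightarrow> l W \<in> carrier (sec F W)"
    "\<And>W W' O'. \<lbrakk>W \<in> \<W>; W' \<in> \<W>; openin X O'; O' \<subseteq> W; O' \<subseteq> W'\<rbrakk> \<Longrightarrow>
       res F W O' (l W) \<otimes>\<^bsub>sec F O'\<^esub> res F (s W \<inter> s W') O' (h (s W) (s W')) =
       res F (r W \<inter> r W') O' (g (r W) (r W')) \<otimes>\<^bsub>sec F O'\<^esub> res F W' O' (l W')"
    by (rule F.cohom1D) blast
  note f' = presheaf_homD[OF f]
  show ?thesis
  proof (rule F'.cohom1I[where \<W> = \<W> and r = r and s = s and l = "\<lambda>W. f W (l W)"])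
    fix W W' assume W: "W \<in> \<W>" "W' \<in> \<W>"
    let ?O = "W \<inter> W'"
    have o: "openin X ?O" using * W by simp
    have sb: "?O \<subseteq> s W \<inter> s W'" "?O \<subseteq> r W \<inter> r W'" using * W by blast+
    have c: "g (r W) (r W') \<in> carrier (sec F (r W \<inter> r W'))" "openin X (r W)" "openin X (r W')"
      "h (s W) (s W') \<in> carrier (sec F (s W \<inter> s W'))" "openin X (s W)" "openin X (s W')"
      using * W Z1D[OF *(1)] Z1D[OF *(2)] by auto
    have "f ?O (res F W ?O (l W) \<otimes>\<^bsub>sec F ?O\<^esub> res F (s W \<inter> s W') ?O (h (s W) (s W'))) =
       f ?O (res F (r W \<inter> r W') ?O (g (r W) (r W')) \<otimes>\<^bsub>sec F ?O\<^esub> res F W' ?O (l W'))"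
      using *(10)[OF W o] by simp
    then show "res F' W ?O (f W (l W)) \<otimes>\<^bsub>sec F' ?O\<^esub>
        res F' (s W \<inter> s W') ?O (f (s W \<inter> s W') (h (s W) (s W'))) =
      res F' (r W \<inter> r W') ?O (f (r W \<inter> r W') (g (r W) (r W'))) \<otimes>\<^bsub>sec F' ?O\<^esub> res F' W' ?O (f W' (l W'))"
      using *(4,9)[OF W(1)] *(4,9)[OF W(2)] c sb by (simp add: f')
  qed (use * f' Z1_map[OF f F] in auto)
qed

lemma H1_map_class:
  assumes f: "presheaf_hom X F F' f" and F: "presheaf_of_groups X F" and F': "presheaf_of_groups X F'"
    and g: "(\<U>, g) \<in> Z1 X F"
  shows "H1_map X F' f (cohom1 X F `` {(\<U>, g)}) = cohom1 X F' `` {(\<U>, \<lambda>U V. f (U \<inter> V) (g U V))}"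
proof -
  note eq = presheaf_of_groups.equiv_cohom1[OF F] and eq' = presheaf_of_groups.equiv_cohom1[OF F']
  have "cohom1 X F' `` {(\<V>, \<lambda>U V. f (U \<inter> V) (h U V))} = cohom1 X F' `` {(\<U>, \<lambda>U V. f (U \<inter> V) (g U V))}"
    if "((\<U>, g), (\<V>, h)) \<in> cohom1 X F" for \<V> h
    using equiv_class_eq[OF eq' cohom1_map[OF f F F' that]] by simp
  moreover have "((\<U>, g), (\<U>, g)) \<in> cohom1 X F"
    using eq g by (simp add: equiv_def refl_on_def)
  ultimately show ?thesis
    unfolding H1_map_def by blast
qed

section \<open>Sheafification\<close>

context presheaf_of_groups
begin

lemma germ_self:
  "\<lbrakk>openin X U; x \<in> U; s \<in> carrier (sec F U)\<rbrakk> \<Longrightarrow> (U, s) \<in> germ X F x U s"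
  unfolding germ_def by auto

lemma germ_memD:
  assumes "(V, t) \<in> germ X F x U s"
  obtains W where "openin X V" "t \<in> carrier (sec F V)" "openin X W" "x \<in> W" "W \<subseteq> U" "W \<subseteq> V"
    "res F U W s = res F V W t"
  using assms unfolding germ_def by auto

text \<open>Two sections that agree near a point have the same germ there; one inclusion suffices by
  symmetry.\<close>

lemma germ_subset:
  assumes "openin X U" "openin X V" "openin X W" "x \<in> W" "W \<subseteq> U" "W \<subseteq> V"
    and "s \<in> carrier (sec F U)" "t \<in> carrier (sec F V)" "res F U W s = res F V W t"
  shows "germ X F x U s \<subseteq> germ X F x V t"
proof (rule subrelI)
  fix P p assume "(P, p) \<in> germ X F x U s"
  then obtain W1 where P: "openin X P" "p \<in> carrier (sec F P)" "openin X W1" "x \<in> W1"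
    "W1 \<subseteq> U" "W1 \<subseteq> P" "res F U W1 s = res F P W1 p" by (rule germ_memD)
  have sb: "W \<inter> W1 \<subseteq> V \<inter> P" using assms P by blast
  have "res F V (W \<inter> W1) t = res F W (W \<inter> W1) (res F V W t)" using assms P by (simp add: res_comp)
  also have "\<dots> = res F W1 (W \<inter> W1) (res F U W1 s)"
    unfolding assms(9)[symmetric] using assms(1,3-7) P(1-6) by (simp add: res_comp)
  also have "\<dots> = res F P (W \<inter> W1) p" unfolding P(7) using P assms(3) by (simp add: res_comp)
  finally have "openin X (W \<inter> W1) \<and> x \<in> W \<inter> W1 \<and> W \<inter> W1 \<subseteq> V \<inter> P \<and>
      res F V (W \<inter> W1) t = res F P (W \<inter> W1) p"
    using assms(3,4) P(3,4) sb by simp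
  then show "(P, p) \<in> germ X F x V t"
    using P assms(4) sb unfolding germ_def by blast
qed

lemma germ_eq:
  assumes "openin X U" "openin X V" "openin X W" "x \<in> W" "W \<subseteq> U" "W \<subseteq> V"
    and "s \<in> carrier (sec F U)" "t \<in> carrier (sec F V)" "res F U W s = res F V W t"
  shows "germ X F x U s = germ X F x V t"
  using germ_subset[OF assms] germ_subset[OF assms(2,1,3,4,6,5,8,7) assms(9)[symmetric]] by simp

lemma germ_eqD:
  assumes "openin X U" "openin X V" "x \<in> V" "t \<in> carrier (sec F V)"
    and "germ X F x U s = germ X F x V t"
  obtains W where "openin X W" "x \<in> W" "W \<subseteq> U" "W \<subseteq> V" "res F U W s = res F V W t"
proof -
  have "(V, t) \<in> germ X F x U s" using assms(5) germ_self[OF assms(2-4)] by simp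
  then show ?thesis using that unfolding germ_def by auto
qed

lemma germ_res:
  "\<lbrakk>openin X U; openin X V; x \<in> V; V \<subseteq> U; s \<in> carrier (sec F U)\<rbrakk>
    \<Longrightarrow> germ X F x V (res F U V s) = germ X F x U s"
  by (rule germ_eq[of _ _ V]) (auto simp: res_id)

lemma stalk_mult_germ:
  assumes "openin X U" "x \<in> U" "s \<in> carrier (sec F U)" "t \<in> carrier (sec F U)"
  shows "stalk_mult X F x (germ X F x U s) (germ X F x U t) = germ X F x U (s \<otimes>\<^bsub>sec F U\<^esub> t)"
proof -
  have "germ X F x (V \<inter> V') (res F V (V \<inter> V') s' \<otimes>\<^bsub>sec F (V \<inter> V')\<^esub> res F V' (V \<inter> V') t')
      = germ X F x U (s \<otimes>\<^bsub>sec F U\<^esub> t)"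
    if V: "(V, s') \<in> germ X F x U s" and V': "(V', t') \<in> germ X F x U t" for V s' V' t'
  proof -
    obtain W where W: "openin X V" "s' \<in> carrier (sec F V)" "openin X W" "x \<in> W" "W \<subseteq> U" "W \<subseteq> V"
      "res F U W s = res F V W s'" using germ_memD[OF V] .
    obtain W' where W': "openin X V'" "t' \<in> carrier (sec F V')" "openin X W'" "x \<in> W'" "W' \<subseteq> U" "W' \<subseteq> V'"
      "res F U W' t = res F V' W' t'" using germ_memD[OF V'] .
    let ?O = "W \<inter> W'"
    have sb: "?O \<subseteq> W" "?O \<subseteq> W'" "?O \<subseteq> V" "?O \<subseteq> V'" "?O \<subseteq> U" "?O \<subseteq> V \<inter> V'" using W W' by blast+
    have "res F V ?O s' = res F W ?O (res F V W s')" using W W' by (simp add: res_comp)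
    also have "\<dots> = res F U ?O s" using W W' assms by (simp add: W(7)[symmetric] res_comp)
    finally have 1: "res F V ?O s' = res F U ?O s" .
    have "res F V' ?O t' = res F W' ?O (res F V' W' t')" using W W' by (simp add: res_comp)
    also have "\<dots> = res F U ?O t" using W W' assms by (simp add: W'(7)[symmetric] res_comp)
    finally have 2: "res F V' ?O t' = res F U ?O t" .
    show ?thesis
      by (rule germ_eq[of _ _ ?O]) (use assms W W' sb 1 2 in \<open>simp_all add: res_mult res_comp\<close>)
  qed
  then have "stalk_mult X F x (germ X F x U s) (germ X F x U t) =
      (\<Union>p\<in>germ X F x U s. \<Union>q\<in>germ X F x U t. germ X F x U (s \<otimes>\<^bsub>sec F U\<^esub> t))"
    unfolding stalk_mult_def by (intro SUP_cong refl) auto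
  then show ?thesis
    using germ_self[OF assms(1-3)] germ_self[OF assms(1,2,4)] by auto
qed

end

text \<open>Stated for morphisms of presheaves of sets because it is applied to the inversion map, which
  is not a homomorphism in general but yields inverses in the sheafification.\<close>

lemma germ_map:
  assumes F: "presheaf_of_groups X F" and F': "presheaf_of_groups X F'"
    and fc: "\<And>U s. \<lbrakk>openin X U; s \<in> carrier (sec F U)\<rbrakk> \<Longrightarrow> f U s \<in> carrier (sec F' U)"
    and fr: "\<And>U V s. \<lbrakk>openin X U; openin X V; V \<subseteq> U; s \<in> carrier (sec F U)\<rbrakk> \<Longrightarrow>
      f V (res F U V s) = res F' U V (f U s)"
    and U: "openin X U" "x \<in> U" "s \<in> carrier (sec F U)"
  shows "(\<Union>(V, t) \<in> germ X F x U s. germ X F' x V (f V t)) = germ X F' x U (f U s)"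
proof -
  interpret F: presheaf_of_groups X F by fact
  interpret F': presheaf_of_groups X F' by fact
  have "germ X F' x V (f V t) = germ X F' x U (f U s)" if V: "(V, t) \<in> germ X F x U s" for V t
  proof -
    obtain W where W: "openin X V" "t \<in> carrier (sec F V)" "openin X W" "x \<in> W" "W \<subseteq> U" "W \<subseteq> V"
      "res F U W s = res F V W t" using F.germ_memD[OF V] .
    show ?thesis
      by (rule F'.germ_eq[of _ _ W]) (use U W in \<open>simp_all add: fc fr[symmetric]\<close>)
  qed
  then show ?thesis using F.germ_self[OF U] by blast
qed

lemma res_sheafify [simp]: "res (sheafify X F) U V \<sigma> = restrict \<sigma> V"
  by (simp add: sheafify_def)

lemma mult_sheafify [simp]:
  "\<sigma> \<otimes>\<^bsub>sec (sheafify X F) U\<^esub> \<tau> = (\<lambda>x\<in>U. stalk_mult X F x (\<sigma> x) (\<tau> x))"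
  by (simp add: sheafify_def)

lemma one_sheafify [simp]: "\<one>\<^bsub>sec (sheafify X F) U\<^esub> = (\<lambda>x\<in>U. germ X F x U \<one>\<^bsub>sec F U\<^esub>)"
  by (simp add: sheafify_def)

lemma sheafify_extensional: "\<sigma> \<in> carrier (sec (sheafify X F) U) \<Longrightarrow> \<sigma> \<in> extensional U"
  by (simp add: sheafify_def)

lemma sheafify_local:
  assumes "\<sigma> \<in> carrier (sec (sheafify X F) U)" "x \<in> U"
  obtains V t where "openin X V" "x \<in> V" "V \<subseteq> U" "t \<in> carrier (sec F V)"
    "\<And>y. y \<in> V \<Longrightarrow> \<sigma> y = germ X F y V t"
  using assms by (auto simp: sheafify_def)

lemma sheafifyI:
  assumes "\<sigma> \<in> extensional U"
    and "\<And>x. x \<in> U \<Longrightarrow> \<exists>V t. openin X V \<and> x \<in> V \<and> V \<subseteq> U \<and>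
            t \<in> carrier (sec F V) \<and> (\<forall>y \<in> V. \<sigma> y = germ X F y V t)"
  shows "\<sigma> \<in> carrier (sec (sheafify X F) U)"
  using assms by (auto simp: sheafify_def)

definition sheafify_unit ::
    "'x topology \<Rightarrow> ('x, 'g) presheaf \<Rightarrow> 'x set \<Rightarrow> 'g \<Rightarrow> ('x \<Rightarrow> ('x set \<times> 'g) set)" where
  "sheafify_unit X F U s = (\<lambda>x\<in>U. germ X F x U s)"

context presheaf_of_groups
begin

lemma sheafify_local2:
  assumes "\<sigma> \<in> carrier (sec (sheafify X F) U)" "\<tau> \<in> carrier (sec (sheafify X F) U)" "x \<in> U"
  obtains V s t where "openin X V" "x \<in> V" "V \<subseteq> U" "s \<in> carrier (sec F V)" "t \<in> carrier (sec F V)"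
    "\<And>y. y \<in> V \<Longrightarrow> \<sigma> y = germ X F y V s" "\<And>y. y \<in> V \<Longrightarrow> \<tau> y = germ X F y V t"
proof -
  obtain V s where V: "openin X V" "x \<in> V" "V \<subseteq> U" "s \<in> carrier (sec F V)"
    "\<And>y. y \<in> V \<Longrightarrow> \<sigma> y = germ X F y V s" by (rule sheafify_local[OF assms(1,3)]) blast
  obtain V' t where V': "openin X V'" "x \<in> V'" "V' \<subseteq> U" "t \<in> carrier (sec F V')"
    "\<And>y. y \<in> V' \<Longrightarrow> \<tau> y = germ X F y V' t" by (rule sheafify_local[OF assms(2,3)]) blast
  show ?thesis
    by (rule that[of "V \<inter> V'" "res F V (V \<inter> V') s" "res F V' (V \<inter> V') t"])
      (use V V' in \<open>auto simp: germ_res\<close>)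
qed

lemma sheafify_local3:
  assumes "\<sigma> \<in> carrier (sec (sheafify X F) U)" "\<tau> \<in> carrier (sec (sheafify X F) U)"
    "\<rho> \<in> carrier (sec (sheafify X F) U)" "x \<in> U"
  obtains V s t r where "openin X V" "x \<in> V" "V \<subseteq> U"
    "s \<in> carrier (sec F V)" "t \<in> carrier (sec F V)" "r \<in> carrier (sec F V)"
    "\<And>y. y \<in> V \<Longrightarrow> \<sigma> y = germ X F y V s" "\<And>y. y \<in> V \<Longrightarrow> \<tau> y = germ X F y V t"
    "\<And>y. y \<in> V \<Longrightarrow> \<rho> y = germ X F y V r"
proof -
  obtain V s t where V: "openin X V" "x \<in> V" "V \<subseteq> U" "s \<in> carrier (sec F V)" "t \<in> carrier (sec F V)"
    "\<And>y. y \<in> V \<Longrightarrow> \<sigma> y = germ X F y V s" "\<And>y. y \<in> V \<Longrightarrow> \<tau> y = germ X F y V t"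
    by (rule sheafify_local2[OF assms(1,2,4)]) blast
  obtain V' r where V': "openin X V'" "x \<in> V'" "V' \<subseteq> U" "r \<in> carrier (sec F V')"
    "\<And>y. y \<in> V' \<Longrightarrow> \<rho> y = germ X F y V' r" by (rule sheafify_local[OF assms(3,4)]) blast
  show ?thesis
    by (rule that[of "V \<inter> V'" "res F V (V \<inter> V') s" "res F V (V \<inter> V') t" "res F V' (V \<inter> V') r"])
      (use V V' in \<open>auto simp: germ_res\<close>)
qed

lemma sheafify_mult_closed:
  assumes "\<sigma> \<in> carrier (sec (sheafify X F) U)" "\<tau> \<in> carrier (sec (sheafify X F) U)"
  shows "\<sigma> \<otimes>\<^bsub>sec (sheafify X F) U\<^esub> \<tau> \<in> carrier (sec (sheafify X F) U)"
proof (rule sheafifyI)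
  fix x assume "x \<in> U"
  then obtain V s t where V: "openin X V" "x \<in> V" "V \<subseteq> U" "s \<in> carrier (sec F V)" "t \<in> carrier (sec F V)"
    "\<And>y. y \<in> V \<Longrightarrow> \<sigma> y = germ X F y V s" "\<And>y. y \<in> V \<Longrightarrow> \<tau> y = germ X F y V t"
    by (rule sheafify_local2[OF assms]) blast
  have "\<forall>y\<in>V. (\<sigma> \<otimes>\<^bsub>sec (sheafify X F) U\<^esub> \<tau>) y = germ X F y V (s \<otimes>\<^bsub>sec F V\<^esub> t)"
    using V by (auto simp: stalk_mult_germ subset_eq)
  then show "\<exists>V t. openin X V \<and> x \<in> V \<and> V \<subseteq> U \<and> t \<in> carrier (sec F V) \<and>
      (\<forall>y \<in> V. (\<sigma> \<otimes>\<^bsub>sec (sheafify X F) U\<^esub> \<tau>) y = germ X F y V t)"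
    using V by (intro exI[of _ V] exI[of _ "s \<otimes>\<^bsub>sec F V\<^esub> t"]) simp
qed simp

lemma sheafify_one_closed:
  assumes "openin X U"
  shows "\<one>\<^bsub>sec (sheafify X F) U\<^esub> \<in> carrier (sec (sheafify X F) U)"
  by (rule sheafifyI, simp, intro exI[of _ U] exI[of _ "\<one>\<^bsub>sec F U\<^esub>"]) (use assms in auto)

lemma group_sheafify:
  assumes U: "openin X U"
  shows "group (sec (sheafify X F) U)"
proof (rule groupI)
  fix \<sigma> \<tau> \<rho>
  assume A: "\<sigma> \<in> carrier (sec (sheafify X F) U)" "\<tau> \<in> carrier (sec (sheafify X F) U)"
    "\<rho> \<in> carrier (sec (sheafify X F) U)"
  show "\<sigma> \<otimes>\<^bsub>sec (sheafify X F) U\<^esub> \<tau> \<otimes>\<^bsub>sec (sheafify X F) U\<^esub> \<rho> =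
    \<sigma> \<otimes>\<^bsub>sec (sheafify X F) U\<^esub> (\<tau> \<otimes>\<^bsub>sec (sheafify X F) U\<^esub> \<rho>)"
  proof -
    have "stalk_mult X F x (stalk_mult X F x (\<sigma> x) (\<tau> x)) (\<rho> x) =
        stalk_mult X F x (\<sigma> x) (stalk_mult X F x (\<tau> x) (\<rho> x))" if x: "x \<in> U" for x
    proof -
      obtain V s t r where V: "openin X V" "x \<in> V" "V \<subseteq> U"
        "s \<in> carrier (sec F V)" "t \<in> carrier (sec F V)" "r \<in> carrier (sec F V)"
        "\<And>y. y \<in> V \<Longrightarrow> \<sigma> y = germ X F y V s" "\<And>y. y \<in> V \<Longrightarrow> \<tau> y = germ X F y V t"
        "\<And>y. y \<in> V \<Longrightarrow> \<rho> y = germ X F y V r" by (rule sheafify_local3[OF A x]) blast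
      then show ?thesis
        by (simp add: stalk_mult_germ group_sec group.is_monoid monoid.m_assoc)
    qed
    then show ?thesis by (auto simp: fun_eq_iff)
  qed
next
  fix \<sigma> assume A: "\<sigma> \<in> carrier (sec (sheafify X F) U)"
  have "stalk_mult X F x (germ X F x U \<one>\<^bsub>sec F U\<^esub>) (\<sigma> x) = \<sigma> x" if x: "x \<in> U" for x
  proof -
    obtain V s where V: "openin X V" "x \<in> V" "V \<subseteq> U" "s \<in> carrier (sec F V)"
      "\<And>y. y \<in> V \<Longrightarrow> \<sigma> y = germ X F y V s" by (rule sheafify_local[OF A x]) blast
    have "germ X F x U \<one>\<^bsub>sec F U\<^esub> = germ X F x V \<one>\<^bsub>sec F V\<^esub>"
      using germ_res[OF U V(1,2,3), of "\<one>\<^bsub>sec F U\<^esub>"] U V by simp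
    then show ?thesis using V by (simp add: stalk_mult_germ)
  qed
  then show "\<one>\<^bsub>sec (sheafify X F) U\<^esub> \<otimes>\<^bsub>sec (sheafify X F) U\<^esub> \<sigma> = \<sigma>"
    using sheafify_extensional[OF A] by (intro extensionalityI) auto
next
  fix \<sigma> assume A: "\<sigma> \<in> carrier (sec (sheafify X F) U)"
  \<comment> \<open>The inverse of a section is taken germ by germ.\<close>
  define \<tau> where "\<tau> = (\<lambda>x\<in>U. \<Union>(V, s) \<in> \<sigma> x. germ X F x V (inv\<^bsub>sec F V\<^esub> s))"
  have \<tau>: "\<tau> y = germ X F y V (inv\<^bsub>sec F V\<^esub> s)"
    if "y \<in> V" "openin X V" "V \<subseteq> U" "s \<in> carrier (sec F V)" "\<sigma> y = germ X F y V s" for y V s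
    using that germ_map[OF presheaf_of_groups_axioms presheaf_of_groups_axioms,
        where f = "\<lambda>U s. inv\<^bsub>sec F U\<^esub> s"]
    by (auto simp: \<tau>_def res_inv subset_eq)
  have "\<tau> \<in> carrier (sec (sheafify X F) U)"
  proof (rule sheafifyI)
    fix x assume "x \<in> U"
    then obtain V s where V: "openin X V" "x \<in> V" "V \<subseteq> U" "s \<in> carrier (sec F V)"
      "\<And>y. y \<in> V \<Longrightarrow> \<sigma> y = germ X F y V s" by (rule sheafify_local[OF A]) blast
    then show "\<exists>V t. openin X V \<and> x \<in> V \<and> V \<subseteq> U \<and> t \<in> carrier (sec F V) \<and> (\<forall>y \<in> V. \<tau> y = germ X F y V t)"
      by (intro exI[of _ V] exI[of _ "inv\<^bsub>sec F V\<^esub> s"]) (simp add: \<tau>)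
  qed (simp add: \<tau>_def)
  moreover have "stalk_mult X F x (\<tau> x) (\<sigma> x) = germ X F x U \<one>\<^bsub>sec F U\<^esub>" if x: "x \<in> U" for x
  proof -
    obtain V s where V: "openin X V" "x \<in> V" "V \<subseteq> U" "s \<in> carrier (sec F V)"
      "\<And>y. y \<in> V \<Longrightarrow> \<sigma> y = germ X F y V s" by (rule sheafify_local[OF A x]) blast
    have "germ X F x U \<one>\<^bsub>sec F U\<^esub> = germ X F x V \<one>\<^bsub>sec F V\<^esub>"
      using germ_res[OF U V(1,2,3), of "\<one>\<^bsub>sec F U\<^esub>"] U V by simp
    then show ?thesis using V by (simp add: \<tau> stalk_mult_germ group_sec group.l_inv)
  qed
  then have "\<tau> \<otimes>\<^bsub>sec (sheafify X F) U\<^esub> \<sigma> = \<one>\<^bsub>sec (sheafify X F) U\<^esub>"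
    by (auto simp: fun_eq_iff)
  ultimately show "\<exists>\<tau>\<in>carrier (sec (sheafify X F) U).
      \<tau> \<otimes>\<^bsub>sec (sheafify X F) U\<^esub> \<sigma> = \<one>\<^bsub>sec (sheafify X F) U\<^esub>" by blast
qed (use sheafify_mult_closed sheafify_one_closed[OF U] in auto)

lemma sheafify_res_closed:
  assumes V: "openin X V" "V \<subseteq> U" and A: "\<sigma> \<in> carrier (sec (sheafify X F) U)"
  shows "restrict \<sigma> V \<in> carrier (sec (sheafify X F) V)"
proof (rule sheafifyI)
  fix x assume x: "x \<in> V"
  then have "x \<in> U" using V by blast
  then obtain W s where W: "openin X W" "x \<in> W" "W \<subseteq> U" "s \<in> carrier (sec F W)"
      "\<And>y. y \<in> W \<Longrightarrow> \<sigma> y = germ X F y W s" by (rule sheafify_local[OF A]) blast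
  show "\<exists>W t. openin X W \<and> x \<in> W \<and> W \<subseteq> V \<and> t \<in> carrier (sec F W) \<and> (\<forall>y \<in> W. restrict \<sigma> V y = germ X F y W t)"
    by (rule exI[of _ "W \<inter> V"], rule exI[of _ "res F W (W \<inter> V) s"])
      (use W V x in \<open>auto simp: germ_res\<close>)
qed simp

lemma presheaf_of_groups_sheafify: "presheaf_of_groups X (sheafify X F)"
proof (rule presheaf_of_groups.intro)
  fix U V assume U: "openin X U" "openin X V" "V \<subseteq> U"
  show "res (sheafify X F) U V \<in> hom (sec (sheafify X F) U) (sec (sheafify X F) V)"
  proof (rule homI)
    fix \<sigma> \<tau>
    show "res (sheafify X F) U V (\<sigma> \<otimes>\<^bsub>sec (sheafify X F) U\<^esub> \<tau>) =
        res (sheafify X F) U V \<sigma> \<otimes>\<^bsub>sec (sheafify X F) V\<^esub> res (sheafify X F) U V \<tau>"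
      using U by (auto simp: fun_eq_iff subset_eq)
  qed (use sheafify_res_closed[OF U(2,3)] in simp)
next
  fix U s assume "openin X U" "s \<in> carrier (sec (sheafify X F) U)"
  then show "res (sheafify X F) U U s = s"
    using sheafify_extensional[of s X F U] by (simp add: extensional_restrict)
next
  fix U V W s assume "openin X U" "openin X V" "openin X W" and "W \<subseteq> V" "V \<subseteq> U"
  then show "res (sheafify X F) V W (res (sheafify X F) U V s) = res (sheafify X F) U W s"
    by (simp add: Int_absorb1)
qed (rule group_sheafify)

text \<open>Sections of a sheafification are functions on points, which makes them easy to glue and to
  compare.\<close>

lemma sheaf_of_groups_sheafify: "sheaf_of_groups X (sheafify X F)"
proof (intro sheaf_of_groups.intro presheaf_of_groups_sheafify sheaf_of_groups_axioms.intro)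
  fix \<U> \<sigma> \<tau>
  assume A: "\<sigma> \<in> carrier (sec (sheafify X F) (\<Union>\<U>))" "\<tau> \<in> carrier (sec (sheafify X F) (\<Union>\<U>))"
    and eq: "\<And>U. U \<in> \<U> \<Longrightarrow> res (sheafify X F) (\<Union>\<U>) U \<sigma> = res (sheafify X F) (\<Union>\<U>) U \<tau>"
  show "\<sigma> = \<tau>"
  proof (rule extensionalityI)
    fix x assume "x \<in> \<Union>\<U>"
    then obtain U where "x \<in> U" "restrict \<sigma> U = restrict \<tau> U" using eq by auto
    then show "\<sigma> x = \<tau> x" by (metis restrict_apply')
  qed (use A sheafify_extensional in auto)
next
  fix \<U> f
  assume op: "\<And>U. U \<in> \<U> \<Longrightarrow> openin X U" and f: "\<And>U. U \<in> \<U> \<Longrightarrow> f U \<in> carrier (sec (sheafify X F) U)"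
    and compat: "\<And>U V. U \<in> \<U> \<Longrightarrow> V \<in> \<U> \<Longrightarrow>
      res (sheafify X F) U (U \<inter> V) (f U) = res (sheafify X F) V (U \<inter> V) (f V)"
  define \<sigma> where "\<sigma> = (\<lambda>x\<in>\<Union>\<U>. f (SOME U. U \<in> \<U> \<and> x \<in> U) x)"
  have \<sigma>: "\<sigma> x = f U x" if "U \<in> \<U>" "x \<in> U" for U x
  proof -
    define V where "V = (SOME U. U \<in> \<U> \<and> x \<in> U)"
    have V: "V \<in> \<U> \<and> x \<in> V" unfolding V_def by (rule someI[of _ U]) (use that in simp)
    then have "restrict (f U) (U \<inter> V) = restrict (f V) (U \<inter> V)" using compat[of U V] that by simp
    from fun_cong[OF this, of x] have "f U x = f V x" using that V by simp
    moreover have "x \<in> \<Union>\<U>" using that by blast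
    ultimately show ?thesis by (simp only: \<sigma>_def V_def restrict_apply if_True)
  qed
  have "\<sigma> \<in> carrier (sec (sheafify X F) (\<Union>\<U>))"
  proof (rule sheafifyI)
    fix x assume "x \<in> \<Union>\<U>"
    then obtain U where U: "U \<in> \<U>" "x \<in> U" by blast
    obtain V s where V: "openin X V" "x \<in> V" "V \<subseteq> U" "s \<in> carrier (sec F V)"
      "\<And>y. y \<in> V \<Longrightarrow> f U y = germ X F y V s" by (rule sheafify_local[OF f[OF U(1)] U(2)]) blast
    then show "\<exists>V t. openin X V \<and> x \<in> V \<and> V \<subseteq> \<Union>\<U> \<and> t \<in> carrier (sec F V) \<and>
        (\<forall>y\<in>V. \<sigma> y = germ X F y V t)"
      using U(1) by (intro exI[of _ V] exI[of _ s]) (auto simp: \<sigma>[OF U(1)] subset_iff)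
  qed (simp add: \<sigma>_def)
  moreover have "restrict \<sigma> U = f U" if U: "U \<in> \<U>" for U
  proof (rule extensionalityI)
    show "f U \<in> extensional U" by (rule sheafify_extensional[OF f[OF U]])
  qed (simp_all add: \<sigma>[OF U])
  ultimately show "\<exists>s\<in>carrier (sec (sheafify X F) (\<Union>\<U>)). \<forall>U\<in>\<U>. res (sheafify X F) (\<Union>\<U>) U s = f U"
    by auto
qed

lemma sheafify_unit_hom: "presheaf_hom X F (sheafify X F) (sheafify_unit X F)"
  unfolding presheaf_hom_def
proof (intro conjI allI impI)
  fix U assume U: "openin X U"
  show "sheafify_unit X F U \<in> hom (sec F U) (sec (sheafify X F) U)"
  proof (rule homI)
    fix s assume "s \<in> carrier (sec F U)"
    then show "sheafify_unit X F U s \<in> carrier (sec (sheafify X F) U)"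
      using U by (intro sheafifyI) (auto simp: sheafify_unit_def)
  qed (use U in \<open>auto simp: sheafify_unit_def fun_eq_iff stalk_mult_germ\<close>)
next
  fix U V s assume "openin X U \<and> openin X V \<and> V \<subseteq> U \<and> s \<in> carrier (sec F U)"
  then show "sheafify_unit X F V (res F U V s) = res (sheafify X F) U V (sheafify_unit X F U s)"
    by (auto simp: sheafify_unit_def fun_eq_iff germ_res)
qed

lemma sheafify_unit_locally_surj:
  assumes "\<sigma> \<in> carrier (sec (sheafify X F) U)" "x \<in> U"
  obtains V s where "openin X V" "x \<in> V" "V \<subseteq> U" "s \<in> carrier (sec F V)"
    "res (sheafify X F) U V \<sigma> = sheafify_unit X F V s"
proof -
  obtain V s where V: "openin X V" "x \<in> V" "V \<subseteq> U" "s \<in> carrier (sec F V)"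
      "\<And>y. y \<in> V \<Longrightarrow> \<sigma> y = germ X F y V s" by (rule sheafify_local[OF assms]) blast
  then show ?thesis by (intro that[of V s]) (auto simp: sheafify_unit_def fun_eq_iff)
qed

lemma sheafify_unit_eqD:
  assumes "openin X U" "s \<in> carrier (sec F U)" "t \<in> carrier (sec F U)"
    and "sheafify_unit X F U s = sheafify_unit X F U t" "x \<in> U"
  obtains V where "openin X V" "x \<in> V" "V \<subseteq> U" "res F U V s = res F U V t"
proof -
  have "germ X F x U s = germ X F x U t"
    using fun_cong[OF assms(4), of x] assms(5) by (simp add: sheafify_unit_def)
  then show ?thesis using germ_eqD[OF assms(1,1,5,3)] that by blast
qed

end

text \<open>The induced morphism of sheafifications is determined by this equation, since every section
  of a sheafification is locally the image of a section of the presheaf.\<close>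

lemma sheafify_map_unit:
  assumes "presheaf_of_groups X F" "presheaf_of_groups X F'" "presheaf_hom X F F' f"
    and "openin X U" "s \<in> carrier (sec F U)"
  shows "sheafify_map X F' f U (sheafify_unit X F U s) = sheafify_unit X F' U (f U s)"
  using germ_map[of X F F' f U _ s] assms presheaf_homD[OF assms(3)]
  by (auto simp: sheafify_map_def sheafify_unit_def fun_eq_iff)

lemma sheafify_map_res:
  assumes "V \<subseteq> U"
  shows "sheafify_map X F' f V (restrict \<sigma> V) = restrict (sheafify_map X F' f U \<sigma>) V"
  using assms by (auto simp: sheafify_map_def fun_eq_iff)

lemma sheafify_map_hom:
  assumes F: "presheaf_of_groups X F" and F': "presheaf_of_groups X F'" and f: "presheaf_hom X F F' f"
  shows "presheaf_hom X (sheafify X F) (sheafify X F') (sheafify_map X F' f)"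
  unfolding presheaf_hom_def
proof (intro conjI allI impI)
  interpret F: presheaf_of_groups X F by fact
  interpret F': presheaf_of_groups X F' by fact
  note f' = presheaf_homD[OF f]
  have germ: "sheafify_map X F' f U \<sigma> y = germ X F' y V (f V s)"
    if "y \<in> V" "V \<subseteq> U" "openin X V" "s \<in> carrier (sec F V)" "\<sigma> y = germ X F y V s" for U V s \<sigma> y
    using that germ_map[OF F F', where f = f] f' by (auto simp: sheafify_map_def subset_eq)
  fix U assume U: "openin X U"
  show "sheafify_map X F' f U \<in> hom (sec (sheafify X F) U) (sec (sheafify X F') U)"
  proof (rule homI)
    fix \<sigma> assume A: "\<sigma> \<in> carrier (sec (sheafify X F) U)"
    show "sheafify_map X F' f U \<sigma> \<in> carrier (sec (sheafify X F') U)"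
    proof (rule sheafifyI)
      fix x assume "x \<in> U"
      then obtain V s where V: "openin X V" "x \<in> V" "V \<subseteq> U" "s \<in> carrier (sec F V)"
        "\<And>y. y \<in> V \<Longrightarrow> \<sigma> y = germ X F y V s" by (rule sheafify_local[OF A]) blast
      then have "\<forall>y\<in>V. sheafify_map X F' f U \<sigma> y = germ X F' y V (f V s)" "f V s \<in> carrier (sec F' V)"
        using germ f' by auto
      with V show "\<exists>V t. openin X V \<and> x \<in> V \<and> V \<subseteq> U \<and> t \<in> carrier (sec F' V) \<and>
          (\<forall>y \<in> V. sheafify_map X F' f U \<sigma> y = germ X F' y V t)"
        by (intro exI[of _ V] exI[of _ "f V s"]) simp
    qed (simp add: sheafify_map_def)
  next
    fix \<sigma> \<tau> assume A: "\<sigma> \<in> carrier (sec (sheafify X F) U)" "\<tau> \<in> carrier (sec (sheafify X F) U)"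
    have "sheafify_map X F' f U (\<sigma> \<otimes>\<^bsub>sec (sheafify X F) U\<^esub> \<tau>) x =
        stalk_mult X F' x (sheafify_map X F' f U \<sigma> x) (sheafify_map X F' f U \<tau> x)" if x: "x \<in> U" for x
    proof -
      obtain V s t where V: "openin X V" "x \<in> V" "V \<subseteq> U" "s \<in> carrier (sec F V)" "t \<in> carrier (sec F V)"
        "\<And>y. y \<in> V \<Longrightarrow> \<sigma> y = germ X F y V s" "\<And>y. y \<in> V \<Longrightarrow> \<tau> y = germ X F y V t"
        by (rule F.sheafify_local2[OF A x]) blast
      have "(\<sigma> \<otimes>\<^bsub>sec (sheafify X F) U\<^esub> \<tau>) x = germ X F x V (s \<otimes>\<^bsub>sec F V\<^esub> t)"
        using V x by (simp add: F.stalk_mult_germ)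
      then have "sheafify_map X F' f U (\<sigma> \<otimes>\<^bsub>sec (sheafify X F) U\<^esub> \<tau>) x = germ X F' x V (f V (s \<otimes>\<^bsub>sec F V\<^esub> t))"
        using germ V by simp
      also have "\<dots> = stalk_mult X F' x (germ X F' x V (f V s)) (germ X F' x V (f V t))"
        using V f' by (simp add: F'.stalk_mult_germ)
      also have "\<dots> = stalk_mult X F' x (sheafify_map X F' f U \<sigma> x) (sheafify_map X F' f U \<tau> x)"
        using germ[OF V(2,3,1,4), of \<sigma>] germ[OF V(2,3,1,5), of \<tau>] V(2,6,7) by simp
      finally show ?thesis .
    qed
    then show "sheafify_map X F' f U (\<sigma> \<otimes>\<^bsub>sec (sheafify X F) U\<^esub> \<tau>) =
        sheafify_map X F' f U \<sigma> \<otimes>\<^bsub>sec (sheafify X F') U\<^esub> sheafify_map X F' f U \<tau>"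
      by (intro extensionalityI[of _ U]) (auto simp: sheafify_map_def)
  qed
qed (simp add: sheafify_map_res)

section \<open>Quotient sheaves\<close>

locale sheaf_quotient = G: sheaf_of_groups X G
  for X :: "'x topology" and G :: "('x, 'g) presheaf" +
  fixes M N :: "'x set \<Rightarrow> 'g set"
  assumes M: "sheaf_of_normal_subgroups X G M"
    and N: "sheaf_of_normal_subgroups X G N"
    and N_sub_M: "\<And>U. openin X U \<Longrightarrow> N U \<subseteq> M U"

lemma sec_sub_presheaf [simp]:
  "sec (sub_presheaf G S) U = (sec G U)\<lparr>carrier := S U\<rparr>"
  "res (sub_presheaf G S) = res G"
  by (simp_all add: sub_presheaf_def)

lemma set_mult_carrier_update [simp]: "set_mult (K\<lparr>carrier := S\<rparr>) = set_mult K"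
  by (intro ext) (simp add: set_mult_def)

lemma sheaf_of_normal_subgroupsD:
  assumes "sheaf_of_normal_subgroups X G S"
  shows "\<And>U. openin X U \<Longrightarrow> S U \<lhd> sec G U"
    and "\<And>U. openin X U \<Longrightarrow> S U \<subseteq> carrier (sec G U)"
    and "\<And>U V s. \<lbrakk>openin X U; openin X V; V \<subseteq> U; s \<in> S U\<rbrakk> \<Longrightarrow> res G U V s \<in> S V"
    and "sheaf_of_groups X (sub_presheaf G S)"
    and "presheaf_of_groups X (sub_presheaf G S)"
proof -
  show n: "S U \<lhd> sec G U" if "openin X U" for U
    using assms that by (simp add: sheaf_of_normal_subgroups_def)
  show "S U \<subseteq> carrier (sec G U)" if "openin X U" for U
    using n[OF that] by (simp add: normal_def subgroup.subset)
  show s: "sheaf_of_groups X (sub_presheaf G S)"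
    using assms by (simp add: sheaf_of_normal_subgroups_def)
  then show p: "presheaf_of_groups X (sub_presheaf G S)" by (rule sheaf_of_groups.axioms)
  show "res G U V s \<in> S V" if "openin X U" "openin X V" "V \<subseteq> U" "s \<in> S U" for U V s
    using presheaf_of_groups.res_closed[OF p that(1-3)] that(4) by simp
qed

context sheaf_quotient
begin

lemmas M_subsheaf = sheaf_of_normal_subgroupsD[OF M]
lemmas N_subsheaf = sheaf_of_normal_subgroupsD[OF N]

lemma M_carrier [simp]: "\<lbrakk>openin X U; s \<in> M U\<rbrakk> \<Longrightarrow> s \<in> carrier (sec G U)"
  using M_subsheaf(2) by blast

lemma N_carrier [simp]: "\<lbrakk>openin X U; s \<in> N U\<rbrakk> \<Longrightarrow> s \<in> carrier (sec G U)"
  using N_subsheaf(2) by blast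

lemma N_M [simp]: "\<lbrakk>openin X U; s \<in> N U\<rbrakk> \<Longrightarrow> s \<in> M U"
  using N_sub_M by blast

lemma M_mult [simp]: "\<lbrakk>openin X U; s \<in> M U; t \<in> M U\<rbrakk> \<Longrightarrow> s \<otimes>\<^bsub>sec G U\<^esub> t \<in> M U"
  using M_subsheaf(1) by (meson normal_def subgroup.m_closed)

lemma N_one [simp]: "openin X U \<Longrightarrow> \<one>\<^bsub>sec G U\<^esub> \<in> N U"
  using N_subsheaf(1) by (meson normal_def subgroup.one_closed)

lemma M_subgroup: "openin X U \<Longrightarrow> subgroup (M U) (sec G U)"
  using M_subsheaf(1) by (simp add: normal_def)

lemma N_subgroup: "openin X U \<Longrightarrow> subgroup (N U) (sec G U)"
  using N_subsheaf(1) by (simp add: normal_def)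

text \<open>As \<open>N\<close> is a sheaf, the local restrictions glue to a section of \<open>N\<close>, which must be \<open>s\<close>
  because sections of \<open>G\<close> are determined locally.\<close>

lemma mem_N_local:
  assumes U: "openin X U" and s: "s \<in> carrier (sec G U)"
    and loc: "\<And>x. x \<in> U \<Longrightarrow> \<exists>V. openin X V \<and> x \<in> V \<and> V \<subseteq> U \<and> res G U V s \<in> N V"
  shows "s \<in> N U"
proof -
  define \<U> where "\<U> = {V. openin X V \<and> V \<subseteq> U \<and> res G U V s \<in> N V}"
  have un: "\<Union>\<U> = U" unfolding \<U>_def using loc by blast
  have op: "openin X V" if "V \<in> \<U>" for V using that by (simp add: \<U>_def)
  have "\<exists>n \<in> carrier (sec (sub_presheaf G N) (\<Union>\<U>)). \<forall>V \<in> \<U>. res (sub_presheaf G N) (\<Union>\<U>) V n = res G U V s"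
  proof (rule sheaf_of_groups.gluing[OF N_subsheaf(4) op])
    fix V W assume "V \<in> \<U>" "W \<in> \<U>"
    then show "res (sub_presheaf G N) V (V \<inter> W) (res G U V s) = res (sub_presheaf G N) W (V \<inter> W) (res G U W s)"
      using U s by (simp add: \<U>_def G.res_comp)
  qed (auto simp: \<U>_def)
  then obtain n where n: "n \<in> N U" "\<And>V. V \<in> \<U> \<Longrightarrow> res G U V n = res G U V s"
    unfolding un by auto
  have "n = s"
    by (rule G.locality[of \<U>]) (use un op n s U in auto)
  with n show ?thesis by simp
qed

abbreviation Q where "Q \<equiv> quot_presheaf G M N"

lemma carrier_Q: "carrier (sec Q U) = (\<lambda>s. N U #>\<^bsub>sec G U\<^esub> s) ` M U"
  by (simp add: quot_presheaf_def carrier_FactGroup)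

lemma normal_N_M: "openin X U \<Longrightarrow> N U \<lhd> (sec G U)\<lparr>carrier := M U\<rparr>"
  by (rule group.normal_restrict_supergroup[OF G.group_sec M_subgroup N_subsheaf(1) N_sub_M])

lemma group_Q: "openin X U \<Longrightarrow> group (sec Q U)"
  using normal.factorgroup_is_group[OF normal_N_M] by (simp add: quot_presheaf_def)

lemma mult_Q:
  assumes "openin X U" "s \<in> M U" "t \<in> M U"
  shows "(N U #>\<^bsub>sec G U\<^esub> s) \<otimes>\<^bsub>sec Q U\<^esub> (N U #>\<^bsub>sec G U\<^esub> t) = N U #>\<^bsub>sec G U\<^esub> (s \<otimes>\<^bsub>sec G U\<^esub> t)"
  using normal.rcos_sum[OF N_subsheaf(1)] assms by (simp add: quot_presheaf_def)

lemma one_Q: "\<one>\<^bsub>sec Q U\<^esub> = N U"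
  by (simp add: quot_presheaf_def)

lemma coset_one: "openin X U \<Longrightarrow> s \<in> carrier (sec G U) \<Longrightarrow> N U #>\<^bsub>sec G U\<^esub> s = N U \<longleftrightarrow> s \<in> N U"
  using group.coset_join1[OF G.group_sec _ _ N_subgroup] group.coset_join2[OF G.group_sec _ N_subgroup]
  by blast

text \<open>Restricting a coset, or mapping it to a larger quotient, means taking its image \<open>B s\<close> and
  multiplying by the target subgroup \<open>L\<close>. This gives the coset of \<open>s\<close> since \<open>L B = L\<close>.\<close>

lemma enlarge_coset:
  assumes "group K" "subgroup L K" "s \<in> carrier K" "B \<subseteq> L" "\<one>\<^bsub>K\<^esub> \<in> B"
  shows "L <#>\<^bsub>K\<^esub> (\<lambda>b. b \<otimes>\<^bsub>K\<^esub> s) ` B = L #>\<^bsub>K\<^esub> s"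
proof -
  interpret K: group K by fact
  interpret L: subgroup L K by fact
  show ?thesis
  proof (intro equalityI subsetI)
    fix x assume "x \<in> L <#>\<^bsub>K\<^esub> (\<lambda>b. b \<otimes>\<^bsub>K\<^esub> s) ` B"
    then obtain l b where lb: "l \<in> L" "b \<in> B" "x = l \<otimes>\<^bsub>K\<^esub> (b \<otimes>\<^bsub>K\<^esub> s)"
      unfolding set_mult_def by auto
    then have "x = (l \<otimes>\<^bsub>K\<^esub> b) \<otimes>\<^bsub>K\<^esub> s" "l \<otimes>\<^bsub>K\<^esub> b \<in> L"
      using assms(3,4) by (simp_all add: K.m_assoc subset_eq)
    then show "x \<in> L #>\<^bsub>K\<^esub> s" unfolding r_coset_def by blast
  next
    fix x assume "x \<in> L #>\<^bsub>K\<^esub> s"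
    then obtain l where "l \<in> L" "x = l \<otimes>\<^bsub>K\<^esub> (\<one>\<^bsub>K\<^esub> \<otimes>\<^bsub>K\<^esub> s)"
      unfolding r_coset_def using assms(3) by auto
    then show "x \<in> L <#>\<^bsub>K\<^esub> (\<lambda>b. b \<otimes>\<^bsub>K\<^esub> s) ` B"
      unfolding set_mult_def using assms(5) by blast
  qed
qed

lemma r_coset_image: "B #>\<^bsub>K\<^esub> s = (\<lambda>b. b \<otimes>\<^bsub>K\<^esub> s) ` B"
  by (auto simp: r_coset_def)

lemma res_Q:
  assumes "openin X U" "openin X V" "V \<subseteq> U" "s \<in> M U"
  shows "res Q U V (N U #>\<^bsub>sec G U\<^esub> s) = N V #>\<^bsub>sec G V\<^esub> res G U V s"
proof -
  have "res G U V ` (N U #>\<^bsub>sec G U\<^esub> s) = (\<lambda>b. b \<otimes>\<^bsub>sec G V\<^esub> res G U V s) ` (res G U V ` N U)"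
    unfolding r_coset_image image_image
    by (rule image_cong[OF refl]) (use assms in \<open>simp add: G.res_mult\<close>)
  moreover have "\<one>\<^bsub>sec G V\<^esub> \<in> res G U V ` N U"
    using assms by (intro image_eqI[of _ _ "\<one>\<^bsub>sec G U\<^esub>"]) auto
  moreover have "res G U V ` N U \<subseteq> N V"
    using N_subsheaf(3) assms by blast
  ultimately show ?thesis
    using enlarge_coset[OF G.group_sec N_subgroup, of V "res G U V s" "res G U V ` N U"] assms
    by (simp add: quot_presheaf_def)
qed

lemma presheaf_Q: "presheaf_of_groups X Q"
proof (rule presheaf_of_groups.intro)
  fix U V assume U: "openin X U" "openin X V" "V \<subseteq> U"
  show "res Q U V \<in> hom (sec Q U) (sec Q V)"
    by (rule homI) (use U M_subsheaf(3) in \<open>auto simp: carrier_Q res_Q mult_Q G.res_mult\<close>)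
qed (auto simp: group_Q carrier_Q res_Q G.res_id M_subsheaf(3) G.res_comp)

lemma coset_hom: "presheaf_hom X (sub_presheaf G M) Q (\<lambda>U s. N U #>\<^bsub>sec G U\<^esub> s)"
  unfolding presheaf_hom_def hom_def by (auto simp: carrier_Q mult_Q res_Q)

lemma quot_proj_unit: "quot_proj X G M N U s = sheafify_unit X Q U (N U #>\<^bsub>sec G U\<^esub> s)"
  by (simp add: quot_proj_def sheafify_unit_def)

lemma presheaf_quot: "presheaf_of_groups X (quot_sheaf X G M N)"
  unfolding quot_sheaf_def by (rule presheaf_of_groups.presheaf_of_groups_sheafify[OF presheaf_Q])

lemma sheaf_quot: "sheaf_of_groups X (quot_sheaf X G M N)"
  unfolding quot_sheaf_def by (rule presheaf_of_groups.sheaf_of_groups_sheafify[OF presheaf_Q])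

lemma quot_proj_hom: "presheaf_hom X (sub_presheaf G M) (quot_sheaf X G M N) (quot_proj X G M N)"
  using presheaf_hom_comp[OF coset_hom presheaf_of_groups.sheafify_unit_hom[OF presheaf_Q]]
  by (simp add: quot_sheaf_def quot_proj_unit[abs_def])

lemma quot_proj_locally_surj:
  assumes "\<sigma> \<in> carrier (sec (quot_sheaf X G M N) U)" "x \<in> U"
  obtains V s where "openin X V" "x \<in> V" "V \<subseteq> U" "s \<in> M V"
    "res (quot_sheaf X G M N) U V \<sigma> = quot_proj X G M N V s"
proof -
  from assms obtain V c where "openin X V" "x \<in> V" "V \<subseteq> U" "c \<in> carrier (sec Q V)"
    "res (quot_sheaf X G M N) U V \<sigma> = sheafify_unit X Q V c"
    unfolding quot_sheaf_def by (rule presheaf_of_groups.sheafify_unit_locally_surj[OF presheaf_Q])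
  then show ?thesis using that by (auto simp: carrier_Q quot_proj_unit)
qed

text \<open>A section of \<open>M\<close> with trivial image has locally trivial cosets, hence lies locally in \<open>N\<close>;
  now \<open>N\<close> is a sheaf.\<close>

lemma quot_proj_eq_one_iff:
  assumes U: "openin X U" and s: "s \<in> M U"
  shows "quot_proj X G M N U s = \<one>\<^bsub>sec (quot_sheaf X G M N) U\<^esub> \<longleftrightarrow> s \<in> N U"
proof -
  note unit = presheaf_of_groups.sheafify_unit_hom[OF presheaf_Q]
  have one: "sheafify_unit X Q U (N U) = \<one>\<^bsub>sec (quot_sheaf X G M N) U\<^esub>"
    using presheaf_hom_one[OF unit presheaf_Q presheaf_quot[unfolded quot_sheaf_def] U]
    by (simp add: one_Q quot_sheaf_def)
  show ?thesis
  proof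
    assume "s \<in> N U"
    then have "N U #>\<^bsub>sec G U\<^esub> s = N U" using coset_one[OF U] U by simp
    then show "quot_proj X G M N U s = \<one>\<^bsub>sec (quot_sheaf X G M N) U\<^esub>"
      by (simp add: quot_proj_unit one)
  next
    assume "quot_proj X G M N U s = \<one>\<^bsub>sec (quot_sheaf X G M N) U\<^esub>"
    then have eq: "sheafify_unit X Q U (N U #>\<^bsub>sec G U\<^esub> s) = sheafify_unit X Q U (N U #>\<^bsub>sec G U\<^esub> \<one>\<^bsub>sec G U\<^esub>)"
      using coset_one[OF U, of "\<one>\<^bsub>sec G U\<^esub>"] U by (simp add: quot_proj_unit one)
    show "s \<in> N U"
    proof (rule mem_N_local[OF U])
      fix x assume "x \<in> U"
      then obtain V where V: "openin X V" "x \<in> V" "V \<subseteq> U"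
        "res Q U V (N U #>\<^bsub>sec G U\<^esub> s) = res Q U V (N U #>\<^bsub>sec G U\<^esub> \<one>\<^bsub>sec G U\<^esub>)"
        using presheaf_of_groups.sheafify_unit_eqD[OF presheaf_Q U _ _ eq] U s
        by (auto simp: carrier_Q)
      then have "N V #>\<^bsub>sec G V\<^esub> res G U V s = N V"
        using U s coset_one[of V "\<one>\<^bsub>sec G V\<^esub>"] by (simp add: res_Q)
      then have "res G U V s \<in> N V" using coset_one V U s by simp
      with V show "\<exists>V. openin X V \<and> x \<in> V \<and> V \<subseteq> U \<and> res G U V s \<in> N V" by blast
    qed (use U s in simp)
  qed
qed

end

locale sheaf_quotient_map = sheaf_quotient X G M N + T: sheaf_quotient X G M' N'
  for X :: "'x topology" and G :: "('x, 'g) presheaf" and M N M' N' +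
  assumes M_sub: "\<And>U. openin X U \<Longrightarrow> M U \<subseteq> M' U"
    and N_sub: "\<And>U. openin X U \<Longrightarrow> N U \<subseteq> N' U"
begin

lemma enlarge:
  assumes "openin X U" "s \<in> M U"
  shows "N' U <#>\<^bsub>sec G U\<^esub> (N U #>\<^bsub>sec G U\<^esub> s) = N' U #>\<^bsub>sec G U\<^esub> s"
proof -
  have "N U #>\<^bsub>sec G U\<^esub> s = (\<lambda>b. b \<otimes>\<^bsub>sec G U\<^esub> s) ` N U" by (rule r_coset_image)
  then show ?thesis
    using enlarge_coset[OF G.group_sec T.N_subgroup, of U s "N U"] assms N_sub by simp
qed

lemma enlarge_hom: "presheaf_hom X Q T.Q (\<lambda>U C. N' U <#>\<^bsub>sec G U\<^esub> C)"
proof -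
  have "s \<in> M' U" if "openin X U" "s \<in> M U" for U s using that M_sub by blast
  then show ?thesis
    unfolding presheaf_hom_def hom_def
    by (auto simp: carrier_Q T.carrier_Q mult_Q T.mult_Q res_Q T.res_Q enlarge M_subsheaf(3))
qed

lemma quot_map_hom:
  "presheaf_hom X (quot_sheaf X G M N) (quot_sheaf X G M' N') (quot_map X G M' N')"
  unfolding quot_sheaf_def quot_map_def
  by (rule sheafify_map_hom[OF presheaf_Q T.presheaf_Q enlarge_hom])

lemma quot_map_proj:
  assumes "openin X U" "s \<in> M U"
  shows "quot_map X G M' N' U (quot_proj X G M N U s) = quot_proj X G M' N' U s"
  unfolding quot_map_def quot_proj_unit T.quot_proj_unit
  by (subst sheafify_map_unit[OF presheaf_Q T.presheaf_Q enlarge_hom])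
    (use assms in \<open>auto simp: carrier_Q enlarge\<close>)

end

text \<open>For \<open>N \<subseteq> K \<subseteq> M\<close>, the sequence \<open>K/N \<rightarrow> M/N \<rightarrow> M/K\<close> is short exact.\<close>

locale sheaf_quotient_sequence =
  inc: sheaf_quotient_map X G K N M N + prj: sheaf_quotient_map X G M N M K
  for X :: "'x topology" and G :: "('x, 'g) presheaf" and M K N
begin

abbreviation "KN \<equiv> quot_sheaf X G K N"
abbreviation "MN \<equiv> quot_sheaf X G M N"
abbreviation "MK \<equiv> quot_sheaf X G M K"

lemma K_M [simp]: "\<lbrakk>openin X U; s \<in> K U\<rbrakk> \<Longrightarrow> s \<in> M U"
  using inc.M_sub by blast

text \<open>Locally \<open>\<sigma>\<close> is represented by a section of \<open>K\<close>, which lies in \<open>N\<close> as its class in \<open>M/N\<close> is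
  trivial.\<close>

lemma inc_inj:
  assumes U: "openin X U" and \<sigma>: "\<sigma> \<in> carrier (sec KN U)"
    and one: "quot_map X G M N U \<sigma> = \<one>\<^bsub>sec MN U\<^esub>"
  shows "\<sigma> = \<one>\<^bsub>sec KN U\<^esub>"
proof -
  interpret KN: sheaf_of_groups X KN by (rule inc.sheaf_quot)
  interpret MN: sheaf_of_groups X MN by (rule inc.T.sheaf_quot)
  define \<U> where "\<U> = {V. openin X V \<and> V \<subseteq> U \<and> res KN U V \<sigma> = \<one>\<^bsub>sec KN V\<^esub>}"
  have "\<exists>V\<in>\<U>. x \<in> V" if x: "x \<in> U" for x
  proof -
    obtain V s where V: "openin X V" "x \<in> V" "V \<subseteq> U" "s \<in> K V" "res KN U V \<sigma> = quot_proj X G K N V s"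
      using inc.quot_proj_locally_surj[OF \<sigma> x] .
    have "quot_proj X G M N V s = res MN U V (quot_map X G M N U \<sigma>)"
      using inc.quot_map_proj[OF V(1,4)] V U \<sigma>
        presheaf_homD(3)[OF inc.quot_map_hom, of U V \<sigma>] by simp
    also have "\<dots> = \<one>\<^bsub>sec MN V\<^esub>" unfolding one using MN.res_one[OF U V(1,3)] .
    finally have "s \<in> N V" using inc.T.quot_proj_eq_one_iff[OF V(1), of s] V by simp
    then have "res KN U V \<sigma> = \<one>\<^bsub>sec KN V\<^esub>"
      using inc.quot_proj_eq_one_iff[OF V(1), of s] V by simp
    then have "V \<in> \<U>" using V(1,3) unfolding \<U>_def by blast
    then show ?thesis using V(2) by blast
  qed
  moreover have "V \<subseteq> U" if "V \<in> \<U>" for V using that by (simp add: \<U>_def)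
  ultimately have un: "\<Union>\<U> = U" by blast
  show ?thesis
    by (rule KN.locality[of \<U>, unfolded un]) (use \<sigma> U in \<open>auto simp: \<U>_def\<close>)
qed

lemma inc_inj_eq:
  assumes U: "openin X U" and "\<sigma> \<in> carrier (sec KN U)" "\<tau> \<in> carrier (sec KN U)"
    and eq: "quot_map X G M N U \<sigma> = quot_map X G M N U \<tau>"
  shows "\<sigma> = \<tau>"
proof -
  interpret KN: sheaf_of_groups X KN by (rule inc.sheaf_quot)
  interpret MN: sheaf_of_groups X MN by (rule inc.T.sheaf_quot)
  interpret h: group_hom "sec KN U" "sec MN U" "quot_map X G M N U"
    by (rule presheaf_hom_group_hom[OF inc.quot_map_hom inc.presheaf_quot inc.T.presheaf_quot U])
  have "\<sigma> \<otimes>\<^bsub>sec KN U\<^esub> inv\<^bsub>sec KN U\<^esub> \<tau> = \<one>\<^bsub>sec KN U\<^esub>"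
    by (rule inc_inj[OF U]) (use assms in \<open>simp_all del: mult_sheafify\<close>)
  then show ?thesis using assms h.G.inv_equality h.G.inv_inv by (metis h.G.inv_closed)
qed

text \<open>Locally \<open>\<tau>\<close> is represented by a section of \<open>M\<close>, which lies in \<open>K\<close> as its class in \<open>M/K\<close> is
  trivial, and so defines a local preimage. By injectivity the local preimages agree on
  overlaps and glue.\<close>

lemma exact:
  assumes U: "openin X U" and \<tau>: "\<tau> \<in> carrier (sec MN U)"
    and one: "quot_map X G M K U \<tau> = \<one>\<^bsub>sec MK U\<^esub>"
  shows "\<exists>\<sigma>\<in>carrier (sec KN U). quot_map X G M N U \<sigma> = \<tau>"
proof -
  interpret KN: sheaf_of_groups X KN by (rule inc.sheaf_quot)
  interpret MN: sheaf_of_groups X MN by (rule inc.T.sheaf_quot)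
  interpret MK: sheaf_of_groups X MK by (rule prj.T.sheaf_quot)
  note i = presheaf_homD[OF inc.quot_map_hom]
  define \<U> where "\<U> = {V. openin X V \<and> V \<subseteq> U \<and>
      (\<exists>\<sigma>\<in>carrier (sec KN V). quot_map X G M N V \<sigma> = res MN U V \<tau>)}"
  have "\<exists>V\<in>\<U>. x \<in> V" if x: "x \<in> U" for x
  proof -
    obtain V s where V: "openin X V" "x \<in> V" "V \<subseteq> U" "s \<in> M V" "res MN U V \<tau> = quot_proj X G M N V s"
      using inc.T.quot_proj_locally_surj[OF \<tau> x] .
    have "quot_proj X G M K V s = res MK U V (quot_map X G M K U \<tau>)"
      using prj.quot_map_proj[OF V(1,4)] V U \<tau>
        presheaf_homD(3)[OF prj.quot_map_hom, of U V \<tau>] by simp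
    also have "\<dots> = \<one>\<^bsub>sec MK V\<^esub>" unfolding one using MK.res_one[OF U V(1,3)] .
    finally have s: "s \<in> K V" using prj.T.quot_proj_eq_one_iff[OF V(1), of s] V by simp
    have "quot_map X G M N V (quot_proj X G K N V s) = res MN U V \<tau>"
      using inc.quot_map_proj[OF V(1) s] V by simp
    moreover have "quot_proj X G K N V s \<in> carrier (sec KN V)"
      using presheaf_homD(1)[OF inc.quot_proj_hom V(1), of s] s by simp
    ultimately have "V \<in> \<U>" using V(1,3) unfolding \<U>_def by blast
    then show ?thesis using V(2) by blast
  qed
  moreover have "V \<subseteq> U" if "V \<in> \<U>" for V using that by (simp add: \<U>_def)
  ultimately have un: "\<Union>\<U> = U" by blast
  have "\<exists>f. \<forall>V\<in>\<U>. f V \<in> carrier (sec KN V) \<and> quot_map X G M N V (f V) = res MN U V \<tau>"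
  proof (rule bchoice, rule ballI)
    fix V assume "V \<in> \<U>"
    then have "\<exists>\<sigma>\<in>carrier (sec KN V). quot_map X G M N V \<sigma> = res MN U V \<tau>"
      unfolding \<U>_def by simp
    then show "\<exists>\<sigma>. \<sigma> \<in> carrier (sec KN V) \<and> quot_map X G M N V \<sigma> = res MN U V \<tau>"
      by (rule bexE) (intro exI conjI)
  qed
  then obtain f where f: "\<And>V. V \<in> \<U> \<Longrightarrow> f V \<in> carrier (sec KN V)"
    "\<And>V. V \<in> \<U> \<Longrightarrow> quot_map X G M N V (f V) = res MN U V \<tau>" by blast
  have op: "openin X V" "V \<subseteq> U" if "V \<in> \<U>" for V using that by (auto simp: \<U>_def)
  have "\<exists>\<sigma>\<in>carrier (sec KN (\<Union>\<U>)). \<forall>V\<in>\<U>. res KN (\<Union>\<U>) V \<sigma> = f V"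
  proof (rule KN.gluing)
    fix V W assume VW: "V \<in> \<U>" "W \<in> \<U>"
    note o = op[OF VW(1)] op[OF VW(2)]
    have "quot_map X G M N (V \<inter> W) (res KN V (V \<inter> W) (f V)) = res MN V (V \<inter> W) (res MN U V \<tau>)"
      using i(3)[of V "V \<inter> W" "f V"] f VW o by simp
    also have "\<dots> = res MN U (V \<inter> W) \<tau>" by (rule MN.res_comp) (use o U \<tau> in auto)
    also have "\<dots> = res MN W (V \<inter> W) (res MN U W \<tau>)" by (rule MN.res_comp[symmetric]) (use o U \<tau> in auto)
    also have "\<dots> = quot_map X G M N (V \<inter> W) (res KN W (V \<inter> W) (f W))"
      using i(3)[of W "V \<inter> W" "f W"] f VW o by simp
    finally have eq: "quot_map X G M N (V \<inter> W) (res KN V (V \<inter> W) (f V)) =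
        quot_map X G M N (V \<inter> W) (res KN W (V \<inter> W) (f W))" .
    have o': "openin X (V \<inter> W)" "V \<inter> W \<subseteq> V" "V \<inter> W \<subseteq> W" using o by auto
    show "res KN V (V \<inter> W) (f V) = res KN W (V \<inter> W) (f W)"
      by (rule inc_inj_eq[OF o'(1) _ _ eq])
        (rule KN.res_closed[OF o(1) o'(1,2) f(1)[OF VW(1)]], rule KN.res_closed[OF o(3) o'(1,3) f(1)[OF VW(2)]])
  qed (use op f in auto)
  then obtain \<sigma> where \<sigma>: "\<sigma> \<in> carrier (sec KN U)" "\<And>V. V \<in> \<U> \<Longrightarrow> res KN U V \<sigma> = f V"
    unfolding un by blast
  have "quot_map X G M N U \<sigma> = \<tau>"
  proof (rule MN.locality[of \<U>, unfolded un])
    fix V assume V: "V \<in> \<U>"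
    show "res MN U V (quot_map X G M N U \<sigma>) = res MN U V \<tau>"
      using i(3)[OF U op[OF V] \<sigma>(1)] \<sigma>(2)[OF V] f(2)[OF V] by simp
  qed (use op \<tau> i(1)[OF U \<sigma>(1)] in auto)
  with \<sigma> show ?thesis by blast
qed

lemma prj_locally_surj:
  assumes \<rho>: "\<rho> \<in> carrier (sec MK U)" "x \<in> U"
  obtains V \<tau> where "openin X V" "x \<in> V" "V \<subseteq> U" "\<tau> \<in> carrier (sec MN V)"
    "quot_map X G M K V \<tau> = res MK U V \<rho>"
proof -
  obtain V s where V: "openin X V" "x \<in> V" "V \<subseteq> U" "s \<in> M V" "res MK U V \<rho> = quot_proj X G M K V s"
    using prj.T.quot_proj_locally_surj[OF \<rho>] .
  show ?thesis
    using that[OF V(1-3), of "quot_proj X G M N V s"] prj.quot_map_proj[OF V(1,4)] V(5)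
      presheaf_homD(1)[OF inc.T.quot_proj_hom V(1), of s] V(4) by simp
qed

end

section \<open>Hypercovers and cochains of degree two\<close>

lemma is_hypercoverD:
  assumes "is_hypercover X K"
  shows "open_cover X (fst K)"
    and "\<And>U. U \<in> fst K \<Longrightarrow> openin X U"
    and "\<And>e. e \<in> snd K \<Longrightarrow> src e \<in> fst K"
    and "\<And>e. e \<in> snd K \<Longrightarrow> tgt e \<in> fst K"
    and "\<And>e. e \<in> snd K \<Longrightarrow> openin X (supp e)"
    and "\<And>e. e \<in> snd K \<Longrightarrow> supp e \<subseteq> src e"
    and "\<And>e. e \<in> snd K \<Longrightarrow> supp e \<subseteq> tgt e"
    and "\<And>U V x. \<lbrakk>U \<in> fst K; V \<in> fst K; x \<in> U; x \<in> V\<rbrakk> \<Longrightarrow> \<exists>P. (U, V, P) \<in> snd K \<and> x \<in> P"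
proof -
  have *: "open_cover X (fst K)" "\<forall>e \<in> snd K. src e \<in> fst K \<and> tgt e \<in> fst K \<and> openin X (supp e)"
    and **: "\<forall>U \<in> fst K. \<forall>V \<in> fst K. \<Union>{P. (U, V, P) \<in> snd K} = U \<inter> V"
    using assms by (auto simp: is_hypercover_def)
  have sub: "supp e \<subseteq> src e \<inter> tgt e" if "e \<in> snd K" for e
  proof -
    have "(src e, tgt e, supp e) \<in> snd K" using that by simp
    then have "supp e \<subseteq> \<Union>{P. (src e, tgt e, P) \<in> snd K}" by blast
    then show ?thesis using * ** that by simp
  qed
  show "open_cover X (fst K)" by fact
  show "openin X U" if "U \<in> fst K" for U using *(1) that by (simp add: open_cover_def)
  show "src e \<in> fst K" "tgt e \<in> fst K" "openin X (supp e)" if "e \<in> snd K" for e using * that by auto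
  show "supp e \<subseteq> src e" "supp e \<subseteq> tgt e" if "e \<in> snd K" for e using sub[OF that] by auto
  show "\<exists>P. (U, V, P) \<in> snd K \<and> x \<in> P" if "U \<in> fst K" "V \<in> fst K" "x \<in> U" "x \<in> V" for U V x
  proof -
    have "x \<in> \<Union>{P. (U, V, P) \<in> snd K}" using ** that by simp
    then show ?thesis by blast
  qed
qed

lemma hyper_refinementD:
  assumes "hyper_refinement M K r0 r"
  shows "\<And>U. U \<in> fst M \<Longrightarrow> r0 U \<in> fst K" and "\<And>U. U \<in> fst M \<Longrightarrow> U \<subseteq> r0 U"
    and "\<And>e. e \<in> snd M \<Longrightarrow> r e \<in> snd K"
    and "\<And>e. e \<in> snd M \<Longrightarrow> src (r e) = r0 (src e)" and "\<And>e. e \<in> snd M \<Longrightarrow> tgt (r e) = r0 (tgt e)"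
    and "\<And>e. e \<in> snd M \<Longrightarrow> supp e \<subseteq> supp (r e)"
  using assms by (auto simp: hyper_refinement_def)

lemma hyper_refinement_comp:
  assumes MK: "hyper_refinement M K r0 r" and NM: "hyper_refinement N M s0 s"
  shows "hyper_refinement N K (\<lambda>U. r0 (s0 U)) (\<lambda>e. r (s e))"
  using hyper_refinementD[OF MK] hyper_refinementD[OF NM]
  unfolding hyper_refinement_def by (simp, meson order.trans)

lemma triangle_refine:
  assumes "hyper_refinement M K r0 r" "triangle M e f g"
  shows "triangle K (r e) (r f) (r g)"
  using assms(2) hyper_refinementD[OF assms(1)] unfolding triangle_def by simp

lemma triangleD:
  assumes "triangle K e f g"
  shows "e \<in> snd K" "f \<in> snd K" "g \<in> snd K" "src g = src e" "src f = tgt e" "tgt g = tgt f"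
  using assms by (auto simp: triangle_def)

text \<open>A refinement of the cover underlying a hypercover extends to a refinement of the hypercover:
  take as edges all open sets that fit into an edge of \<open>K\<close>.\<close>

lemma hypercover_pullback:
  assumes K: "is_hypercover X K" and W: "open_cover X \<W>"
    and q: "\<And>W. W \<in> \<W> \<Longrightarrow> q W \<in> fst K \<and> W \<subseteq> q W"
  obtains M r where "is_hypercover X M" "fst M = \<W>" "hyper_refinement M K q r"
proof -
  define E where "E = {e. src e \<in> \<W> \<and> tgt e \<in> \<W> \<and> openin X (supp e) \<and> supp e \<subseteq> src e \<inter> tgt e \<and>
    (\<exists>e'\<in>snd K. src e' = q (src e) \<and> tgt e' = q (tgt e) \<and> supp e \<subseteq> supp e')}"
  have "\<Union>{P. (U, V, P) \<in> E} = U \<inter> V" if UV: "U \<in> \<W>" "V \<in> \<W>" for U V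
  proof (intro equalityI subsetI)
    fix x assume "x \<in> \<Union>{P. (U, V, P) \<in> E}"
    then show "x \<in> U \<inter> V" by (auto simp: E_def)
  next
    fix x assume x: "x \<in> U \<inter> V"
    obtain P where P: "(q U, q V, P) \<in> snd K" "x \<in> P"
      using is_hypercoverD(8)[OF K, of "q U" "q V" x] q UV x by blast
    have "openin X P" using is_hypercoverD(5)[OF K P(1)] by simp
    then have "(U, V, U \<inter> V \<inter> P) \<in> E"
      using UV open_coverD[OF W] by (auto simp: E_def intro!: bexI[OF _ P(1)])
    then show "x \<in> \<Union>{P. (U, V, P) \<in> E}" using x P(2) by blast
  qed
  then have M: "is_hypercover X (\<W>, E)" using W by (auto simp: is_hypercover_def E_def)
  have "\<forall>e\<in>E. \<exists>e'. e' \<in> snd K \<and> src e' = q (src e) \<and> tgt e' = q (tgt e) \<and> supp e \<subseteq> supp e'"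
    by (simp add: E_def Bex_def)
  from bchoice[OF this] obtain r where "\<forall>e\<in>E. r e \<in> snd K \<and> src (r e) = q (src e) \<and>
      tgt (r e) = q (tgt e) \<and> supp e \<subseteq> supp (r e)" ..
  then have "hyper_refinement (\<W>, E) K q r" using q by (simp add: hyper_refinement_def)
  with M show ?thesis using that by simp
qed

definition coboundary2 ::
    "('x, 'g) presheaf \<Rightarrow> ('x edge \<Rightarrow> 'g) \<Rightarrow> 'x edge \<Rightarrow> 'x edge \<Rightarrow> 'x edge \<Rightarrow> 'g" where
  "coboundary2 F l e f g = (let S = supp3 e f g in
     res F (supp e) S (l e) \<otimes>\<^bsub>sec F S\<^esub> res F (supp f) S (l f) \<otimes>\<^bsub>sec F S\<^esub>
     inv\<^bsub>sec F S\<^esub> (res F (supp g) S (l g)))"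

definition pullback2 :: "('x, 'g) presheaf \<Rightarrow> ('x edge \<Rightarrow> 'x edge) \<Rightarrow>
    ('x edge \<Rightarrow> 'x edge \<Rightarrow> 'x edge \<Rightarrow> 'g) \<Rightarrow> 'x edge \<Rightarrow> 'x edge \<Rightarrow> 'x edge \<Rightarrow> 'g" where
  "pullback2 F r a e f g = res F (supp3 (r e) (r f) (r g)) (supp3 e f g) (a (r e) (r f) (r g))"

definition trivial_hypercover :: "'x topology \<Rightarrow> 'x hypercover" where
  "trivial_hypercover X = ({topspace X}, {(topspace X, topspace X, topspace X)})"

lemma is_hypercover_trivial: "is_hypercover X (trivial_hypercover X)"
  by (auto simp: trivial_hypercover_def is_hypercover_def)

lemma hyper_refinement_trivial:
  assumes "is_hypercover X M"
  shows "hyper_refinement M (trivial_hypercover X) (\<lambda>_. topspace X)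
    (\<lambda>_. (topspace X, topspace X, topspace X))"
  using openin_subset[OF is_hypercoverD(2)[OF assms]] openin_subset[OF is_hypercoverD(5)[OF assms]]
  unfolding hyper_refinement_def trivial_hypercover_def by simp

lemma cohom2_iff:
  "((K, a), (L, b)) \<in> cohom2 X A \<longleftrightarrow> (K, a) \<in> Z2 X A \<and> (L, b) \<in> Z2 X A \<and>
     (\<exists>M r0 r s0 s l. is_hypercover X M \<and> hyper_refinement M K r0 r \<and> hyper_refinement M L s0 s \<and>
        (\<forall>e \<in> snd M. l e \<in> carrier (sec A (supp e))) \<and>
        (\<forall>e f g. triangle M e f g \<longrightarrow> pullback2 A r a e f g =
           pullback2 A s b e f g \<otimes>\<^bsub>sec A (supp3 e f g)\<^esub> coboundary2 A l e f g))"
  by (simp add: cohom2_def pullback2_def coboundary2_def Let_def)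

lemma triangle_supp:
  assumes "is_hypercover X K" "triangle K e f g"
  shows "openin X (supp3 e f g)" "openin X (supp e)" "openin X (supp f)" "openin X (supp g)"
    and "supp3 e f g \<subseteq> supp e" "supp3 e f g \<subseteq> supp f" "supp3 e f g \<subseteq> supp g"
  using is_hypercoverD(5)[OF assms(1)] triangleD[OF assms(2)] by auto

lemma supp3_refine:
  assumes "hyper_refinement M K r0 r" "triangle M e f g"
  shows "supp3 e f g \<subseteq> supp3 (r e) (r f) (r g)"
  using hyper_refinementD(6)[OF assms(1)] triangleD[OF assms(2)] by (meson Int_mono)

lemma Z2D:
  assumes "(K, a) \<in> Z2 X A"
  shows "is_hypercover X K"
    and "\<And>e f g. triangle K e f g \<Longrightarrow> a e f g \<in> carrier (sec A (supp3 e f g))"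
  using assms unfolding Z2_def by blast+

context presheaf_of_groups
begin

lemma Z2_one:
  assumes K: "is_hypercover X K"
  shows "(K, \<lambda>e f g. \<one>\<^bsub>sec F (supp3 e f g)\<^esub>) \<in> Z2 X F"
proof -
  have eq: "(let S = supp e01 \<inter> supp e02 \<inter> supp e03 \<inter> supp e12 \<inter> supp e13 \<inter> supp e23 in
         res F (supp3 e12 e23 e13) S \<one>\<^bsub>sec F (supp3 e12 e23 e13)\<^esub> \<otimes>\<^bsub>sec F S\<^esub>
         res F (supp3 e01 e13 e03) S \<one>\<^bsub>sec F (supp3 e01 e13 e03)\<^esub> =
         res F (supp3 e02 e23 e03) S \<one>\<^bsub>sec F (supp3 e02 e23 e03)\<^esub> \<otimes>\<^bsub>sec F S\<^esub>
         res F (supp3 e01 e12 e02) S \<one>\<^bsub>sec F (supp3 e01 e12 e02)\<^esub>)"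
    if "triangle K e01 e12 e02" "triangle K e01 e13 e03" "triangle K e02 e23 e03" "triangle K e12 e23 e13"
    for e01 e02 e03 e12 e13 e23
  proof -
    note o = is_hypercoverD(5)[OF K] triangleD(1-3)[OF that(1)] triangleD(1-3)[OF that(2)] triangleD(2)[OF that(3)]
    define S where "S = supp e01 \<inter> supp e02 \<inter> supp e03 \<inter> supp e12 \<inter> supp e13 \<inter> supp e23"
    have "openin X S" unfolding S_def by (intro openin_Int) (use o in auto)
    moreover have "S \<subseteq> supp3 e12 e23 e13" "S \<subseteq> supp3 e01 e13 e03" "S \<subseteq> supp3 e02 e23 e03" "S \<subseteq> supp3 e01 e12 e02"
      by (auto simp: S_def)
    ultimately show ?thesis
      unfolding S_def[symmetric] Let_def using that[THEN triangle_supp(1)[OF K]] by simp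
  qed
  show ?thesis
    unfolding Z2_def by (intro CollectI case_prodI conjI allI impI K one_sec triangle_supp(1)[OF K] eq) blast+
qed

lemma pullback2_closed:
  assumes "(K, a) \<in> Z2 X F" "hyper_refinement M K r0 r" "is_hypercover X M" "triangle M e f g"
  shows "pullback2 F r a e f g \<in> carrier (sec F (supp3 e f g))"
  unfolding pullback2_def
  by (rule res_closed[OF triangle_supp(1)[OF Z2D(1)[OF assms(1)]] triangle_supp(1)[OF assms(3,4)]
        supp3_refine[OF assms(2,4)] Z2D(2)[OF assms(1)]])
    (rule triangle_refine[OF assms(2,4)])+

lemma pullback2_one:
  assumes "is_hypercover X K" "hyper_refinement M K r0 r" "is_hypercover X M" "triangle M e f g"
  shows "pullback2 F r (\<lambda>e f g. \<one>\<^bsub>sec F (supp3 e f g)\<^esub>) e f g = \<one>\<^bsub>sec F (supp3 e f g)\<^esub>"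
  unfolding pullback2_def
  by (rule res_one[OF triangle_supp(1)[OF assms(1)] triangle_supp(1)[OF assms(3,4)] supp3_refine[OF assms(2,4)]])
    (rule triangle_refine[OF assms(2,4)])

lemma pullback2_comp:
  assumes K: "is_hypercover X K" and M: "is_hypercover X M" and N: "is_hypercover X N"
    and a: "\<And>e f g. triangle K e f g \<Longrightarrow> a e f g \<in> carrier (sec F (supp3 e f g))"
    and MK: "hyper_refinement M K r0 r" and NM: "hyper_refinement N M s0 s" and t: "triangle N e f g"
  shows "pullback2 F s (pullback2 F r a) e f g = pullback2 F (\<lambda>e. r (s e)) a e f g"
proof -
  note tM = triangle_refine[OF NM t] 
  note tK = triangle_refine[OF MK tM]
  show ?thesis
    unfolding pullback2_def
    by (rule res_comp[OF triangle_supp(1)[OF K tK] triangle_supp(1)[OF M tM] triangle_supp(1)[OF N t]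
          supp3_refine[OF NM t] supp3_refine[OF MK tM] a[OF tK]])
qed

lemma coboundary2_closed:
  assumes M: "is_hypercover X M" and l: "\<And>e. e \<in> snd M \<Longrightarrow> l e \<in> carrier (sec F (supp e))"
    and t: "triangle M e f g"
  shows "coboundary2 F l e f g \<in> carrier (sec F (supp3 e f g))"
proof -
  note tr = triangle_supp[OF M t]
  show ?thesis
    unfolding coboundary2_def Let_def
    by (intro mult_sec inv_sec tr(1) res_closed[OF tr(2) tr(1) tr(5)] res_closed[OF tr(3) tr(1) tr(6)]
        res_closed[OF tr(4) tr(1) tr(7)] l triangleD(1-3)[OF t])
qed

lemma coboundary2_pullback:
  assumes M: "is_hypercover X M" and N: "is_hypercover X N" and NM: "hyper_refinement N M s0 s"
    and l: "\<And>e. e \<in> snd M \<Longrightarrow> l e \<in> carrier (sec F (supp e))"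
    and t: "triangle N e f g"
  shows "pullback2 F s (coboundary2 F l) e f g = coboundary2 F (\<lambda>e. res F (supp (s e)) (supp e) (l (s e))) e f g"
proof -
  note tM = triangle_refine[OF NM t]
  note s = triangle_supp[OF M tM] and s' = triangle_supp[OF N t] and sub = supp3_refine[OF NM t]
    and r = hyper_refinementD(6)[OF NM] and d = triangleD(1-3)[OF t] and dM = triangleD(1-3)[OF tM]
  define S where "S = supp3 (s e) (s f) (s g)"
  define S' where "S' = supp3 e f g"
  note defs = S_def[symmetric] S'_def[symmetric]
  note S = s[unfolded defs] s'[unfolded defs] sub[unfolded defs]
  have c: "l (s e) \<in> carrier (sec F (supp (s e)))" "l (s f) \<in> carrier (sec F (supp (s f)))"
    "l (s g) \<in> carrier (sec F (supp (s g)))" using l dM by auto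
  have comp: "res F S S' (res F (supp x) S y) = res F (supp x) S' y" if "x \<in> {s e, s f, s g}" "y \<in> carrier (sec F (supp x))" for x y
    by (rule res_comp) (use that S in auto)
  have comp': "res F (supp x) S' (res F (supp (s x)) (supp x) y) = res F (supp (s x)) S' y"
    if "x \<in> {e, f, g}" "y \<in> carrier (sec F (supp (s x)))" for x y
    by (rule res_comp) (use that S r[OF d(1)] r[OF d(2)] r[OF d(3)] in auto)
  show ?thesis
    unfolding pullback2_def coboundary2_def Let_def defs
    using S c by (simp add: res_mult res_inv comp comp')
qed

end

section \<open>The connecting map of a central extension in degree two\<close>

context group
begin

text \<open>Twisting a cocycle by a cochain \<open>m\<close> gives a cocycle.\<close>

lemma cocycle_twist:
  assumes "{m1, m2, m3, g12, g23, g13} \<subseteq> carrier G" "g12 \<otimes> g23 = g13"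
  shows "(m1 \<otimes> g12 \<otimes> inv m2) \<otimes> (m2 \<otimes> g23 \<otimes> inv m3) = m1 \<otimes> g13 \<otimes> inv m3"
proof -
  have c: "m1 \<in> carrier G" "m2 \<in> carrier G" "m3 \<in> carrier G" "g12 \<in> carrier G" "g23 \<in> carrier G"
    using assms(1) by auto
  have "inv m2 \<otimes> (m2 \<otimes> x) = x" if "x \<in> carrier G" for x
    using that c by (simp add: m_assoc[symmetric])
  then have "(m1 \<otimes> g12 \<otimes> inv m2) \<otimes> (m2 \<otimes> g23 \<otimes> inv m3) = m1 \<otimes> (g12 \<otimes> g23) \<otimes> inv m3"
    using c by (simp add: m_assoc)
  then show ?thesis by (simp add: assms(2))
qed

text \<open>Multiplying a cocycle \<open>d\<close> by a central cochain \<open>a\<close> turns its trivial obstruction into the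
  coboundary of \<open>a\<close>.\<close>

lemma central_twist:
  assumes "{a1, a2, a3, d1, d2, d3} \<subseteq> carrier G" "d1 \<otimes> d2 = d3"
    and "a2 \<otimes> d1 = d1 \<otimes> a2"
  shows "(a1 \<otimes> d1) \<otimes> (a2 \<otimes> d2) \<otimes> inv (a3 \<otimes> d3) = a1 \<otimes> a2 \<otimes> inv a3"
proof -
  have c: "a1 \<in> carrier G" "a2 \<in> carrier G" "a3 \<in> carrier G" "d1 \<in> carrier G" "d2 \<in> carrier G" "d3 \<in> carrier G"
    using assms(1) by auto
  have "(a1 \<otimes> d1) \<otimes> (a2 \<otimes> d2) = a1 \<otimes> (d1 \<otimes> a2) \<otimes> d2" using c by (simp add: m_assoc)
  also have "\<dots> = a1 \<otimes> a2 \<otimes> (d1 \<otimes> d2)" unfolding assms(3)[symmetric] using c by (simp add: m_assoc)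
  finally have "(a1 \<otimes> d1) \<otimes> (a2 \<otimes> d2) \<otimes> inv (a3 \<otimes> d3) = a1 \<otimes> a2 \<otimes> d3 \<otimes> (inv d3 \<otimes> inv a3)"
    using c by (simp add: assms(2) inv_mult_group)
  moreover have "d3 \<otimes> (inv d3 \<otimes> inv a3) = inv a3" using c by (simp add: m_assoc[symmetric])
  ultimately show ?thesis using c by (simp add: m_assoc)
qed

end

lemma (in comm_group) coboundary_difference:
  assumes "{y, l1, l2, l3, t1, t2, t3} \<subseteq> carrier G"
    and "t1 \<otimes> t2 \<otimes> inv t3 = y \<otimes> (l1 \<otimes> l2 \<otimes> inv l3)"
  shows "\<one> = y \<otimes> ((l1 \<otimes> inv t1) \<otimes> (l2 \<otimes> inv t2) \<otimes> inv (l3 \<otimes> inv t3))"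
proof -
  have c: "y \<in> carrier G" "l1 \<in> carrier G" "l2 \<in> carrier G" "l3 \<in> carrier G"
     "t1 \<in> carrier G" "t2 \<in> carrier G" "t3 \<in> carrier G" using assms(1) by auto
  have "y \<otimes> ((l1 \<otimes> inv t1) \<otimes> (l2 \<otimes> inv t2) \<otimes> inv (l3 \<otimes> inv t3)) =
      (y \<otimes> (l1 \<otimes> l2 \<otimes> inv l3)) \<otimes> inv (t1 \<otimes> t2 \<otimes> inv t3)"
    using c by (simp add: inv_mult inv_mult_group m_ac)
  also have "\<dots> = \<one>" unfolding assms(2)[symmetric] using c by simp
  finally show ?thesis by simp
qed

locale central_extension =
  A: presheaf_of_groups X A + B: presheaf_of_groups X B + C: presheaf_of_groups X C
  for X :: "'x topology" and A :: "('x, 'a) presheaf" and B :: "('x, 'b) presheaf"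
    and C :: "('x, 'c) presheaf" +
  fixes i :: "'x set \<Rightarrow> 'a \<Rightarrow> 'b" and p :: "'x set \<Rightarrow> 'b \<Rightarrow> 'c"
  assumes i_hom: "presheaf_hom X A B i" and p_hom: "presheaf_hom X B C p"
    and inj: "\<And>U s t. \<lbrakk>openin X U; s \<in> carrier (sec A U); t \<in> carrier (sec A U); i U s = i U t\<rbrakk> \<Longrightarrow> s = t"
    and exact: "\<And>U b. \<lbrakk>openin X U; b \<in> carrier (sec B U); p U b = \<one>\<^bsub>sec C U\<^esub>\<rbrakk> \<Longrightarrow>
      \<exists>t\<in>carrier (sec A U). i U t = b"
    and locally_surj: "\<And>U c x. \<lbrakk>openin X U; c \<in> carrier (sec C U); x \<in> U\<rbrakk> \<Longrightarrow>
      \<exists>V b. openin X V \<and> x \<in> V \<and> V \<subseteq> U \<and> b \<in> carrier (sec B V) \<and> p V b = res C U V c"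
    and central: "\<And>U t b. \<lbrakk>openin X U; t \<in> carrier (sec A U); b \<in> carrier (sec B U)\<rbrakk> \<Longrightarrow>
      i U t \<otimes>\<^bsub>sec B U\<^esub> b = b \<otimes>\<^bsub>sec B U\<^esub> i U t"
begin

lemmas i = presheaf_homD[OF i_hom]
lemmas p = presheaf_homD[OF p_hom]
lemmas i_inv = presheaf_hom_inv[OF i_hom A.presheaf_of_groups_axioms B.presheaf_of_groups_axioms]
lemmas p_inv = presheaf_hom_inv[OF p_hom B.presheaf_of_groups_axioms C.presheaf_of_groups_axioms]

text \<open>The group \<open>A\<close> embeds into the centre of \<open>B\<close>.\<close>

lemma comm_group_A:
  assumes U: "openin X U"
  shows "comm_group (sec A U)"
proof (rule group.group_comm_groupI[OF A.group_sec[OF U]])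
  fix s t assume st: "s \<in> carrier (sec A U)" "t \<in> carrier (sec A U)"
  have "i U (s \<otimes>\<^bsub>sec A U\<^esub> t) = i U (t \<otimes>\<^bsub>sec A U\<^esub> s)"
    unfolding i(2)[OF U st] i(2)[OF U st(2,1)] by (rule central[OF U st(1) i(1)[OF U st(2)]])
  then show "s \<otimes>\<^bsub>sec A U\<^esub> t = t \<otimes>\<^bsub>sec A U\<^esub> s"
    using st by (intro inj[OF U]) (simp_all add: U)
qed

lemma i_coboundary2:
  assumes M: "is_hypercover X M" and t: "\<And>e. e \<in> snd M \<Longrightarrow> t e \<in> carrier (sec A (supp e))"
    and tr: "triangle M e f g"
  shows "i (supp3 e f g) (coboundary2 A t e f g) = coboundary2 B (\<lambda>e. i (supp e) (t e)) e f g"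
proof -
  note s = triangle_supp[OF M tr] and d = triangleD(1-3)[OF tr]
  note c = t[OF d(1)] t[OF d(2)] t[OF d(3)]
  define S where "S = supp3 e f g"
  show ?thesis
    unfolding coboundary2_def Let_def S_def[symmetric]
    using s[folded S_def] c by (simp add: i i_inv)
qed

text \<open>Let \<open>b\<close> be local lifts of a cocycle \<open>c\<close> on the edges of a hypercover, with obstruction cocycle
  \<open>a\<close>. If \<open>c\<close> is cohomologous to the image of a cocycle \<open>g\<close> of \<open>B\<close>, say by a cochain \<open>l\<close>, then
  locally \<open>l\<close> lifts to a cochain \<open>m\<close> of \<open>B\<close>, and the twist \<open>D\<close> of \<open>g\<close> by \<open>m\<close> is a second lift of \<open>c\<close>,
  without obstruction. By exactness \<open>b\<close> and \<open>D\<close> differ by a cochain \<open>t\<close> of \<open>A\<close>, and since \<open>A\<close> is central the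
  obstruction of \<open>b\<close> is the coboundary of \<open>t\<close>.\<close>

lemma lifted_cocycle_splits:
  assumes K: "is_hypercover X K"
    and cg: "((fst K, c), (\<V>, \<lambda>U V. p (U \<inter> V) (g U V))) \<in> cohom1 X C"
    and g: "(\<V>, g) \<in> Z1 X B"
    and b: "\<And>e. e \<in> snd K \<Longrightarrow> b e \<in> carrier (sec B (supp e))"
      "\<And>e. e \<in> snd K \<Longrightarrow> p (supp e) (b e) = res C (src e \<inter> tgt e) (supp e) (c (src e) (tgt e))"
    and a: "\<And>e f g. triangle K e f g \<Longrightarrow> a e f g \<in> carrier (sec A (supp3 e f g))"
      "\<And>e f g. triangle K e f g \<Longrightarrow> i (supp3 e f g) (a e f g) = coboundary2 B b e f g"
  obtains M r0 r t where "is_hypercover X M" "hyper_refinement M K r0 r"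
    "\<And>e. e \<in> snd M \<Longrightarrow> t e \<in> carrier (sec A (supp e))"
    "\<And>e f g. triangle M e f g \<Longrightarrow> pullback2 A r a e f g = coboundary2 A t e f g"
proof -
  from cg obtain \<W> r s l where *: "(fst K, c) \<in> Z1 X C" "open_cover X \<W>"
    "\<And>W. W \<in> \<W> \<Longrightarrow> openin X W"
    "\<And>W. W \<in> \<W> \<Longrightarrow> r W \<in> fst K" "\<And>W. W \<in> \<W> \<Longrightarrow> W \<subseteq> r W"
    "\<And>W. W \<in> \<W> \<Longrightarrow> s W \<in> \<V>" "\<And>W. W \<in> \<W> \<Longrightarrow> W \<subseteq> s W"
    "\<And>W. W \<in> \<W> \<Longrightarrow> l W \<in> carrier (sec C W)"
    "\<And>W W' O'. \<lbrakk>W \<in> \<W>; W' \<in> \<W>; openin X O'; O' \<subseteq> W; O' \<subseteq> W'\<rbrakk> \<Longrightarrow>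
       res C W O' (l W) \<otimes>\<^bsub>sec C O'\<^esub> res C (s W \<inter> s W') O' (p (s W \<inter> s W') (g (s W) (s W'))) =
       res C (r W \<inter> r W') O' (c (r W) (r W')) \<otimes>\<^bsub>sec C O'\<^esub> res C W' O' (l W')"
    by (rule C.cohom1D) blast
  define \<N> where "\<N> = {N. openin X N \<and> (\<exists>W m. W \<in> \<W> \<and> N \<subseteq> W \<and> m \<in> carrier (sec B N) \<and> p N m = res C W N (l W))}"
  have "\<forall>N\<in>\<N>. \<exists>W m. W \<in> \<W> \<and> N \<subseteq> W \<and> m \<in> carrier (sec B N) \<and> p N m = res C W N (l W)"
    unfolding \<N>_def by simp
  then obtain w m where wm: "\<And>N. N \<in> \<N> \<Longrightarrow> w N \<in> \<W>" "\<And>N. N \<in> \<N> \<Longrightarrow> N \<subseteq> w N"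
    "\<And>N. N \<in> \<N> \<Longrightarrow> m N \<in> carrier (sec B N)" "\<And>N. N \<in> \<N> \<Longrightarrow> p N (m N) = res C (w N) N (l (w N))"
    by metis
  have Nop: "openin X N" if "N \<in> \<N>" for N using that by (simp add: \<N>_def)
  have cov: "open_cover X \<N>"
  proof -
    have "\<exists>N\<in>\<N>. x \<in> N" if "x \<in> topspace X" for x
    proof -
      have "x \<in> \<Union>\<W>" using *(2) that by (simp add: open_cover_def)
      then obtain W where W: "W \<in> \<W>" "x \<in> W" ..
      obtain N m where "openin X N" "x \<in> N" "N \<subseteq> W" "m \<in> carrier (sec B N)" "p N m = res C W N (l W)"
        using locally_surj[OF *(3)[OF W(1)] *(8)[OF W(1)] W(2)] by blast
      then have "N \<in> \<N>" unfolding \<N>_def using W(1) by blast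
      then show ?thesis using \<open>x \<in> N\<close> by blast
    qed
    then show ?thesis unfolding open_cover_def using Nop openin_subset by blast
  qed
  have q: "r (w N) \<in> fst K \<and> N \<subseteq> r (w N)" if "N \<in> \<N>" for N
    using *(4,5)[OF wm(1)[OF that]] wm(2)[OF that] by blast
  have sw: "s (w N) \<in> \<V>" "N \<subseteq> s (w N)" "openin X (s (w N))" if "N \<in> \<N>" for N
    using *(6,7)[OF wm(1)[OF that]] wm(2)[OF that] Z1D(2)[OF g] by blast+
  obtain M \<rho> where M: "is_hypercover X M" "fst M = \<N>" and MK: "hyper_refinement M K (\<lambda>N. r (w N)) \<rho>"
    using hypercover_pullback[OF K cov q] by blast
  define D where "D N N' S = res B N S (m N) \<otimes>\<^bsub>sec B S\<^esub>
      res B (s (w N) \<inter> s (w N')) S (g (s (w N)) (s (w N'))) \<otimes>\<^bsub>sec B S\<^esub>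
      inv\<^bsub>sec B S\<^esub> (res B N' S (m N'))" for N N' S
  have parts: "res B N S (m N) \<in> carrier (sec B S)" "res B N' S (m N') \<in> carrier (sec B S)"
      "res B (s (w N) \<inter> s (w N')) S (g (s (w N)) (s (w N'))) \<in> carrier (sec B S)"
      "S \<subseteq> s (w N)" "S \<subseteq> s (w N')" "S \<subseteq> w N" "S \<subseteq> w N'"
    if N: "N \<in> \<N>" "N' \<in> \<N>" and S: "openin X S" "S \<subseteq> N" "S \<subseteq> N'" for N N' S
  proof -
    show sub: "S \<subseteq> s (w N)" "S \<subseteq> s (w N')" using sw(2)[OF N(1)] sw(2)[OF N(2)] S by simp_all
    show "S \<subseteq> w N" "S \<subseteq> w N'" using wm(2)[OF N(1)] wm(2)[OF N(2)] S by simp_all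
    show "res B (s (w N) \<inter> s (w N')) S (g (s (w N)) (s (w N'))) \<in> carrier (sec B S)"
      using sub sw(1,3)[OF N(1)] sw(1,3)[OF N(2)] Z1D(3)[OF g] S by simp
    show "res B N S (m N) \<in> carrier (sec B S)" "res B N' S (m N') \<in> carrier (sec B S)"
      using N S wm(3) Nop by simp_all
  qed
  have Dc: "D N N' S \<in> carrier (sec B S)"
    if "N \<in> \<N>" "N' \<in> \<N>" "openin X S" "S \<subseteq> N" "S \<subseteq> N'" for N N' S
    unfolding D_def using parts[OF that] that by simp
  have Dres: "res B P S (D N N' P) = D N N' S"
    if N: "N \<in> \<N>" "N' \<in> \<N>" and P: "openin X P" "P \<subseteq> N" "P \<subseteq> N'" and S: "openin X S" "S \<subseteq> P" for N N' P S
    unfolding D_def using parts[OF N P] N P S sw(1,3)[OF N(1)] sw(1,3)[OF N(2)] Z1D(3)[OF g] Nop wm(3)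
    by (simp add: B.res_mult B.res_inv B.res_comp)
  have Dmult: "D N1 N2 S \<otimes>\<^bsub>sec B S\<^esub> D N2 N3 S = D N1 N3 S"
    if N: "N1 \<in> \<N>" "N2 \<in> \<N>" "N3 \<in> \<N>" and S: "openin X S" "S \<subseteq> N1" "S \<subseteq> N2" "S \<subseteq> N3" for N1 N2 N3 S
  proof -
    have "S \<subseteq> s (w N1) \<inter> s (w N2) \<inter> s (w N3)"
      using parts(4,5)[OF N(1,2) S(1-3)] parts(5)[OF N(1,3) S(1,2,4)] by simp
    then show ?thesis
      unfolding D_def using parts[OF N(1,2) S(1-3)] parts[OF N(1,3) S(1,2,4)] parts[OF N(2,3) S(1,3,4)]
      by (intro group.cocycle_twist[OF B.group_sec[OF S(1)]] B.Z1_restrict[OF g] sw(1) N S) simp_all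
  qed
  have pD: "p S (D N N' S) = res C (r (w N) \<inter> r (w N')) S (c (r (w N)) (r (w N')))"
    if N: "N \<in> \<N>" "N' \<in> \<N>" and S: "openin X S" "S \<subseteq> N" "S \<subseteq> N'" for N N' S
  proof -
    note pt = parts[OF N S]
    have pm: "p S (res B N1 S (m N1)) = res C (w N1) S (l (w N1))" if N1: "N1 \<in> \<N>" "S \<subseteq> N1" for N1
      using p(3)[OF Nop[OF N1(1)] S(1) N1(2) wm(3)[OF N1(1)]]
        C.res_comp[OF *(3)[OF wm(1)[OF N1(1)]] Nop[OF N1(1)] S(1) N1(2) wm(2)[OF N1(1)] *(8)[OF wm(1)[OF N1(1)]]]
      by (simp add: wm(4)[OF N1(1)])
    have pg: "p S (res B (s (w N) \<inter> s (w N')) S (g (s (w N)) (s (w N')))) =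
        res C (s (w N) \<inter> s (w N')) S (p (s (w N) \<inter> s (w N')) (g (s (w N)) (s (w N'))))"
      by (rule p(3)) (use pt S sw(1,3)[OF N(1)] sw(1,3)[OF N(2)] Z1D(3)[OF g] in simp_all)
    have lc: "res C (w N1) S (l (w N1)) \<in> carrier (sec C S)" if N1: "N1 \<in> \<N>" "S \<subseteq> w N1" for N1
      using *(3,8)[OF wm(1)[OF N1(1)]] N1 S by simp
    have rel: "res C (w N) S (l (w N)) \<otimes>\<^bsub>sec C S\<^esub>
         res C (s (w N) \<inter> s (w N')) S (p (s (w N) \<inter> s (w N')) (g (s (w N)) (s (w N')))) =
       res C (r (w N) \<inter> r (w N')) S (c (r (w N)) (r (w N'))) \<otimes>\<^bsub>sec C S\<^esub> res C (w N') S (l (w N'))"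
      by (rule *(9)) (use wm(1) N S pt in simp_all)
    have cc: "res C (r (w N) \<inter> r (w N')) S (c (r (w N)) (r (w N'))) \<in> carrier (sec C S)"
    proof -
      have "S \<subseteq> r (w N) \<inter> r (w N')" using q[OF N(1)] q[OF N(2)] S by blast
      then show ?thesis
        using q[OF N(1)] q[OF N(2)] Z1D(2,3)[OF *(1)] S(1) by simp
    qed
    have "p S (D N N' S) = res C (w N) S (l (w N)) \<otimes>\<^bsub>sec C S\<^esub>
         res C (s (w N) \<inter> s (w N')) S (p (s (w N) \<inter> s (w N')) (g (s (w N)) (s (w N')))) \<otimes>\<^bsub>sec C S\<^esub>
         inv\<^bsub>sec C S\<^esub> (res C (w N') S (l (w N')))"
      unfolding D_def using pt(1,2,3) S N by (simp add: p p_inv pm pg[symmetric])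
    also have "\<dots> = res C (r (w N) \<inter> r (w N')) S (c (r (w N)) (r (w N')))"
      unfolding rel using cc lc[OF N(2) pt(7)]
      by (simp add: group.inv_solve_right'[OF C.group_sec[OF S(1)]] S(1))
    finally show ?thesis .
  qed
  have "\<exists>t\<in>carrier (sec A (supp e)). i (supp e) t =
      res B (supp (\<rho> e)) (supp e) (b (\<rho> e)) \<otimes>\<^bsub>sec B (supp e)\<^esub> inv\<^bsub>sec B (supp e)\<^esub> (D (src e) (tgt e) (supp e))"
    if e: "e \<in> snd M" for e
  proof (rule exact)
    note h = is_hypercoverD(3-7)[OF M(1) e]
    note N = h(1,2)[unfolded M(2)] and rf = hyper_refinementD(3-6)[OF MK e]
    note hK = is_hypercoverD(3-7)[OF K rf(1)]
    note d = Dc[OF N h(3-5)]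
    show "openin X (supp e)" by (rule h(3))
    have bc: "res B (supp (\<rho> e)) (supp e) (b (\<rho> e)) \<in> carrier (sec B (supp e))"
      by (rule B.res_closed[OF hK(3) h(3) rf(4) b(1)[OF rf(1)]])
    show "res B (supp (\<rho> e)) (supp e) (b (\<rho> e)) \<otimes>\<^bsub>sec B (supp e)\<^esub>
        inv\<^bsub>sec B (supp e)\<^esub> (D (src e) (tgt e) (supp e)) \<in> carrier (sec B (supp e))"
      using bc d h(3) by simp
    have sub: "supp (\<rho> e) \<subseteq> r (w (src e)) \<inter> r (w (tgt e))" using hK(4,5) rf by simp
    have "p (supp e) (res B (supp (\<rho> e)) (supp e) (b (\<rho> e))) =
        res C (supp (\<rho> e)) (supp e) (p (supp (\<rho> e)) (b (\<rho> e)))"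
      by (rule p(3)[OF hK(3) h(3) rf(4) b(1)[OF rf(1)]])
    also have "\<dots> = res C (r (w (src e)) \<inter> r (w (tgt e))) (supp e) (c (r (w (src e))) (r (w (tgt e))))"
      unfolding b(2)[OF rf(1)] rf(2,3)
      by (rule C.res_comp[OF _ hK(3) h(3) rf(4) sub])
        (use q[OF N(1)] q[OF N(2)] Z1D(2,3)[OF *(1)] in simp_all)
    also have "\<dots> = p (supp e) (D (src e) (tgt e) (supp e))"
      by (rule pD[OF N h(3-5), symmetric])
    finally show "p (supp e) (res B (supp (\<rho> e)) (supp e) (b (\<rho> e)) \<otimes>\<^bsub>sec B (supp e)\<^esub>
        inv\<^bsub>sec B (supp e)\<^esub> (D (src e) (tgt e) (supp e))) = \<one>\<^bsub>sec C (supp e)\<^esub>"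
      using bc d h(3) p(1)[OF h(3) d] group.r_inv[OF C.group_sec[OF h(3)] p(1)[OF h(3) d]]
      by (simp add: p(2) p_inv)
  qed
  then have "\<forall>e\<in>snd M. \<exists>t. t \<in> carrier (sec A (supp e)) \<and> i (supp e) t =
      res B (supp (\<rho> e)) (supp e) (b (\<rho> e)) \<otimes>\<^bsub>sec B (supp e)\<^esub> inv\<^bsub>sec B (supp e)\<^esub> (D (src e) (tgt e) (supp e))"
    by (simp add: Bex_def)
  from bchoice[OF this] obtain t where t: "\<And>e. e \<in> snd M \<Longrightarrow> t e \<in> carrier (sec A (supp e))"
    "\<And>e. e \<in> snd M \<Longrightarrow> i (supp e) (t e) =
      res B (supp (\<rho> e)) (supp e) (b (\<rho> e)) \<otimes>\<^bsub>sec B (supp e)\<^esub> inv\<^bsub>sec B (supp e)\<^esub> (D (src e) (tgt e) (supp e))"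
    by blast
  have split: "res B (supp (\<rho> e)) S (b (\<rho> e)) = res B (supp e) S (i (supp e) (t e)) \<otimes>\<^bsub>sec B S\<^esub> D (src e) (tgt e) S"
    if e: "e \<in> snd M" and S: "openin X S" "S \<subseteq> supp e" for e S
  proof -
    note h = is_hypercoverD(3-7)[OF M(1) e]
    note N = h(1,2)[unfolded M(2)] and rf = hyper_refinementD(3-6)[OF MK e]
    note hK = is_hypercoverD(3-7)[OF K rf(1)]
    note d = Dc[OF N h(3-5)]
    have bc: "res B (supp (\<rho> e)) (supp e) (b (\<rho> e)) \<in> carrier (sec B (supp e))"
      by (rule B.res_closed[OF hK(3) h(3) rf(4) b(1)[OF rf(1)]])
    have "res B (supp (\<rho> e)) S (b (\<rho> e)) = res B (supp e) S (res B (supp (\<rho> e)) (supp e) (b (\<rho> e)))"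
      by (rule B.res_comp[symmetric, OF hK(3) h(3) S(1) S(2) rf(4) b(1)[OF rf(1)]])
    also have "res B (supp (\<rho> e)) (supp e) (b (\<rho> e)) =
        i (supp e) (t e) \<otimes>\<^bsub>sec B (supp e)\<^esub> D (src e) (tgt e) (supp e)"
      unfolding t(2)[OF e] using bc d h(3)
      by (simp add: monoid.m_assoc[OF group.is_monoid[OF B.group_sec[OF h(3)]]] group.l_inv[OF B.group_sec[OF h(3)]])
    also have "res B (supp e) S \<dots> = res B (supp e) S (i (supp e) (t e)) \<otimes>\<^bsub>sec B S\<^esub> D (src e) (tgt e) S"
      using Dres[OF N h(3-5) S] B.res_mult[OF h(3) S _ d] i(1)[OF h(3) t(1)[OF e]] by simp
    finally show ?thesis .
  qed
  have "pullback2 A \<rho> a e f k = coboundary2 A t e f k" if tr: "triangle M e f k" for e f k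
  proof (rule inj)
    note trK = triangle_refine[OF MK tr] and d = triangleD[OF tr] and sM = triangle_supp[OF M(1) tr]
    note sK = triangle_supp[OF K trK]
    define S where "S = supp3 e f k"
    define T where "T = supp3 (\<rho> e) (\<rho> f) (\<rho> k)"
    note S = sM[folded S_def] and T = sK[folded T_def]
    have ST: "S \<subseteq> T" unfolding S_def T_def by (rule supp3_refine[OF MK tr])
    note hd = is_hypercoverD(3-7)[OF M(1) d(1)] is_hypercoverD(3-7)[OF M(1) d(2)]
    show "openin X (supp3 e f k)" by (rule sM(1))
    have bK: "b (\<rho> e) \<in> carrier (sec B (supp (\<rho> e)))" "b (\<rho> f) \<in> carrier (sec B (supp (\<rho> f)))"
      "b (\<rho> k) \<in> carrier (sec B (supp (\<rho> k)))"
      using b(1) triangleD(1-3)[OF trK] by auto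
    note tc = t(1)[OF d(1)] t(1)[OF d(2)] t(1)[OF d(3)]
    show c: "pullback2 A \<rho> a e f k \<in> carrier (sec A (supp3 e f k))"
      unfolding pullback2_def S_def[symmetric] T_def[symmetric]
      by (rule A.res_closed[OF T(1) S(1) ST a(1)[OF trK, folded T_def]])
    show "coboundary2 A t e f k \<in> carrier (sec A (supp3 e f k))"
      by (rule A.coboundary2_closed[OF M(1) t(1) tr])
    have it: "res B (supp x) S (i (supp x) (t x)) \<in> carrier (sec B S)" if "x \<in> {e, f, k}" for x
      using that S tc i(1) by auto
    have sub: "S \<subseteq> src e" "S \<subseteq> tgt e" "S \<subseteq> tgt f"
      using S(5,6) hd(4,5,10) by auto
    have N: "src e \<in> \<N>" "tgt e \<in> \<N>" "tgt f \<in> \<N>" using hd(1,2,7) M(2) by auto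
    have "i S (pullback2 A \<rho> a e f k) = res B T S (i T (a (\<rho> e) (\<rho> f) (\<rho> k)))"
      unfolding pullback2_def S_def[symmetric] T_def[symmetric]
      by (rule i(3)[OF T(1) S(1) ST a(1)[OF trK, folded T_def]])
    also have "\<dots> = pullback2 B \<rho> (coboundary2 B b) e f k"
      unfolding pullback2_def S_def[symmetric] T_def[symmetric] a(2)[OF trK, folded T_def] ..
    also have "\<dots> = coboundary2 B (\<lambda>e. res B (supp (\<rho> e)) (supp e) (b (\<rho> e))) e f k"
      by (rule B.coboundary2_pullback[OF K M(1) MK b(1) tr])
    also have "\<dots> = res B (supp (\<rho> e)) S (b (\<rho> e)) \<otimes>\<^bsub>sec B S\<^esub> res B (supp (\<rho> f)) S (b (\<rho> f)) \<otimes>\<^bsub>sec B S\<^esub>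
        inv\<^bsub>sec B S\<^esub> (res B (supp (\<rho> k)) S (b (\<rho> k)))"
      unfolding coboundary2_def Let_def S_def[symmetric]
      using S T bK hyper_refinementD(6)[OF MK d(1)] hyper_refinementD(6)[OF MK d(2)] hyper_refinementD(6)[OF MK d(3)]
      by (simp add: B.res_comp)
    also have "\<dots> = (res B (supp e) S (i (supp e) (t e)) \<otimes>\<^bsub>sec B S\<^esub> D (src e) (tgt e) S) \<otimes>\<^bsub>sec B S\<^esub>
        (res B (supp f) S (i (supp f) (t f)) \<otimes>\<^bsub>sec B S\<^esub> D (tgt e) (tgt f) S) \<otimes>\<^bsub>sec B S\<^esub>
        inv\<^bsub>sec B S\<^esub> (res B (supp k) S (i (supp k) (t k)) \<otimes>\<^bsub>sec B S\<^esub> D (src e) (tgt f) S)"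
      using split[OF d(1) S(1,5)] split[OF d(2) S(1,6)] split[OF d(3) S(1,7)] d(4-6) by simp
    also have "\<dots> = res B (supp e) S (i (supp e) (t e)) \<otimes>\<^bsub>sec B S\<^esub> res B (supp f) S (i (supp f) (t f)) \<otimes>\<^bsub>sec B S\<^esub>
        inv\<^bsub>sec B S\<^esub> (res B (supp k) S (i (supp k) (t k)))"
    proof (rule group.central_twist[OF B.group_sec[OF S(1)] _ Dmult[OF N S(1) sub]])
      show "res B (supp f) S (i (supp f) (t f)) \<otimes>\<^bsub>sec B S\<^esub> D (src e) (tgt e) S =
          D (src e) (tgt e) S \<otimes>\<^bsub>sec B S\<^esub> res B (supp f) S (i (supp f) (t f))"
        unfolding i(3)[OF S(3) S(1) S(6) tc(2), symmetric]
        by (rule central[OF S(1) A.res_closed[OF S(3) S(1) S(6) tc(2)] Dc[OF N(1,2) S(1) sub(1,2)]])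
    qed (use it Dc[OF N(1,2) S(1) sub(1,2)] Dc[OF N(2,3) S(1) sub(2,3)] Dc[OF N(1,3) S(1) sub(1,3)] in simp)
    also have "\<dots> = i S (coboundary2 A t e f k)"
      using i_coboundary2[OF M(1) t(1) tr] unfolding coboundary2_def Let_def S_def[symmetric] by simp
    finally show "i (supp3 e f k) (pullback2 A \<rho> a e f k) = i (supp3 e f k) (coboundary2 A t e f k)"
      by (simp add: S_def)
  qed
  then show ?thesis using that[OF M(1) MK t(1)] by blast
qed

end

context central_extension
begin

lemma connecting1_iff:
  "y \<in> connecting1 X A B C i p \<gamma> \<longleftrightarrow> (\<exists>K c a b. (fst K, c) \<in> \<gamma> \<and> (K, a) \<in> Z2 X A \<and>
     (\<forall>e \<in> snd K. b e \<in> carrier (sec B (supp e)) \<and>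
        p (supp e) (b e) = res C (src e \<inter> tgt e) (supp e) (c (src e) (tgt e))) \<and>
     (\<forall>e f g. triangle K e f g \<longrightarrow> i (supp3 e f g) (a e f g) = coboundary2 B b e f g) \<and>
     ((K, a), y) \<in> cohom2 X A)"
proof -
  have "y \<in> connecting1 X A B C i p \<gamma> \<longleftrightarrow> (\<exists>\<U> c \<E> a b. (\<U>, c) \<in> \<gamma> \<and> ((\<U>, \<E>), a) \<in> Z2 X A \<and>
     (\<forall>e \<in> \<E>. b e \<in> carrier (sec B (supp e)) \<and>
        p (supp e) (b e) = res C (src e \<inter> tgt e) (supp e) (c (src e) (tgt e))) \<and>
     (\<forall>e f g. triangle (\<U>, \<E>) e f g \<longrightarrow> i (supp3 e f g) (a e f g) = coboundary2 B b e f g) \<and>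
     (((\<U>, \<E>), a), y) \<in> cohom2 X A)"
    unfolding connecting1_def coboundary2_def Let_def Union_iff Bex_def mem_Collect_eq Image_singleton_iff
    by (rule iffI; elim exE conjE; hypsubst?; (intro exI conjI)?; (assumption | rule refl | erule Image_singleton_iff[THEN iffD1] | erule Image_singleton_iff[THEN iffD2]))
  then show ?thesis by (simp only: split_paired_Ex fst_conv snd_conv) blast
qed

text \<open>An element \<open>y\<close> of the connecting class is compared with the obstruction cocycle \<open>a\<close> of some
  lifts on a hypercover \<open>M\<close>. Applying the splitting lemma to the restrictions of all data to
  \<open>M\<close> exhibits \<open>y\<close> as a coboundary on a refinement of \<open>M\<close>. Splitting \<open>a\<close> on its own hypercover
  \<open>K\<close> would instead produce two unrelated refinements of \<open>K\<close>, and a homotopy between the two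
  pullbacks of \<open>a\<close> to a common refinement.\<close>

lemma connecting1_of_lift_subset:
  assumes g: "(\<V>, g) \<in> Z1 X B"
    and y: "y \<in> connecting1 X A B C i p (cohom1 X C `` {(\<V>, \<lambda>U V. p (U \<inter> V) (g U V))})"
  shows "y \<in> H2_zero X A"
proof -
  let ?T = "trivial_hypercover X"
  obtain L b' where yL: "y = (L, b')" by (cases y)
  from y obtain K c a b where
    c: "((\<V>, \<lambda>U V. p (U \<inter> V) (g U V)), (fst K, c)) \<in> cohom1 X C" and a: "(K, a) \<in> Z2 X A"
    and b: "\<And>e. e \<in> snd K \<Longrightarrow> b e \<in> carrier (sec B (supp e))"
      "\<And>e. e \<in> snd K \<Longrightarrow> p (supp e) (b e) = res C (src e \<inter> tgt e) (supp e) (c (src e) (tgt e))"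
    and ia: "\<And>e f g. triangle K e f g \<Longrightarrow> i (supp3 e f g) (a e f g) = coboundary2 B b e f g"
    and coh: "((K, a), (L, b')) \<in> cohom2 X A"
    unfolding connecting1_iff yL by blast
  from coh obtain M r0 r s0 s l where L: "(L, b') \<in> Z2 X A" and M: "is_hypercover X M"
    and MK: "hyper_refinement M K r0 r" and refL: "hyper_refinement M L s0 s"
    and l: "\<And>e. e \<in> snd M \<Longrightarrow> l e \<in> carrier (sec A (supp e))"
    and eq: "\<And>e f g. triangle M e f g \<Longrightarrow> pullback2 A r a e f g =
           pullback2 A s b' e f g \<otimes>\<^bsub>sec A (supp3 e f g)\<^esub> coboundary2 A l e f g"
    unfolding cohom2_iff by blast
  note K = Z2D(1)[OF a] and L' = Z2D(1)[OF L]
  have cZ: "(fst K, c) \<in> Z1 X C" using c by (auto simp: cohom1_def)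
  have q: "r0 U \<in> fst K \<and> U \<subseteq> r0 U" if "U \<in> fst M" for U
    using hyper_refinementD(1,2)[OF MK that] by blast
  define c' where "c' = (\<lambda>U V. res C (r0 U \<inter> r0 V) (U \<inter> V) (c (r0 U) (r0 V)))"
  have c': "((fst M, c'), (\<V>, \<lambda>U V. p (U \<inter> V) (g U V))) \<in> cohom1 X C"
    unfolding c'_def
    by (rule C.cohom1_trans[OF C.cohom1_refine[OF cZ is_hypercoverD(1)[OF M] q] C.cohom1_sym[OF c]])
  define b2 where "b2 = (\<lambda>e. res B (supp (r e)) (supp e) (b (r e)))"
  have b2: "b2 e \<in> carrier (sec B (supp e))"
    "p (supp e) (b2 e) = res C (src e \<inter> tgt e) (supp e) (c' (src e) (tgt e))" if e: "e \<in> snd M" for e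
  proof -
    note h = is_hypercoverD(3-7)[OF M e] and rf = hyper_refinementD(3-6)[OF MK e]
    note hK = is_hypercoverD(3-7)[OF K rf(1)]
    show "b2 e \<in> carrier (sec B (supp e))"
      unfolding b2_def by (rule B.res_closed[OF hK(3) h(3) rf(4) b(1)[OF rf(1)]])
    have o: "openin X (r0 (src e) \<inter> r0 (tgt e))" "openin X (src e \<inter> tgt e)"
      "src e \<inter> tgt e \<subseteq> r0 (src e) \<inter> r0 (tgt e)" "supp e \<subseteq> src e \<inter> tgt e"
      "supp (r e) \<subseteq> r0 (src e) \<inter> r0 (tgt e)"
      using h q[OF h(1)] q[OF h(2)] is_hypercoverD(2)[OF M] is_hypercoverD(2)[OF K] hK(4,5) rf(2,3)
      by (simp_all add: le_infI1 le_infI2)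
    have cc: "c (r0 (src e)) (r0 (tgt e)) \<in> carrier (sec C (r0 (src e) \<inter> r0 (tgt e)))"
      using Z1D(3)[OF cZ] q h by simp
    have "p (supp e) (b2 e) = res C (supp (r e)) (supp e) (p (supp (r e)) (b (r e)))"
      unfolding b2_def by (rule p(3)[OF hK(3) h(3) rf(4) b(1)[OF rf(1)]])
    also have "\<dots> = res C (r0 (src e) \<inter> r0 (tgt e)) (supp e) (c (r0 (src e)) (r0 (tgt e)))"
      unfolding b(2)[OF rf(1)] rf(2,3) by (rule C.res_comp[OF o(1) hK(3) h(3) rf(4) o(5) cc])
    also have "\<dots> = res C (src e \<inter> tgt e) (supp e) (c' (src e) (tgt e))"
      unfolding c'_def by (rule C.res_comp[symmetric, OF o(1) o(2) h(3) o(4) o(3) cc])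
    finally show "p (supp e) (b2 e) = res C (src e \<inter> tgt e) (supp e) (c' (src e) (tgt e))" .
  qed
  have ia2: "i (supp3 e f g) (pullback2 A r a e f g) = coboundary2 B b2 e f g" if t: "triangle M e f g" for e f g
  proof -
    note tK = triangle_refine[OF MK t]
    have "i (supp3 e f g) (pullback2 A r a e f g) = pullback2 B r (coboundary2 B b) e f g"
      unfolding pullback2_def ia[OF tK, symmetric]
      by (rule i(3)[OF triangle_supp(1)[OF K tK] triangle_supp(1)[OF M t] supp3_refine[OF MK t] Z2D(2)[OF a tK]])
    also have "\<dots> = coboundary2 B b2 e f g"
      unfolding b2_def by (rule B.coboundary2_pullback[OF K M MK b(1) t])
    finally show ?thesis .
  qed
  obtain N t0 t x where N: "is_hypercover X N" and NM: "hyper_refinement N M t0 t"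
    and x: "\<And>e. e \<in> snd N \<Longrightarrow> x e \<in> carrier (sec A (supp e))"
    and xeq: "\<And>e f g. triangle N e f g \<Longrightarrow> pullback2 A t (pullback2 A r a) e f g = coboundary2 A x e f g"
    by (rule lifted_cocycle_splits[OF M c' g b2 A.pullback2_closed[OF a MK M] ia2]; (assumption | (rule that; assumption)))
  have lt: "res A (supp (t e)) (supp e) (l (t e)) \<in> carrier (sec A (supp e))" if e: "e \<in> snd N" for e
    using is_hypercoverD(5)[OF N e] hyper_refinementD(3,6)[OF NM e]
      is_hypercoverD(5)[OF M] l by simp
  \<comment> \<open>On \<open>N\<close> the cocycle \<open>a\<close> is the coboundary of \<open>x\<close>, and it differs from \<open>b'\<close> by that of \<open>l\<close>.\<close>
  define z where "z e = res A (supp (t e)) (supp e) (l (t e)) \<otimes>\<^bsub>sec A (supp e)\<^esub> inv\<^bsub>sec A (supp e)\<^esub> (x e)" for e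
  have zeq: "\<one>\<^bsub>sec A (supp3 e f g)\<^esub> =
      pullback2 A (\<lambda>e. s (t e)) b' e f g \<otimes>\<^bsub>sec A (supp3 e f g)\<^esub> coboundary2 A z e f g"
    if tr: "triangle N e f g" for e f g
  proof -
    note trM = triangle_refine[OF NM tr] and sN = triangle_supp[OF N tr] and d = triangleD(1-3)[OF tr]
    note sM = triangle_supp[OF M trM]
    define S where "S = supp3 e f g"
    note S = sN[folded S_def]
    define T where "T = supp3 (t e) (t f) (t g)"
    note T = sM[folded T_def]
    have ST: "S \<subseteq> T" unfolding S_def T_def by (rule supp3_refine[OF NM tr])
    have pc: "pullback2 A s b' (t e) (t f) (t g) \<in> carrier (sec A T)"
      unfolding T_def by (rule A.pullback2_closed[OF L refL M trM])
    have lc: "coboundary2 A l (t e) (t f) (t g) \<in> carrier (sec A T)"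
      unfolding T_def by (rule A.coboundary2_closed[OF M l trM])
    have yc: "pullback2 A (\<lambda>e. s (t e)) b' e f g \<in> carrier (sec A S)"
      unfolding S_def by (rule A.pullback2_closed[OF L hyper_refinement_comp[OF refL NM] N tr])
    have "coboundary2 A x e f g = res A T S (pullback2 A s b' (t e) (t f) (t g) \<otimes>\<^bsub>sec A T\<^esub> coboundary2 A l (t e) (t f) (t g))"
      unfolding xeq[OF tr, symmetric] pullback2_def[of A t] eq[OF trM] S_def T_def ..
    also have "\<dots> = pullback2 A t (pullback2 A s b') e f g \<otimes>\<^bsub>sec A S\<^esub> pullback2 A t (coboundary2 A l) e f g"
      unfolding A.res_mult[OF T(1) S(1) ST pc lc] pullback2_def[of A t] S_def[symmetric] T_def[symmetric] ..
    also have "\<dots> = pullback2 A (\<lambda>e. s (t e)) b' e f g \<otimes>\<^bsub>sec A S\<^esub>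
        coboundary2 A (\<lambda>e. res A (supp (t e)) (supp e) (l (t e))) e f g"
      using A.pullback2_comp[OF L' M N Z2D(2)[OF L] refL NM tr] A.coboundary2_pullback[OF M N NM l tr] by simp
    finally have main: "coboundary2 A x e f g = \<dots>" .
    show ?thesis
      unfolding coboundary2_def Let_def S_def[symmetric] z_def
      using comm_group.coboundary_difference[OF comm_group_A[OF S(1)] _ main[unfolded coboundary2_def Let_def S_def[symmetric]]]
        yc S x d lt by (simp add: A.res_mult A.res_inv)
  qed
  have "((?T, \<lambda>e f g. \<one>\<^bsub>sec A (supp3 e f g)\<^esub>), (L, b')) \<in> cohom2 X A"
    unfolding cohom2_iff
  proof (intro conjI exI)
    show "(?T, \<lambda>e f g. \<one>\<^bsub>sec A (supp3 e f g)\<^esub>) \<in> Z2 X A" by (rule A.Z2_one[OF is_hypercover_trivial])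
    show "hyper_refinement N ?T (\<lambda>_. topspace X) (\<lambda>_. (topspace X, topspace X, topspace X))"
      by (rule hyper_refinement_trivial[OF N])
    show "hyper_refinement N L (\<lambda>U. s0 (t0 U)) (\<lambda>e. s (t e))" by (rule hyper_refinement_comp[OF refL NM])
    show "\<forall>e\<in>snd N. z e \<in> carrier (sec A (supp e))"
      using lt x is_hypercoverD(5)[OF N] by (simp add: z_def)
    show "\<forall>e f g. triangle N e f g \<longrightarrow>
        pullback2 A (\<lambda>_. (topspace X, topspace X, topspace X)) (\<lambda>e f g. \<one>\<^bsub>sec A (supp3 e f g)\<^esub>) e f g =
        pullback2 A (\<lambda>e. s (t e)) b' e f g \<otimes>\<^bsub>sec A (supp3 e f g)\<^esub> coboundary2 A z e f g"
    proof (intro allI impI)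
      fix e f g assume tr: "triangle N e f g"
      show "pullback2 A (\<lambda>_. (topspace X, topspace X, topspace X)) (\<lambda>e f g. \<one>\<^bsub>sec A (supp3 e f g)\<^esub>) e f g =
        pullback2 A (\<lambda>e. s (t e)) b' e f g \<otimes>\<^bsub>sec A (supp3 e f g)\<^esub> coboundary2 A z e f g"
        unfolding A.pullback2_one[OF is_hypercover_trivial hyper_refinement_trivial[OF N] N tr] by (rule zeq[OF tr])
    qed
  qed (rule L N)+
  then show ?thesis unfolding H2_zero_def yL trivial_hypercover_def by simp
qed

text \<open>The lifts \<open>g U V\<close> on the full intersections \<open>U \<inter> V\<close> have the constant obstruction cocycle 1,
  so the class of 1 on the corresponding hypercover contributes to the connecting class. As
  the pullbacks of 1 are all equal to 1, whatever is cohomologous to the trivial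
  cocycle is also cohomologous to this one.\<close>

lemma connecting1_of_lift_superset:
  assumes g: "(\<V>, g) \<in> Z1 X B" and y: "y \<in> H2_zero X A"
  shows "y \<in> connecting1 X A B C i p (cohom1 X C `` {(\<V>, \<lambda>U V. p (U \<inter> V) (g U V))})"
proof -
  let ?T = "trivial_hypercover X"
  obtain L b' where yL: "y = (L, b')" by (cases y)
  have "((?T, \<lambda>e f g. \<one>\<^bsub>sec A (supp3 e f g)\<^esub>), (L, b')) \<in> cohom2 X A"
    using y unfolding H2_zero_def yL trivial_hypercover_def by simp
  then obtain M r0 r s0 s l where L: "(L, b') \<in> Z2 X A" and M: "is_hypercover X M"
    and MT: "hyper_refinement M ?T r0 r" and refL: "hyper_refinement M L s0 s"
    and l: "\<And>e. e \<in> snd M \<Longrightarrow> l e \<in> carrier (sec A (supp e))"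
    and eq: "\<And>e f g. triangle M e f g \<Longrightarrow> pullback2 A r (\<lambda>e f g. \<one>\<^bsub>sec A (supp3 e f g)\<^esub>) e f g =
           pullback2 A s b' e f g \<otimes>\<^bsub>sec A (supp3 e f g)\<^esub> coboundary2 A l e f g"
    unfolding cohom2_iff by blast
  note L' = Z2D(1)[OF L] and Z = Z1D[OF g]
  define K where "K = (\<V>, {(U, V, U \<inter> V) | U V. U \<in> \<V> \<and> V \<in> \<V>})"
  have edge: "src e \<in> \<V>" "tgt e \<in> \<V>" "supp e = src e \<inter> tgt e" if "e \<in> snd K" for e
    using that by (auto simp: K_def)
  have K: "is_hypercover X K"
    using Z by (auto simp: K_def is_hypercover_def)
  have pg: "(\<V>, \<lambda>U V. p (U \<inter> V) (g U V)) \<in> Z1 X C"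
    by (rule Z1_map[OF p_hom B.presheaf_of_groups_axioms g])
  define b where "b e = g (src e) (tgt e)" for e :: "'x edge"
  have b: "b e \<in> carrier (sec B (supp e))"
    "p (supp e) (b e) = res C (src e \<inter> tgt e) (supp e) (p (src e \<inter> tgt e) (g (src e) (tgt e)))"
    if e: "e \<in> snd K" for e
  proof -
    note ed = edge[OF e]
    show "b e \<in> carrier (sec B (supp e))"
      using ed Z(3) by (simp add: b_def)
    show "p (supp e) (b e) = res C (src e \<inter> tgt e) (supp e) (p (src e \<inter> tgt e) (g (src e) (tgt e)))"
      using ed Z(2,3) by (simp add: b_def C.res_id p)
  qed
  have ib: "i (supp3 e f h) \<one>\<^bsub>sec A (supp3 e f h)\<^esub> = coboundary2 B b e f h" if tr: "triangle K e f h" for e f h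
  proof -
    note d = triangleD[OF tr] and sK = triangle_supp[OF K tr]
    note ed = edge[OF d(1)] edge[OF d(2)] edge[OF d(3)]
    define S where "S = supp3 e f h"
    note S = sK[folded S_def]
    have sub: "S \<subseteq> src e \<inter> tgt e \<inter> tgt f" using S ed by auto
    have "res B (supp e) S (b e) \<otimes>\<^bsub>sec B S\<^esub> res B (supp f) S (b f) = res B (supp h) S (b h)"
      unfolding b_def ed d(4-6) using B.Z1_restrict[OF g ed(1,2,5) S(1) sub] d(5) by simp
    moreover have "res B (supp h) S (b h) \<in> carrier (sec B S)"
      by (rule B.res_closed[OF S(4) S(1) S(7) b(1)[OF d(3)]])
    moreover have "i S \<one>\<^bsub>sec A S\<^esub> = \<one>\<^bsub>sec B S\<^esub>"
      by (rule presheaf_hom_one[OF i_hom A.presheaf_of_groups_axioms B.presheaf_of_groups_axioms S(1)])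
    ultimately show ?thesis
      unfolding coboundary2_def Let_def S_def[symmetric]
      by (simp add: group.r_inv[OF B.group_sec[OF S(1)]])
  qed
  obtain \<N> v w where cov: "open_cover X \<N>"
    and v: "\<And>N. N \<in> \<N> \<Longrightarrow> v N \<in> \<V>" "\<And>N. N \<in> \<N> \<Longrightarrow> N \<subseteq> v N"
    and w': "\<And>N. N \<in> \<N> \<Longrightarrow> w N \<in> fst M" "\<And>N. N \<in> \<N> \<Longrightarrow> N \<subseteq> w N"
    by (rule open_cover_common_refinement[OF Z(1) is_hypercoverD(1)[OF M]]) (rule that)
  have w: "w N \<in> fst M \<and> N \<subseteq> w N" if "N \<in> \<N>" for N using w' that by simp
  obtain N \<rho> where N: "is_hypercover X N" "fst N = \<N>" and NM: "hyper_refinement N M w \<rho>"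
    using hypercover_pullback[OF M cov w] by blast
  define \<kappa> where "\<kappa> e = (v (src e), v (tgt e), v (src e) \<inter> v (tgt e))" for e :: "'x edge"
  have NK: "hyper_refinement N K v \<kappa>"
    unfolding hyper_refinement_def
  proof (intro conjI ballI)
    fix U assume "U \<in> fst N"
    then show "v U \<in> fst K" "U \<subseteq> v U" using v N(2) by (simp_all add: K_def)
  next
    fix e assume e: "e \<in> snd N"
    note h = is_hypercoverD(3-7)[OF N(1) e]
    note m = h(1,2)[unfolded N(2)]
    show "\<kappa> e \<in> snd K" using v(1)[OF m(1)] v(1)[OF m(2)] by (auto simp: \<kappa>_def K_def)
    show "src (\<kappa> e) = v (src e)" "tgt (\<kappa> e) = v (tgt e)" by (simp_all add: \<kappa>_def)
    show "supp e \<subseteq> supp (\<kappa> e)" using v(2)[OF m(1)] v(2)[OF m(2)] h(4,5) unfolding \<kappa>_def snd_conv by blast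
  qed
  have "((K, \<lambda>e f g. \<one>\<^bsub>sec A (supp3 e f g)\<^esub>), (L, b')) \<in> cohom2 X A"
    unfolding cohom2_iff
  proof (intro conjI exI)
    show "(K, \<lambda>e f g. \<one>\<^bsub>sec A (supp3 e f g)\<^esub>) \<in> Z2 X A" by (rule A.Z2_one[OF K])
    show "hyper_refinement N L (\<lambda>U. s0 (w U)) (\<lambda>e. s (\<rho> e))" by (rule hyper_refinement_comp[OF refL NM])
    show "\<forall>e\<in>snd N. res A (supp (\<rho> e)) (supp e) (l (\<rho> e)) \<in> carrier (sec A (supp e))"
      using is_hypercoverD(5)[OF N(1)] hyper_refinementD(3,6)[OF NM] is_hypercoverD(5)[OF M] l by simp
    show "\<forall>e f g. triangle N e f g \<longrightarrow>
        pullback2 A \<kappa> (\<lambda>e f g. \<one>\<^bsub>sec A (supp3 e f g)\<^esub>) e f g =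
        pullback2 A (\<lambda>e. s (\<rho> e)) b' e f g \<otimes>\<^bsub>sec A (supp3 e f g)\<^esub>
          coboundary2 A (\<lambda>e. res A (supp (\<rho> e)) (supp e) (l (\<rho> e))) e f g"
    proof (intro allI impI)
      fix e f h assume tr: "triangle N e f h"
      note trM = triangle_refine[OF NM tr]
      define S where "S = supp3 e f h"
      define T where "T = supp3 (\<rho> e) (\<rho> f) (\<rho> h)"
      have S: "openin X S" and T: "openin X T" and ST: "S \<subseteq> T"
        unfolding S_def T_def using triangle_supp(1)[OF N(1) tr] triangle_supp(1)[OF M trM] supp3_refine[OF NM tr] .
      have "\<one>\<^bsub>sec A S\<^esub> = res A T S \<one>\<^bsub>sec A T\<^esub>" using S T ST by simp
      also have "\<dots> = res A T S (pullback2 A s b' (\<rho> e) (\<rho> f) (\<rho> h) \<otimes>\<^bsub>sec A T\<^esub> coboundary2 A l (\<rho> e) (\<rho> f) (\<rho> h))"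
        unfolding T_def eq[OF trM, symmetric] A.pullback2_one[OF is_hypercover_trivial MT M trM] ..
      also have "\<dots> = pullback2 A \<rho> (pullback2 A s b') e f h \<otimes>\<^bsub>sec A S\<^esub> pullback2 A \<rho> (coboundary2 A l) e f h"
        unfolding pullback2_def[of A \<rho>] S_def[symmetric] T_def[symmetric]
        by (rule A.res_mult[OF T S ST A.pullback2_closed[OF L refL M trM, folded T_def]
              A.coboundary2_closed[OF M l trM, folded T_def]])
      finally show "pullback2 A \<kappa> (\<lambda>e f g. \<one>\<^bsub>sec A (supp3 e f g)\<^esub>) e f h =
        pullback2 A (\<lambda>e. s (\<rho> e)) b' e f h \<otimes>\<^bsub>sec A (supp3 e f h)\<^esub>
          coboundary2 A (\<lambda>e. res A (supp (\<rho> e)) (supp e) (l (\<rho> e))) e f h"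
        using A.pullback2_one[OF K NK N(1) tr] A.pullback2_comp[OF L' M N(1) Z2D(2)[OF L] refL NM tr]
          A.coboundary2_pullback[OF M N(1) NM l tr] by (simp add: S_def)
    qed
  qed (rule L N NK)+
  moreover have "((\<V>, \<lambda>U V. p (U \<inter> V) (g U V)), (fst K, \<lambda>U V. p (U \<inter> V) (g U V))) \<in> cohom1 X C"
    unfolding K_def fst_conv by (rule C.cohom1_cong[OF pg pg refl])
  ultimately show ?thesis
    unfolding connecting1_iff yL
    by (intro exI[of _ K] exI[of _ "\<lambda>U V. p (U \<inter> V) (g U V)"] exI[of _ "\<lambda>e f g. \<one>\<^bsub>sec A (supp3 e f g)\<^esub>"]
        exI[of _ b] conjI ballI allI impI A.Z2_one[OF K] b ib) (auto simp: yL)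
qed

theorem connecting1_of_lift:
  assumes "(\<V>, g) \<in> Z1 X B"
  shows "connecting1 X A B C i p (cohom1 X C `` {(\<V>, \<lambda>U V. p (U \<inter> V) (g U V))}) = H2_zero X A"
  using connecting1_of_lift_subset[OF assms] connecting1_of_lift_superset[OF assms] by blast

end

section \<open>The primary complex of an AQ central series\<close>

lemma inv_sub_presheaf:
  assumes "sheaf_of_normal_subgroups X G S" "presheaf_of_groups X G" "openin X U" "s \<in> S U"
  shows "inv\<^bsub>sec (sub_presheaf G S) U\<^esub> s = inv\<^bsub>sec G U\<^esub> s"
  using group.m_inv_consistent[OF presheaf_of_groups.group_sec[OF assms(2,3)], of "S U" s]
    sheaf_of_normal_subgroupsD(1)[OF assms(1,3)] assms(4) by (simp add: normal_def)

lemma Z1_sub_presheaf: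
  assumes "(\<U>, g) \<in> Z1 X (sub_presheaf G S)" "\<And>U V. U \<in> \<U> \<Longrightarrow> V \<in> \<U> \<Longrightarrow> g U V \<in> S' (U \<inter> V)"
  shows "(\<U>, g) \<in> Z1 X (sub_presheaf G S')"
  using assms unfolding Z1_def by simp

locale aq_series =
  fixes X :: "'x topology" and G :: "('x, 'g) presheaf" and H :: "nat \<Rightarrow> 'x set \<Rightarrow> 'g set"
  assumes central_series: "AQ_central_series X G H"
begin

lemma normal_series: "AQ_normal_series X G H"
  using central_series by (simp add: AQ_central_series_def)

lemma sheaf_G: "sheaf_of_groups X G"
  using normal_series by (simp add: AQ_normal_series_def)

lemma presheaf_G: "presheaf_of_groups X G"
  using sheaf_G by (rule sheaf_of_groups.axioms)

lemma normal_subsheaf: "sheaf_of_normal_subgroups X G (H j)"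
  using normal_series by (simp add: AQ_normal_series_def)

lemma decreasing: "m \<le> n \<Longrightarrow> openin X U \<Longrightarrow> H n U \<subseteq> H m U"
proof (induction rule: dec_induct)
  case (step n)
  have "H (Suc n) U \<subseteq> H n U" using normal_series step.prems by (simp add: AQ_normal_series_def)
  also have "\<dots> \<subseteq> H m U" by (rule step.IH[OF step.prems])
  finally show ?case .
qed simp

lemma presheaf_sub: "presheaf_of_groups X (sub_presheaf G (H j))"
  by (rule sheaf_of_normal_subgroupsD(5)[OF normal_subsheaf])

lemma quotient: "m \<le> n \<Longrightarrow> sheaf_quotient X G (H m) (H n)"
  by (intro sheaf_quotient.intro sheaf_quotient_axioms.intro sheaf_G normal_subsheaf decreasing)

lemma quotient_map:
  "\<lbrakk>m \<le> n; m' \<le> n'; m' \<le> m; n' \<le> n\<rbrakk> \<Longrightarrow> sheaf_quotient_map X G (H m) (H n) (H m') (H n')"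
  by (intro sheaf_quotient_map.intro sheaf_quotient_map_axioms.intro quotient decreasing)

lemma presheaf_series_quot: "m \<le> n \<Longrightarrow> presheaf_of_groups X (series_quot X G H m n)"
  by (rule sheaf_quotient.presheaf_quot[OF quotient])

lemma presheaf_lin: "presheaf_of_groups X (lin X G H j)"
  unfolding lin_def by (rule presheaf_series_quot) simp

lemma central_index:
  assumes "0 < j"
  shows "central_index X G H j < j" "central_at X G H (central_index X G H j) j"
proof -
  have "\<exists>k. k < j \<and> central_at X G H k j"
    using central_series assms unfolding AQ_central_series_def by blast
  from someI_ex[OF this] show "central_index X G H j < j" "central_at X G H (central_index X G H j) j"
    by (simp_all add: central_index_def)
qed

lemma central_extension:
  assumes k: "k \<le> j" and c: "central_at X G H k j"
  shows "central_extension X (lin X G H j) (series_quot X G H k (Suc j)) (series_quot X G H k j)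
    (series_map X G H k (Suc j)) (series_map X G H k j)"
proof -
  interpret sheaf_quotient_sequence X G "H k" "H j" "H (Suc j)"
    by (intro sheaf_quotient_sequence.intro quotient_map) (use k in auto)
  show ?thesis
  proof (intro central_extension.intro central_extension_axioms.intro)
    show "presheaf_of_groups X (lin X G H j)" by (rule presheaf_lin)
    show "presheaf_of_groups X (series_quot X G H k (Suc j))" "presheaf_of_groups X (series_quot X G H k j)"
      using k by (simp_all add: presheaf_series_quot)
    show "presheaf_hom X (lin X G H j) (series_quot X G H k (Suc j)) (series_map X G H k (Suc j))"
      unfolding lin_def by (rule inc.quot_map_hom)
    show "presheaf_hom X (series_quot X G H k (Suc j)) (series_quot X G H k j) (series_map X G H k j)"
      by (rule prj.quot_map_hom)
  next
    fix U s t assume "openin X U" "s \<in> carrier (sec (lin X G H j) U)" "t \<in> carrier (sec (lin X G H j) U)"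
      "series_map X G H k (Suc j) U s = series_map X G H k (Suc j) U t"
    then show "s = t" unfolding lin_def by (rule inc_inj_eq)
  next
    fix U b assume "openin X U" "b \<in> carrier (sec (series_quot X G H k (Suc j)) U)"
      "series_map X G H k j U b = \<one>\<^bsub>sec (series_quot X G H k j) U\<^esub>"
    then show "\<exists>t\<in>carrier (sec (lin X G H j) U). series_map X G H k (Suc j) U t = b"
      unfolding lin_def by (rule exact)
  next
    fix U c x assume A: "openin X U" "c \<in> carrier (sec (series_quot X G H k j) U)" "x \<in> U"
    show "\<exists>V b. openin X V \<and> x \<in> V \<and> V \<subseteq> U \<and> b \<in> carrier (sec (series_quot X G H k (Suc j)) V) \<and>
          series_map X G H k j V b = res (series_quot X G H k j) U V c"
      by (rule prj_locally_surj[OF A(2,3)]) (intro exI conjI)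
  next
    fix U t b assume "openin X U" "t \<in> carrier (sec (lin X G H j) U)"
      "b \<in> carrier (sec (series_quot X G H k (Suc j)) U)"
    then show "series_map X G H k (Suc j) U t \<otimes>\<^bsub>sec (series_quot X G H k (Suc j)) U\<^esub> b =
        b \<otimes>\<^bsub>sec (series_quot X G H k (Suc j)) U\<^esub> series_map X G H k (Suc j) U t"
      using c unfolding central_at_def by blast
  qed
qed

lemma quot_proj_hom: "m \<le> n \<Longrightarrow>
    presheaf_hom X (sub_presheaf G (H m)) (series_quot X G H m n) (quot_proj X G (H m) (H n))"
  by (rule sheaf_quotient.quot_proj_hom[OF quotient])

lemma series_map_proj:
  "\<lbrakk>m \<le> n; m' \<le> n'; m' \<le> m; n' \<le> n; openin X U; s \<in> H m U\<rbrakk> \<Longrightarrow>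
    series_map X G H m' n' U (quot_proj X G (H m) (H n) U s) = quot_proj X G (H m') (H n') U s"
  by (rule sheaf_quotient_map.quot_map_proj[OF quotient_map])

lemma omega_class:
  assumes "(\<U>, g) \<in> Z1 X (sub_presheaf G (H j))"
  shows "omega X G H j (cohom1 X (sub_presheaf G (H j)) `` {(\<U>, g)}) =
    cohom1 X (lin X G H j) `` {(\<U>, \<lambda>U V. quot_proj X G (H j) (H (Suc j)) (U \<inter> V) (g U V))}"
  unfolding omega_def
  by (rule H1_map_class[OF quot_proj_hom[of j "Suc j", folded lin_def] presheaf_sub presheaf_lin assms]) simp

text \<open>A torsor under \<open>H j\<close> gives a cocycle of \<open>H k/H (j + 2)\<close> lifting the image of its linearisation
  in \<open>H k/H (j + 1)\<close>, where \<open>k\<close> is the central index.\<close>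

theorem primary1_omega:
  assumes h: "h \<in> H1 X (sub_presheaf G (H j))"
  shows "primary1 X G H j (omega X G H j h) = H2_zero X (lin X G H (Suc j))"
proof -
  let ?k = "central_index X G H (Suc j)"
  have k: "?k \<le> j" using central_index(1)[of "Suc j"] by simp
  have c: "central_at X G H ?k (Suc j)" by (rule central_index(2)) simp
  obtain \<U> g where g: "(\<U>, g) \<in> Z1 X (sub_presheaf G (H j))" and h': "h = cohom1 X (sub_presheaf G (H j)) `` {(\<U>, g)}"
    using h unfolding H1_def by (auto elim!: quotientE)
  interpret central_extension X "lin X G H (Suc j)" "series_quot X G H ?k (j + 2)" "series_quot X G H ?k (Suc j)"
    "series_map X G H ?k (j + 2)" "series_map X G H ?k (Suc j)"
    using central_extension[OF _ c] k by simp
  note gU = Z1D[OF g]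
  define a where "a U V = quot_proj X G (H j) (H (Suc j)) (U \<inter> V) (g U V)" for U V
  define b where "b U V = quot_proj X G (H ?k) (H (j + 2)) (U \<inter> V) (g U V)" for U V
  have gk: "(\<U>, g) \<in> Z1 X (sub_presheaf G (H ?k))"
    by (rule Z1_sub_presheaf[OF g], rule subsetD[OF decreasing[OF k openin_Int[OF gU(2) gU(2)]]])
      (use gU(3) in simp_all)
  have b: "(\<U>, b) \<in> Z1 X (series_quot X G H ?k (j + 2))"
    unfolding b_def by (rule Z1_map[OF quot_proj_hom presheaf_sub gk]) (use k in simp)
  have a: "(\<U>, a) \<in> Z1 X (lin X G H j)"
    unfolding a_def lin_def by (rule Z1_map[OF quot_proj_hom presheaf_sub g]) simp
  have sm: "presheaf_hom X (lin X G H j) (series_quot X G H ?k (Suc j)) (series_map X G H ?k (Suc j))"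
    unfolding lin_def by (rule sheaf_quotient_map.quot_map_hom[OF quotient_map]) (use k in simp_all)
  have "H1_map X (series_quot X G H ?k (Suc j)) (series_map X G H ?k (Suc j)) (omega X G H j h) =
      cohom1 X (series_quot X G H ?k (Suc j)) `` {(\<U>, \<lambda>U V. series_map X G H ?k (Suc j) (U \<inter> V) (a U V))}"
    unfolding h' omega_class[OF g] a_def[symmetric] by (rule H1_map_class[OF sm presheaf_lin _ a]) (rule C.presheaf_of_groups_axioms)
  also have "\<dots> = cohom1 X (series_quot X G H ?k (Suc j)) `` {(\<U>, \<lambda>U V. series_map X G H ?k (Suc j) (U \<inter> V) (b U V))}"
  proof (rule equiv_class_eq[OF C.equiv_cohom1 C.cohom1_cong])
    show "(\<U>, \<lambda>U V. series_map X G H ?k (Suc j) (U \<inter> V) (a U V)) \<in> Z1 X (series_quot X G H ?k (Suc j))"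
      by (rule Z1_map[OF sm presheaf_lin a])
    show "(\<U>, \<lambda>U V. series_map X G H ?k (Suc j) (U \<inter> V) (b U V)) \<in> Z1 X (series_quot X G H ?k (Suc j))"
      by (rule Z1_map[OF p_hom B.presheaf_of_groups_axioms b])
    fix U V assume UV: "U \<in> \<U>" "V \<in> \<U>"
    then have "openin X (U \<inter> V)" "g U V \<in> H j (U \<inter> V)" "g U V \<in> H ?k (U \<inter> V)"
      using gU Z1D(3)[OF gk] by auto
    then show "series_map X G H ?k (Suc j) (U \<inter> V) (a U V) = series_map X G H ?k (Suc j) (U \<inter> V) (b U V)"
      using k by (simp add: a_def b_def series_map_proj)
  qed
  finally show ?thesis
    unfolding primary1_def Let_def using connecting1_of_lift[OF b] by simp
qed

text \<open>Sections \<open>s U\<close> of \<open>H j\<close> representing \<open>\<sigma>\<close> locally give the torsor \<open>g U V = (s U)\<^sup>-\<^sup>1 (s V)\<close> under \<open>H (j + 1)\<close>,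
  and, for the central index \<open>k\<close>, the classes of the \<open>s U\<close> in \<open>H k/H (j + 2)\<close> are admissible choices in the construction
  of the connecting map.\<close>

theorem primary0_integrates:
  assumes \<sigma>: "\<sigma> \<in> H0 X (lin X G H j)" and \<theta>: "\<theta> \<in> H1 X (lin X G H (Suc j))" "\<theta> = primary0 X G H j \<sigma>"
  shows "\<exists>h\<in>H1 X (sub_presheaf G (H (Suc j))). omega X G H (Suc j) h = \<theta>"
proof -
  let ?k = "central_index X G H (Suc j)"
  have k: "?k \<le> j" using central_index(1)[of "Suc j"] by simp
  interpret Q: sheaf_quotient X G "H j" "H (Suc j)" by (rule quotient) simp
  interpret L: presheaf_of_groups X "lin X G H j" by (rule presheaf_lin)
  interpret Hj: presheaf_of_groups X "sub_presheaf G (H j)" by (rule presheaf_sub)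
  interpret B: presheaf_of_groups X "series_quot X G H ?k (j + 2)"
    by (rule presheaf_series_quot) (use k in simp)
  interpret Hk: presheaf_of_groups X "sub_presheaf G (H ?k)" by (rule presheaf_sub)
  have pj: "presheaf_hom X (sub_presheaf G (H j)) (lin X G H j) (quot_proj X G (H j) (H (Suc j)))"
    unfolding lin_def by (rule quot_proj_hom) simp
  have pk: "presheaf_hom X (sub_presheaf G (H ?k)) (series_quot X G H ?k (j + 2)) (quot_proj X G (H ?k) (H (j + 2)))"
    by (rule quot_proj_hom) (use k in simp)
  define \<U> where "\<U> = {U. openin X U \<and>
    (\<exists>s. s \<in> H j U \<and> quot_proj X G (H j) (H (Suc j)) U s = res (lin X G H j) (topspace X) U \<sigma>)}"
  have "\<forall>U\<in>\<U>. \<exists>s. s \<in> H j U \<and> quot_proj X G (H j) (H (Suc j)) U s = res (lin X G H j) (topspace X) U \<sigma>"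
    by (simp add: \<U>_def)
  from bchoice[OF this] obtain s where s: "\<And>U. U \<in> \<U> \<Longrightarrow> s U \<in> H j U"
    "\<And>U. U \<in> \<U> \<Longrightarrow> quot_proj X G (H j) (H (Suc j)) U (s U) = res (lin X G H j) (topspace X) U \<sigma>" by blast
  have op: "openin X U" if "U \<in> \<U>" for U using that by (simp add: \<U>_def)
  have cov: "open_cover X \<U>"
  proof -
    have "\<exists>U\<in>\<U>. x \<in> U" if x: "x \<in> topspace X" for x
    proof -
      obtain V t where "openin X V" "x \<in> V" "t \<in> H j V"
        "res (lin X G H j) (topspace X) V \<sigma> = quot_proj X G (H j) (H (Suc j)) V t"
        using Q.quot_proj_locally_surj[OF \<sigma>[unfolded H0_def lin_def] x] unfolding lin_def by metis
      then have "V \<in> \<U>" unfolding \<U>_def by auto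
      then show ?thesis using \<open>x \<in> V\<close> by blast
    qed
    moreover have "U \<subseteq> topspace X" if "U \<in> \<U>" for U using op[OF that] by (rule openin_subset)
    ultimately have "\<Union>\<U> = topspace X" by blast
    then show ?thesis using op by (simp add: open_cover_def)
  qed
  define g where "g U V = inv\<^bsub>sec (sub_presheaf G (H j)) (U \<inter> V)\<^esub> (res (sub_presheaf G (H j)) U (U \<inter> V) (s U))
      \<otimes>\<^bsub>sec (sub_presheaf G (H j)) (U \<inter> V)\<^esub> res (sub_presheaf G (H j)) V (U \<inter> V) (s V)" for U V
  have gj: "(\<U>, g) \<in> Z1 X (sub_presheaf G (H j))"
    unfolding g_def by (rule Hj.Z1_coboundary[OF cov]) (use s in simp)
  have rs: "res G U (U \<inter> V) (s U) \<in> H j (U \<inter> V)" "res G V (U \<inter> V) (s V) \<in> H j (U \<inter> V)"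
    if "U \<in> \<U>" "V \<in> \<U>" for U V
    using that op s sheaf_of_normal_subgroupsD(3)[OF normal_subsheaf] by simp_all
  have gS: "g U V \<in> H (Suc j) (U \<inter> V)" if UV: "U \<in> \<U>" "V \<in> \<U>" for U V
  proof -
    let ?O = "U \<inter> V"
    have o: "openin X ?O" using UV op by simp
    interpret h: group_hom "sec (sub_presheaf G (H j)) ?O" "sec (lin X G H j) ?O" "quot_proj X G (H j) (H (Suc j)) ?O"
      by (rule presheaf_hom_group_hom[OF pj presheaf_sub presheaf_lin o])
    have r: "quot_proj X G (H j) (H (Suc j)) ?O (res G W ?O (s W)) = res (lin X G H j) (topspace X) ?O \<sigma>"
      if W: "W \<in> \<U>" "?O \<subseteq> W" for W
      using presheaf_homD(3)[OF pj op[OF W(1)] o W(2), of "s W"] s[OF W(1)] \<sigma>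
        L.res_comp[OF openin_topspace op[OF W(1)] o W(2) openin_subset[OF op[OF W(1)]], of \<sigma>]
      by (simp add: H0_def)
    have "quot_proj X G (H j) (H (Suc j)) ?O (g U V) =
        inv\<^bsub>sec (lin X G H j) ?O\<^esub> (res (lin X G H j) (topspace X) ?O \<sigma>) \<otimes>\<^bsub>sec (lin X G H j) ?O\<^esub>
        res (lin X G H j) (topspace X) ?O \<sigma>"
      unfolding g_def using rs[OF UV] r[OF UV(1)] r[OF UV(2)] h.hom_mult h.hom_inv h.G.inv_closed by simp
    also have "\<dots> = \<one>\<^bsub>sec (lin X G H j) ?O\<^esub>"
      using \<sigma> o openin_subset[OF o] by (intro h.H.l_inv) (simp add: H0_def)
    finally show ?thesis
      using Q.quot_proj_eq_one_iff[OF o, of "g U V"] Z1D(3)[OF gj UV] by (simp add: lin_def)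
  qed
  have g: "(\<U>, g) \<in> Z1 X (sub_presheaf G (H (Suc j)))"
    by (rule Z1_sub_presheaf[OF gj gS])
  define a where "a U V = quot_proj X G (H (Suc j)) (H (Suc (Suc j))) (U \<inter> V) (g U V)" for U V
  define b where "b U = quot_proj X G (H ?k) (H (j + 2)) U (s U)" for U
  have sk: "s U \<in> H ?k U" if "U \<in> \<U>" for U using s(1)[OF that] decreasing[OF k op[OF that]] by blast
  have a: "(\<U>, a) \<in> Z1 X (lin X G H (Suc j))"
    unfolding a_def lin_def by (rule Z1_map[OF quot_proj_hom presheaf_sub g]) simp
  have b: "b U \<in> carrier (sec (series_quot X G H ?k (j + 2)) U)"
    "series_map X G H ?k (Suc j) U (b U) =
      res (series_quot X G H ?k (Suc j)) (topspace X) U (series_map X G H ?k (Suc j) (topspace X) \<sigma>)"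
    if U: "U \<in> \<U>" for U
  proof -
    show "b U \<in> carrier (sec (series_quot X G H ?k (j + 2)) U)"
      unfolding b_def by (rule presheaf_homD(1)[OF pk op[OF U]]) (use sk[OF U] in simp)
    have sm: "presheaf_hom X (lin X G H j) (series_quot X G H ?k (Suc j)) (series_map X G H ?k (Suc j))"
      unfolding lin_def by (rule sheaf_quotient_map.quot_map_hom[OF quotient_map]) (use k in simp_all)
    have "series_map X G H ?k (Suc j) U (b U) = series_map X G H ?k (Suc j) U (quot_proj X G (H j) (H (Suc j)) U (s U))"
      unfolding b_def using k op[OF U] sk[OF U] s(1)[OF U] by (simp add: series_map_proj)
    also have "\<dots> = res (series_quot X G H ?k (Suc j)) (topspace X) U (series_map X G H ?k (Suc j) (topspace X) \<sigma>)"
      unfolding s(2)[OF U]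
      by (rule presheaf_homD(3)[OF sm openin_topspace op[OF U] openin_subset[OF op[OF U]] \<sigma>[unfolded H0_def]])
    finally show "series_map X G H ?k (Suc j) U (b U) =
      res (series_quot X G H ?k (Suc j)) (topspace X) U (series_map X G H ?k (Suc j) (topspace X) \<sigma>)" .
  qed
  have ab: "series_map X G H ?k (j + 2) (U \<inter> V) (a U V) =
      inv\<^bsub>sec (series_quot X G H ?k (j + 2)) (U \<inter> V)\<^esub> (res (series_quot X G H ?k (j + 2)) U (U \<inter> V) (b U))
      \<otimes>\<^bsub>sec (series_quot X G H ?k (j + 2)) (U \<inter> V)\<^esub> res (series_quot X G H ?k (j + 2)) V (U \<inter> V) (b V)"
    if UV: "U \<in> \<U>" "V \<in> \<U>" for U V
  proof -
    let ?O = "U \<inter> V"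
    have o: "openin X ?O" using UV op by simp
    interpret h: group_hom "sec (sub_presheaf G (H ?k)) ?O" "sec (series_quot X G H ?k (j + 2)) ?O"
      "quot_proj X G (H ?k) (H (j + 2)) ?O"
      by (rule presheaf_hom_group_hom[OF pk presheaf_sub B.presheaf_of_groups_axioms o])
    have rk: "res G U ?O (s U) \<in> H ?k ?O" "res G V ?O (s V) \<in> H ?k ?O"
      using rs[OF UV] decreasing[OF k o] by auto
    have rb: "quot_proj X G (H ?k) (H (j + 2)) ?O (res G W ?O (s W)) = res (series_quot X G H ?k (j + 2)) W ?O (b W)"
      if W: "W \<in> \<U>" "?O \<subseteq> W" for W
      unfolding b_def using presheaf_homD(3)[OF pk op[OF W(1)] o W(2), of "s W"] sk[OF W(1)] by simp
    have gk: "g U V = inv\<^bsub>sec (sub_presheaf G (H ?k)) ?O\<^esub> (res G U ?O (s U))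
        \<otimes>\<^bsub>sec (sub_presheaf G (H ?k)) ?O\<^esub> res G V ?O (s V)"
      using inv_sub_presheaf[OF normal_subsheaf[of j] presheaf_G o rs(1)[OF UV]] inv_sub_presheaf[OF normal_subsheaf[of ?k] presheaf_G o rk(1)]
      by (simp add: g_def)
    have "series_map X G H ?k (j + 2) ?O (a U V) = quot_proj X G (H ?k) (H (j + 2)) ?O (g U V)"
      unfolding a_def using k gS[OF UV] o by (simp add: series_map_proj)
    also have "\<dots> = inv\<^bsub>sec (series_quot X G H ?k (j + 2)) ?O\<^esub> (quot_proj X G (H ?k) (H (j + 2)) ?O (res G U ?O (s U)))
        \<otimes>\<^bsub>sec (series_quot X G H ?k (j + 2)) ?O\<^esub> quot_proj X G (H ?k) (H (j + 2)) ?O (res G V ?O (s V))"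
      unfolding gk using rk h.hom_mult h.hom_inv h.G.inv_closed by simp
    finally show ?thesis using rb[OF UV(1)] rb[OF UV(2)] by simp
  qed
  \<comment> \<open>The connecting map is the union of the classes obtained from all choices. Since \<open>\<theta>\<close> is a
    single class, it equals each one of them.\<close>
  have "cohom1 X (lin X G H (Suc j)) `` {(\<U>, a)} \<subseteq> \<theta>"
    unfolding \<theta>(2) primary0_def Let_def connecting0_def using a b ab by blast
  moreover have "(\<U>, a) \<in> cohom1 X (lin X G H (Suc j)) `` {(\<U>, a)}"
    using presheaf_of_groups.cohom1_cong[OF presheaf_lin a a] by simp
  ultimately have "(\<U>, a) \<in> \<theta>" by blast
  then have "\<theta> = cohom1 X (lin X G H (Suc j)) `` {(\<U>, a)}"
    using \<theta>(1) presheaf_of_groups.equiv_cohom1[OF presheaf_lin, of "Suc j"]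
    unfolding H1_def by (auto elim!: quotientE dest: equiv_class_eq)
  then have "omega X G H (Suc j) (cohom1 X (sub_presheaf G (H (Suc j))) `` {(\<U>, g)}) = \<theta>"
    unfolding omega_class[OF g] a_def by simp
  moreover have "cohom1 X (sub_presheaf G (H (Suc j))) `` {(\<U>, g)} \<in> H1 X (sub_presheaf G (H (Suc j)))"
    unfolding H1_def using g by (rule quotientI)
  ultimately show ?thesis by blast
qed

lemma H1_zero_integrates:
  "\<exists>h\<in>H1 X (sub_presheaf G (H j)). omega X G H j h = H1_zero X (lin X G H j)"
proof -
  have one: "({topspace X}, \<lambda>U V. \<one>\<^bsub>sec F (U \<inter> V)\<^esub>) \<in> Z1 X F" if "presheaf_of_groups X F"
    for F :: "('x, 'h) presheaf"
  proof -
    interpret presheaf_of_groups X F by fact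
    show ?thesis by (rule Z1I) auto
  qed
  let ?S = "sub_presheaf G (H j)"
  let ?o = "({topspace X}, \<lambda>U V. \<one>\<^bsub>sec ?S (U \<inter> V)\<^esub>)"
  have pj: "presheaf_hom X ?S (lin X G H j) (quot_proj X G (H j) (H (Suc j)))"
    unfolding lin_def by (rule quot_proj_hom) simp
  have Z: "?o \<in> Z1 X ?S" by (rule one[OF presheaf_sub])
  have "omega X G H j (cohom1 X ?S `` {?o}) = H1_zero X (lin X G H j)"
    unfolding omega_class[OF Z] H1_zero_def
  proof (rule equiv_class_eq[OF presheaf_of_groups.equiv_cohom1[OF presheaf_lin]
        presheaf_of_groups.cohom1_cong[OF presheaf_lin Z1_map[OF pj presheaf_sub Z] one[OF presheaf_lin]]])
    fix U V assume "U \<in> {topspace X}" "V \<in> {topspace X}"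
    then have "openin X (U \<inter> V)" by simp
    then show "quot_proj X G (H j) (H (Suc j)) (U \<inter> V) \<one>\<^bsub>sec ?S (U \<inter> V)\<^esub> = \<one>\<^bsub>sec (lin X G H j) (U \<inter> V)\<^esub>"
      by (rule presheaf_hom_one[OF pj presheaf_sub presheaf_lin])
  qed
  then show ?thesis unfolding H1_def using quotientI[OF Z] by blast
qed

end

theorem theorem4p7:
  fixes X :: "'x topology" and G :: "('x, 'g) presheaf" and H :: "nat \<Rightarrow> 'x set \<Rightarrow> 'g set"
    and j :: nat and \<theta> :: "('x, ('x, 'g) quot_sec) cochain1 set"
  assumes "AQ_central_series X G H"
    and "primary_H1_vanishes X G H"
    and "\<theta> \<in> H1 X (lin X G H j)"
  shows "(\<exists>h \<in> H1 X (sub_presheaf G (H j)). omega X G H j h = \<theta>) \<longleftrightarrow>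
         primary1 X G H j \<theta> = H2_zero X (lin X G H (Suc j))"
proof -
  interpret aq_series X G H using assms(1) by (rule aq_series.intro)
  show ?thesis
  proof
    assume "\<exists>h \<in> H1 X (sub_presheaf G (H j)). omega X G H j h = \<theta>"
    then show "primary1 X G H j \<theta> = H2_zero X (lin X G H (Suc j))" using primary1_omega by blast
  next
    assume "primary1 X G H j \<theta> = H2_zero X (lin X G H (Suc j))"
    with assms(3) have "\<theta> \<in> {\<theta> \<in> H1 X (lin X G H j). primary1 X G H j \<theta> = H2_zero X (lin X G H (Suc j))}"
      by simp
    also have "\<dots> = (case j of 0 \<Rightarrow> {H1_zero X (lin X G H 0)}
                 | Suc i \<Rightarrow> primary0 X G H i ` H0 X (lin X G H i))"
      using assms(2) by (simp only: primary_H1_vanishes_def)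
    finally have im: "\<theta> \<in> \<dots>" .
    show "\<exists>h \<in> H1 X (sub_presheaf G (H j)). omega X G H j h = \<theta>"
    proof (cases j)
      case 0
      then show ?thesis using im H1_zero_integrates[of 0] by simp
    next
      case (Suc i)
      then obtain \<sigma> where "\<sigma> \<in> H0 X (lin X G H i)" "\<theta> = primary0 X G H i \<sigma>" using im by auto
      then show ?thesis using primary0_integrates assms(3) Suc by blast
    qed
  qed
qed

end
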